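(* Let $V\in C^2(\mathbb{R}^d,\mathbb{R})$ be coercive and let $e\in\mathbb{R}^d$ be a critical point of $V$ with $V(e)=0$ and $\min_{\mathbb{R}^d} V<0$. The following two conditions are equivalent: (1) $c_{\mathrm{lin}}<c_{\mathrm{nl}}$; (2) there exists a pushed front invading $e$ at a speed which is greater than $c_{\mathrm{lin}}$. Moreover, if these conditions hold, then the following two additional conclusions also hold: (3) there exists a pushed front invading $e$ at the speed $c_{\mathrm{nl}}$; (4) the profile of every pushed front invading $e$ at the speed $c_{\mathrm{nl}}$ is a global minimizer of the energy $\mathcal{E}_{c_{\mathrm{nl}}}[\cdot]$ in $H^1_{c_{\mathrm{nl}},e}(\mathbb{R},\mathbb{R}^d)$.
   Context: $d\ge1$ is an integer. For $u\in\mathbb{R}^d$, $u^2$ denotes $|u|^2$. Coercivity of $V$ means $\lim_{R\to+\infty}\inf_{|u|\ge R}\frac{u\cdot\nabla V(u)}{|u|^2}>0$. For $c>0$, $H^1_c(\mathbb{R},\mathbb{R}^d)$ is the set of $w\in H^1_{\mathrm{loc}}(\mathbb{R},\mathbb{R}^d)$ such that $\xi\mapsto e^{c\xi/2}w(\xi)$ and $\xi\mapsto e^{c\xi/2}w'(\xi)$ are in $L^2(\mathbb{R},\mathbb{R}^d)$; $H^1_{c,e}(\mathbb{R},\mathbb{R}^d)=\{w\in H^1_{\mathrm{loc}}: w-e\in H^1_c(\mathbb{R},\mathbb{R}^d)\}$; and for $w\in H^1_{c,e}(\mathbb{R},\mathbb{R}^d)$, $\mathcal{E}_c[w]=\int_{\mathbb{R}}e^{c\xi}\bigl(\tfrac12w'(\xi)^2+V(w(\xi))\bigr)\,d\xi\in\mathbb{R}\cup\{+\infty\}$.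 Let $\mu_1$ be the least eigenvalue of $D^2V(e)$; the maximal linear invasion speed is $c_{\mathrm{lin}}=2\sqrt{-\mu_1}$ if $\mu_1<0$ and $c_{\mathrm{lin}}=0$ if $\mu_1\ge0$. For every $c>0$ the infimum of $\mathcal{E}_c$ over $H^1_{c,e}(\mathbb{R},\mathbb{R}^d)$ is either $0$ or $-\infty$; let $\mathcal{C}_{-\infty}$ be the set of $c>0$ for which it is $-\infty$. The maximal nonlinear invasion speed is $c_{\mathrm{nl}}=\sup\mathcal{C}_{-\infty}$ (the set $\mathcal{C}_{-\infty}$ is nonempty and bounded). Travelling waves and fronts (for the system $u_t=-\nabla V(u)+u_{xx}$). Let $c>0$. A profile of a travelling wave invading $e$ at speed $c$ is a nonconstant maximal solution $\phi$ (with values in $\mathbb{R}^d$) of $\phi''=-c\phi'+\nabla V(\phi)$ whose maximal interval has the form $(T_-,+\infty)$ and with $\phi(\xi)\to e$ as $\xi\to+\infty$. It is the profile of a travelling front if moreover $T_-=-\infty$ and there is $V_{-\infty}<0$ such that the distance from $\phi(\xi)$ to $\{w:\nabla V(w)=0,\ V(w)=V_{-\infty}\}$ goes to $0$ as $\xi\to-\infty$. The front is pushed if $\phi(\xi)-e=o(e^{-c\xi/2})$ as $\xi\to+\infty$. *)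

theory Defs
  imports "HOL-Analysis.Analysis" "HOL-Library.Landau_Symbols"
begin

section \<open>The potential\<close>

definition grad :: "(real ^ 'n \<Rightarrow> real) \<Rightarrow> real ^ 'n \<Rightarrow> real ^ 'n" where
  "grad V u = (THE D. GDERIV V u :> D)"

definition hess :: "(real ^ 'n \<Rightarrow> real) \<Rightarrow> real ^ 'n \<Rightarrow> real ^ 'n ^ 'n" where
  "hess V u = matrix (frechet_derivative (grad V) (at u))"

definition C2 :: "(real ^ 'n \<Rightarrow> real) \<Rightarrow> bool" where
  "C2 V \<longleftrightarrow>
     (\<forall>u. V differentiable (at u)) \<and> (\<forall>u. grad V differentiable (at u)) \<and>
     continuous_on UNIV (hess V)"

text \<open>The infima are nondecreasing in R and may be infinite, hence the extended reals.\<close>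

definition coercive :: "(real ^ 'n \<Rightarrow> real) \<Rightarrow> bool" where
  "coercive V \<longleftrightarrow>
     (\<exists>L>0. ((\<lambda>R::real. INF u\<in>{u. norm u \<ge> R}. ereal ((u \<bullet> grad V u) / (norm u)\<^sup>2)) \<longlongrightarrow> L) at_top)"

definition least_eigenvalue :: "real ^ 'n ^ 'n \<Rightarrow> real" where
  "least_eigenvalue A = Min {\<mu>. \<exists>v. v \<noteq> 0 \<and> A *v v = \<mu> *\<^sub>R v}"

definition c_lin :: "(real ^ 'n \<Rightarrow> real) \<Rightarrow> real ^ 'n \<Rightarrow> real" where
  "c_lin V e = (let \<mu>1 = least_eigenvalue (hess V e) in if \<mu>1 < 0 then 2 * sqrt (- \<mu>1) else 0)"


section \<open>Weighted Sobolev spaces on the real line\<close>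

text \<open>Elements of these spaces are represented by functions rather than by classes modulo
  almost everywhere equality; all notions below only depend on the class.\<close>

definition L2 :: "(real \<Rightarrow> 'a::euclidean_space) \<Rightarrow> bool" where
  "L2 w \<longleftrightarrow> w \<in> borel_measurable lebesgue \<and> integrable lebesgue (\<lambda>x. (norm (w x))\<^sup>2)"

definition L2_loc :: "(real \<Rightarrow> 'a::euclidean_space) \<Rightarrow> bool" where
  "L2_loc w \<longleftrightarrow> w \<in> borel_measurable lebesgue \<and>
     (\<forall>a b. set_integrable lebesgue {a..b} (\<lambda>x. (norm (w x))\<^sup>2))"

text \<open>Test functions are compactly supported of class C1; smooth ones would give the same
  weak derivatives.\<close>

definition test_function :: "(real \<Rightarrow> real) \<Rightarrow> bool" where
  "test_function \<eta> \<longleftrightarrow> \<eta> C1_differentiable_on UNIV \<and> compact (closure {x. \<eta> x \<noteq> 0})"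

definition has_weak_derivative ::
    "(real \<Rightarrow> 'a::euclidean_space) \<Rightarrow> (real \<Rightarrow> 'a) \<Rightarrow> bool" where
  "has_weak_derivative w g \<longleftrightarrow>
     (\<forall>\<eta>. test_function \<eta> \<longrightarrow>
        (LINT x|lebesgue. deriv \<eta> x *\<^sub>R w x) = - (LINT x|lebesgue. \<eta> x *\<^sub>R g x))"

definition H1_loc :: "(real \<Rightarrow> 'a::euclidean_space) set" where
  "H1_loc = {w. L2_loc w \<and> (\<exists>g. L2_loc g \<and> has_weak_derivative w g)}"

text \<open>Some representative of the weak derivative, which is unique up to a null set.\<close>

definition weak_deriv :: "(real \<Rightarrow> 'a::euclidean_space) \<Rightarrow> real \<Rightarrow> 'a" where
  "weak_deriv w = (SOME g. L2_loc g \<and> has_weak_derivative w g)"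

definition H1_weighted :: "real \<Rightarrow> (real \<Rightarrow> 'a::euclidean_space) set" where
  "H1_weighted c = {w \<in> H1_loc.
     L2 (\<lambda>x. exp (c * x / 2) *\<^sub>R w x) \<and> L2 (\<lambda>x. exp (c * x / 2) *\<^sub>R weak_deriv w x)}"

definition H1_affine :: "real \<Rightarrow> 'a::euclidean_space \<Rightarrow> (real \<Rightarrow> 'a) set" where
  "H1_affine c e = {w \<in> H1_loc. (\<lambda>x. w x - e) \<in> H1_weighted c}"


section \<open>Energy and nonlinear invasion speed\<close>

definition energy_density ::
    "(real ^ 'n \<Rightarrow> real) \<Rightarrow> real \<Rightarrow> (real \<Rightarrow> real ^ 'n) \<Rightarrow> real \<Rightarrow> real" where
  "energy_density V c w x = exp (c * x) * ((norm (weak_deriv w x))\<^sup>2 / 2 + V (w x))"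

text \<open>The Lebesgue integral of the density as positive part minus negative part.
  For V coercive, V(e) = 0, grad V(e) = 0 and w in the affine space above, the negative part has
  finite integral, so that the value lies in the reals or is plus infinity.\<close>

definition energy ::
    "(real ^ 'n \<Rightarrow> real) \<Rightarrow> real \<Rightarrow> (real \<Rightarrow> real ^ 'n) \<Rightarrow> ereal" where
  "energy V c w =
     enn2ereal (\<integral>\<^sup>+ x. ennreal (energy_density V c w x) \<partial>lebesgue)
     - enn2ereal (\<integral>\<^sup>+ x. ennreal (- energy_density V c w x) \<partial>lebesgue)"

definition C_minus_infinity :: "(real ^ 'n \<Rightarrow> real) \<Rightarrow> real ^ 'n \<Rightarrow> real set" where
  "C_minus_infinity V e = {c. c > 0 \<and> (INF w\<in>H1_affine c e. energy V c w) = - \<infinity>}"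

definition c_nl :: "(real ^ 'n \<Rightarrow> real) \<Rightarrow> real ^ 'n \<Rightarrow> real" where
  "c_nl V e = Sup (C_minus_infinity V e)"

definition global_minimizer ::
    "(real ^ 'n \<Rightarrow> real) \<Rightarrow> real \<Rightarrow> real ^ 'n \<Rightarrow> (real \<Rightarrow> real ^ 'n) \<Rightarrow> bool" where
  "global_minimizer V c e w \<longleftrightarrow>
     w \<in> H1_affine c e \<and> (\<forall>v \<in> H1_affine c e. energy V c w \<le> energy V c v)"


section \<open>Travelling waves and fronts\<close>

definition wave_solution ::
    "(real ^ 'n \<Rightarrow> real) \<Rightarrow> real \<Rightarrow> real set \<Rightarrow> (real \<Rightarrow> real ^ 'n) \<Rightarrow> bool" where
  "wave_solution V c I \<phi> \<longleftrightarrow>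
     (\<exists>\<psi>. \<forall>x\<in>I. (\<phi> has_vector_derivative \<psi> x) (at x) \<and>
                (\<psi> has_vector_derivative (- c *\<^sub>R \<psi> x + grad V (\<phi> x))) (at x))"

definition maximal_wave_solution ::
    "(real ^ 'n \<Rightarrow> real) \<Rightarrow> real \<Rightarrow> real set \<Rightarrow> (real \<Rightarrow> real ^ 'n) \<Rightarrow> bool" where
  "maximal_wave_solution V c I \<phi> \<longleftrightarrow>
     open I \<and> is_interval I \<and> wave_solution V c I \<phi> \<and>
     (\<forall>J \<theta>. open J \<and> is_interval J \<and> I \<subseteq> J \<and> wave_solution V c J \<theta> \<and> (\<forall>x\<in>I. \<theta> x = \<phi> x)
        \<longrightarrow> J = I)"

text \<open>Only the values of the profile on its maximal interval matter; the left end of that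
  interval is allowed to be minus infinity.\<close>

definition travelling_wave_profile ::
    "(real ^ 'n \<Rightarrow> real) \<Rightarrow> real ^ 'n \<Rightarrow> real \<Rightarrow> ereal \<Rightarrow> (real \<Rightarrow> real ^ 'n) \<Rightarrow> bool" where
  "travelling_wave_profile V e c T \<phi> \<longleftrightarrow>
     c > 0 \<and> maximal_wave_solution V c {x. T < ereal x} \<phi> \<and>
     (\<exists>x y. T < ereal x \<and> T < ereal y \<and> \<phi> x \<noteq> \<phi> y) \<and>
     (\<phi> \<longlongrightarrow> e) at_top"

definition critical_points_at_level :: "(real ^ 'n \<Rightarrow> real) \<Rightarrow> real \<Rightarrow> (real ^ 'n) set" where
  "critical_points_at_level V h = {w. grad V w = 0 \<and> V w = h}"

text \<open>Nonemptiness is required because infdist to the empty set is 0, not infinity.\<close>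

definition travelling_front_profile ::
    "(real ^ 'n \<Rightarrow> real) \<Rightarrow> real ^ 'n \<Rightarrow> real \<Rightarrow> (real \<Rightarrow> real ^ 'n) \<Rightarrow> bool" where
  "travelling_front_profile V e c \<phi> \<longleftrightarrow>
     travelling_wave_profile V e c (- \<infinity>) \<phi> \<and>
     (\<exists>h<0. critical_points_at_level V h \<noteq> {} \<and>
        ((\<lambda>x. infdist (\<phi> x) (critical_points_at_level V h)) \<longlongrightarrow> 0) at_bot)"

definition pushed_front_profile ::
    "(real ^ 'n \<Rightarrow> real) \<Rightarrow> real ^ 'n \<Rightarrow> real \<Rightarrow> (real \<Rightarrow> real ^ 'n) \<Rightarrow> bool" where
  "pushed_front_profile V e c \<phi> \<longleftrightarrow>
     travelling_front_profile V e c \<phi> \<and>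
     (\<lambda>x. norm (\<phi> x - e)) \<in> o[at_top](\<lambda>x. exp (- c * x / 2))"

end

theory Submission
  imports Defs "HOL-Complex_Analysis.Great_Picard"
begin

text \<open>
  Let \<open>\<phi>\<close> be a front invading \<open>e\<close> at speed \<open>c\<close>. Along \<open>\<phi>\<close> the quantity
  \<open>exp (c' x) (\<bar>\<phi>'\<bar>\<^sup>2 / 2 - V \<phi>)\<close> has derivative
  \<open>- exp (c' x) (c' (\<bar>\<phi>'\<bar>\<^sup>2 / 2 + V \<phi>) + (c - c') \<bar>\<phi>'\<bar>\<^sup>2)\<close>. If \<open>\<phi> - e\<close> decays fast enough,
  integrating over the line gives
  \<open>c' E\<^bsub>c'\<^esub>[\<phi>] = - (c - c') \<integral> exp (c' x) \<bar>\<phi>'\<bar>\<^sup>2\<close> (\<open>wave_energy\<close>). For \<open>c' < c\<close> the decay of a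
  pushed front suffices, the energy is negative, and translation, which multiplies the energy by
  \<open>exp (c' a)\<close>, drives it to \<open>-\<infinity>\<close>; hence a pushed front cannot be faster than the nonlinear
  invasion speed (\<open>pushed_front_speed_le_c_nl\<close>), which is one implication. For
  \<open>c' = c = c_nl > c_lin\<close> the strict convexity of \<open>V u + c\<^sup>2 / 8 \<bar>u - e\<bar>\<^sup>2\<close> at \<open>e\<close> improves the decay to a
  faster exponential rate (\<open>wave_fast_decay\<close>), so the energy vanishes. Negative energy being an open
  condition on the speed (\<open>negative_energy_faster\<close>), it does not occur at \<open>c_nl\<close>, and \<open>\<phi>\<close> is a
  global minimiser (\<open>pushed_front_minimises\<close>).

  For the existence of a front at the speed \<open>c = c_nl > c_lin\<close>, write
  \<open>w = e + exp (- c x / 2) v\<close>. The weighted space becomes the ordinary Sobolev space of the line, and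
  completing the square turns the energy into
  \<open>1/2 \<integral> \<bar>v'\<bar>\<^sup>2 + \<integral> exp (c x) (V w + c\<^sup>2 / 8 \<bar>w - e\<bar>\<^sup>2)\<close> (\<open>dens_integral\<close>). The second integrand
  is positive where \<open>w\<close> is near \<open>e\<close>, precisely because \<open>c > c_lin\<close> (\<open>V_near_e\<close>), and on a left half-line
  it is at least \<open>exp (c x) min V\<close>, which is integrable. Take functions of negative energy at speeds
  increasing to \<open>c_nl\<close>, translated so that they enter a small ball around \<open>e\<close> for good at 0
  (\<open>negative_energy_normalised\<close>). Their derivatives are then bounded in \<open>L\<^sup>2\<close>, a subsequence converges
  locally uniformly, and weak lower semicontinuity (\<open>L2_weak_limit\<close>) together with Fatou's lemma
  gives a limit of energy at most 0 which is not \<open>e\<close> because of its value at 0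
  (\<open>minimiser_exists\<close>). Its first variation vanishes, so it solves the travelling wave
  equation (\<open>euler_lagrange\<close>); coercivity of \<open>V\<close> makes it bounded (\<open>wave_bounded\<close>); the Lyapunov
  function \<open>\<bar>\<phi>'\<bar>\<^sup>2 / 2 - V \<phi>\<close> makes it approach critical points at one negative level
  (\<open>wave_converges_to_critical_level\<close>); and membership in the weighted space makes the front pushed.
\<close>

section \<open>The potential\<close>

lemma has_derivative_grad:
  assumes "V differentiable (at u)"
  shows "(V has_derivative (\<lambda>h. grad V u \<bullet> h)) (at u)"
proof -
  obtain f' where f': "(V has_derivative f') (at u)" using assms differentiable_def by blast
  define D where "D = (\<Sum>b\<in>Basis. f' b *\<^sub>R b)"
  have lin: "linear f'" using f' has_derivative_linear by blast
  have "f' h = h \<bullet> D" for h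
  proof -
    have "f' h = f' (\<Sum>b\<in>Basis. (h \<bullet> b) *\<^sub>R b)" by (simp add: euclidean_representation)
    also have "\<dots> = (\<Sum>b\<in>Basis. (h \<bullet> b) * f' b)"
      by (simp add: linear_sum[OF lin] linear_cmul[OF lin])
    finally show ?thesis by (simp add: D_def inner_sum_right mult.commute)
  qed
  then have G: "GDERIV V u :> D" using f' \<open>\<And>h. f' h = h \<bullet> D\<close> unfolding gderiv_def by presburger
  have "grad V u = D" unfolding grad_def
  proof (rule the_equality[where a=D])
    fix D' assume "GDERIV V u :> D'"
    then have "(\<lambda>h. h \<bullet> D') = (\<lambda>h. h \<bullet> D)"
      using G has_derivative_unique unfolding gderiv_def by blast
    then show "D' = D" by (metis vector_eq_ldot)
  qed (use G in auto)
  then show ?thesis using G by (simp add: gderiv_def inner_commute)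
qed

text \<open>The mean value theorem is applied in the direction \<open>h\<close> only, so that differentiability of the
  gradient at the single point \<open>u\<close> is enough. The second difference is symmetric in \<open>h\<close> and \<open>k\<close>, whence
  the symmetry of the second derivative.\<close>
lemma second_difference:
  fixes V :: "'a::euclidean_space \<Rightarrow> real" and G :: "'a \<Rightarrow> 'a"
  assumes V: "\<And>u. (V has_derivative (\<lambda>h. G u \<bullet> h)) (at u)"
    and A: "(G has_derivative A) (at u)" and "\<epsilon> > 0"
  obtains d where "d > 0"
    "\<And>t. 0 < t \<Longrightarrow> t < d \<Longrightarrow>
      \<bar>V (u + t *\<^sub>R h + t *\<^sub>R k) - V (u + t *\<^sub>R h) - V (u + t *\<^sub>R k) + V u - t\<^sup>2 * (A k \<bullet> h)\<bar> \<le> \<epsilon> * t\<^sup>2"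
proof -
  define C where "C = (2 * norm h + norm k) * norm h + 1"
  have C: "C > 0" by (simp add: C_def add_nonneg_pos)
  have lin: "linear A" using A has_derivative_linear by blast
  obtain \<delta> where \<delta>: "\<delta> > 0" and
    est: "\<And>y. norm (y - u) < \<delta> \<Longrightarrow> norm (G y - G u - A (y - u)) \<le> \<epsilon> / C * norm (y - u)"
    using A \<open>\<epsilon> > 0\<close> C unfolding has_derivative_at_alt by (meson divide_pos_pos)
  define d where "d = \<delta> / (norm h + norm k + 1)"
  have d: "d > 0" using \<delta> by (simp add: d_def add_nonneg_pos)
  show ?thesis
  proof (rule that[OF d])
    fix t :: real assume t: "0 < t" "t < d"
    define f where "f s = V (u + s *\<^sub>R h + t *\<^sub>R k) - V (u + s *\<^sub>R h)" for s
    have df: "(f has_real_derivative ((G (u + s *\<^sub>R h + t *\<^sub>R k) - G (u + s *\<^sub>R h)) \<bullet> h)) (at s)" for s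
    proof -
      have a1: "((\<lambda>s. u + s *\<^sub>R h + t *\<^sub>R k) has_derivative (\<lambda>x. x *\<^sub>R h)) (at s)"
        by (auto intro!: derivative_eq_intros)
      have a2: "((\<lambda>s. u + s *\<^sub>R h) has_derivative (\<lambda>x. x *\<^sub>R h)) (at s)"
        by (auto intro!: derivative_eq_intros)
      show ?thesis unfolding f_def has_field_derivative_def
        using has_derivative_diff[OF has_derivative_compose[OF a1 V] has_derivative_compose[OF a2 V]]
        by (rule has_derivative_eq_rhs) (auto simp: inner_diff_left algebra_simps)
    qed
    obtain z where z: "0 < z" "z < t"
      and fz: "f t - f 0 = (t - 0) * ((G (u + z *\<^sub>R h + t *\<^sub>R k) - G (u + z *\<^sub>R h)) \<bullet> h)"
      using MVT2[OF t(1), of f "\<lambda>z. (G (u + z *\<^sub>R h + t *\<^sub>R k) - G (u + z *\<^sub>R h)) \<bullet> h"] df by blast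
    have td: "t * (norm h + norm k + 1) < \<delta>" 
      using t(2) pos_less_divide_eq[of "norm h + norm k + 1" t \<delta>] by (simp add: d_def add_nonneg_pos)
    have b1: "norm (z *\<^sub>R h + t *\<^sub>R k) \<le> t * (norm h + norm k)"
    proof -
      have "norm (z *\<^sub>R h + t *\<^sub>R k) \<le> z * norm h + t * norm k"
        using norm_triangle_ineq[of "z *\<^sub>R h" "t *\<^sub>R k"] z t by simp
      also have "\<dots> \<le> t * norm h + t * norm k" using z by (simp add: mult_right_mono)
      finally show ?thesis by (simp add: algebra_simps)
    qed
    have b2: "norm (z *\<^sub>R h) \<le> t * norm h" using z by (simp add: mult_right_mono)
    have tp: "t * norm k \<ge> 0" "t * norm h \<ge> 0" using t by auto
    have e1: "norm (G (u + z *\<^sub>R h + t *\<^sub>R k) - G u - A (z *\<^sub>R h + t *\<^sub>R k)) \<le> \<epsilon> / C * (t * (norm h + norm k))"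
    proof -
      have "norm (z *\<^sub>R h + t *\<^sub>R k) < \<delta>" using b1 td t by (simp add: algebra_simps)
      with est[of "u + z *\<^sub>R h + t *\<^sub>R k"]
      have "norm (G (u + z *\<^sub>R h + t *\<^sub>R k) - G u - A (z *\<^sub>R h + t *\<^sub>R k)) \<le> \<epsilon> / C * norm (z *\<^sub>R h + t *\<^sub>R k)"
        by (simp add: add.assoc)
      also have "\<dots> \<le> \<epsilon> / C * (t * (norm h + norm k))"
        using b1 C \<open>\<epsilon> > 0\<close> by (intro mult_left_mono) auto
      finally show ?thesis .
    qed
    have e2: "norm (G (u + z *\<^sub>R h) - G u - A (z *\<^sub>R h)) \<le> \<epsilon> / C * (t * norm h)"
    proof -
      have "t * norm h < \<delta>" using td t tp by (simp only: distrib_left mult_1_right)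
      then have "norm (z *\<^sub>R h) < \<delta>" using b2 by simp
      with est[of "u + z *\<^sub>R h"]
      have "norm (G (u + z *\<^sub>R h) - G u - A (z *\<^sub>R h)) \<le> \<epsilon> / C * norm (z *\<^sub>R h)" by simp
      also have "\<dots> \<le> \<epsilon> / C * (t * norm h)"
        using b2 C \<open>\<epsilon> > 0\<close> by (intro mult_left_mono) auto
      finally show ?thesis .
    qed
    define r where "r = (G (u + z *\<^sub>R h + t *\<^sub>R k) - G u - A (z *\<^sub>R h + t *\<^sub>R k)) - (G (u + z *\<^sub>R h) - G u - A (z *\<^sub>R h))"
    have "norm r \<le> \<epsilon> / C * (t * (norm h + norm k)) + \<epsilon> / C * (t * norm h)"
      unfolding r_def using norm_triangle_ineq4 e1 e2 by (smt (verit, best))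
    also have "\<dots> = \<epsilon> / C * t * (2 * norm h + norm k)" by (simp add: algebra_simps)
    finally have nr: "norm r \<le> \<epsilon> / C * t * (2 * norm h + norm k)" .
    have Gr: "G (u + z *\<^sub>R h + t *\<^sub>R k) - G (u + z *\<^sub>R h) = r + t *\<^sub>R A k"
      by (simp add: r_def linear_add[OF lin] linear_cmul[OF lin])
    have "\<bar>f t - f 0 - t\<^sup>2 * (A k \<bullet> h)\<bar> = t * \<bar>r \<bullet> h\<bar>"
      using t unfolding fz Gr by (simp add: inner_add_left algebra_simps power2_eq_square abs_mult)
    also have "\<dots> \<le> t * (norm r * norm h)"
      using t Cauchy_Schwarz_ineq2 by (intro mult_left_mono) auto
    also have "\<dots> \<le> t * ((\<epsilon> / C * t * (2 * norm h + norm k)) * norm h)"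
      using t nr by (intro mult_left_mono mult_right_mono) auto
    also have "\<dots> = \<epsilon> * t\<^sup>2 * ((C - 1) / C)" by (simp add: C_def power2_eq_square)
    also have "\<dots> \<le> \<epsilon> * t\<^sup>2 * 1" using C \<open>\<epsilon> > 0\<close> by (intro mult_left_mono) auto
    finally show "\<bar>V (u + t *\<^sub>R h + t *\<^sub>R k) - V (u + t *\<^sub>R h) - V (u + t *\<^sub>R k) + V u - t\<^sup>2 * (A k \<bullet> h)\<bar> \<le> \<epsilon> * t\<^sup>2"
      by (simp add: f_def algebra_simps)
  qed
qed

lemma second_derivative_symmetric:
  fixes V :: "'a::euclidean_space \<Rightarrow> real" and G :: "'a \<Rightarrow> 'a"
  assumes V: "\<And>u. (V has_derivative (\<lambda>h. G u \<bullet> h)) (at u)"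
    and A: "(G has_derivative A) (at u)"
  shows "A k \<bullet> h = A h \<bullet> k"
proof -
  have "\<bar>A k \<bullet> h - A h \<bullet> k\<bar> \<le> \<epsilon>" if "\<epsilon> > 0" for \<epsilon>
  proof -
    have e2: "\<epsilon> / 2 > 0" using that by simp
    obtain d1 where d1: "d1 > 0"
      "\<And>t. 0 < t \<Longrightarrow> t < d1 \<Longrightarrow>
      \<bar>V (u + t *\<^sub>R h + t *\<^sub>R k) - V (u + t *\<^sub>R h) - V (u + t *\<^sub>R k) + V u - t\<^sup>2 * (A k \<bullet> h)\<bar> \<le> \<epsilon>/2 * t\<^sup>2"
      using second_difference[OF V A e2] by blast
    obtain d2 where d2: "d2 > 0"
      "\<And>t. 0 < t \<Longrightarrow> t < d2 \<Longrightarrow>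
      \<bar>V (u + t *\<^sub>R k + t *\<^sub>R h) - V (u + t *\<^sub>R k) - V (u + t *\<^sub>R h) + V u - t\<^sup>2 * (A h \<bullet> k)\<bar> \<le> \<epsilon>/2 * t\<^sup>2"
      using second_difference[OF V A e2] by blast
    define t where "t = min d1 d2 / 2"
    have t: "0 < t" "t < d1" "t < d2" using d1 d2 by (auto simp: t_def)
    have "u + t *\<^sub>R k + t *\<^sub>R h = u + t *\<^sub>R h + t *\<^sub>R k" by (simp add: algebra_simps)
    then have "\<bar>t\<^sup>2 * (A k \<bullet> h) - t\<^sup>2 * (A h \<bullet> k)\<bar> \<le> \<epsilon> * t\<^sup>2"
      using d1(2)[OF t(1,2)] d2(2)[OF t(1,3)] by (smt (verit) field_sum_of_halves distrib_right)
    then have "t\<^sup>2 * \<bar>A k \<bullet> h - A h \<bullet> k\<bar> \<le> t\<^sup>2 * \<epsilon>"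
      by (simp add: abs_mult mult.commute flip: right_diff_distrib left_diff_distrib)
    then show ?thesis using t by simp
  qed
  then have "\<bar>A k \<bullet> h - A h \<bullet> k\<bar> \<le> 0" by (rule field_le_epsilon) auto
  then show ?thesis by simp
qed

text \<open>Eigenvectors for distinct eigenvalues are orthogonal, hence independent. Without finiteness the
  minimum in \<open>least_eigenvalue\<close> would be an unspecified value.\<close>
lemma finite_eigenvalues_symmetric:
  fixes A :: "real ^ 'n ^ 'n"
  assumes sym: "\<And>x y. (A *v x) \<bullet> y = (A *v y) \<bullet> x"
  shows "finite {\<mu>. \<exists>v. v \<noteq> 0 \<and> A *v v = \<mu> *\<^sub>R v}" (is "finite ?S")
proof -
  define f where "f \<mu> = (SOME v. v \<noteq> 0 \<and> A *v v = \<mu> *\<^sub>R v)" for \<mu>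
  have f: "f \<mu> \<noteq> 0 \<and> A *v f \<mu> = \<mu> *\<^sub>R f \<mu>" if "\<mu> \<in> ?S" for \<mu>
    using someI_ex[of "\<lambda>v. v \<noteq> 0 \<and> A *v v = \<mu> *\<^sub>R v"] that unfolding f_def by simp
  have orth: "f \<mu> \<bullet> f \<nu> = 0" if "\<mu> \<in> ?S" "\<nu> \<in> ?S" "\<mu> \<noteq> \<nu>" for \<mu> \<nu>
  proof -
    have "\<mu> * (f \<mu> \<bullet> f \<nu>) = \<nu> * (f \<mu> \<bullet> f \<nu>)"
      using f[OF that(1)] f[OF that(2)] sym[of "f \<mu>" "f \<nu>"] by (simp add: inner_commute)
    then show ?thesis using that by simp
  qed
  have inj: "inj_on f ?S" 
  proof (rule inj_onI)
    fix \<mu> \<nu> assume *: "\<mu> \<in> ?S" "\<nu> \<in> ?S" "f \<mu> = f \<nu>"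
    show "\<mu> = \<nu>"
    proof (rule ccontr)
      assume "\<mu> \<noteq> \<nu>"
      then have "f \<mu> \<bullet> f \<mu> = 0" using orth[OF *(1,2)] *(3) by simp
      then show False using f[OF *(1)] by simp
    qed
  qed
  have "pairwise orthogonal (f ` ?S)"
    unfolding pairwise_def orthogonal_def using orth by blast
  then have "independent (f ` ?S)"
    by (rule pairwise_orthogonal_independent) (use f in fastforce)
  then have "finite (f ` ?S)" by (rule independent_imp_finite)
  then show ?thesis using inj finite_imageD by blast
qed

text \<open>A minimiser \<open>v\<close> of the quadratic form on the unit sphere, with minimum \<open>\<mu>\<close>, is an eigenvector:
  \<open>y \<mapsto> A y \<bullet> y - \<mu> (y \<bullet> y)\<close> is nonnegative and vanishes at \<open>v\<close>, so that its derivative at \<open>v\<close> in the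
  direction \<open>w = A v - \<mu> v\<close>, which is \<open>2 w \<bullet> w\<close>, must vanish.\<close>
lemma least_eigenvalue_le_quadratic_form:
  fixes A :: "real ^ 'n ^ 'n"
  assumes sym: "\<And>x y. (A *v x) \<bullet> y = (A *v y) \<bullet> x"
  shows "least_eigenvalue A * (norm x)\<^sup>2 \<le> (A *v x) \<bullet> x"
proof -
  have "compact (sphere (0::real^'n) 1)" "sphere (0::real^'n) 1 \<noteq> {}" by auto
  moreover have "continuous_on (sphere 0 1) (\<lambda>x::real^'n. (A *v x) \<bullet> x)"
    by (intro continuous_intros)
  ultimately obtain v where v: "v \<in> sphere 0 1"
    and vmin: "\<And>y. y \<in> sphere 0 1 \<Longrightarrow> (A *v v) \<bullet> v \<le> (A *v y) \<bullet> y"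
    using continuous_attains_inf[of "sphere 0 1" "\<lambda>x::real^'n. (A *v x) \<bullet> x"] by blast
  define \<mu> where "\<mu> = (A *v v) \<bullet> v"
  have nv: "v \<bullet> v = 1" using v by (simp add: norm_eq_1)
  have low: "\<mu> * (y \<bullet> y) \<le> (A *v y) \<bullet> y" for y
  proof (cases "y = 0")
    case False
    have "\<mu> \<le> (A *v (y /\<^sub>R norm y)) \<bullet> (y /\<^sub>R norm y)"
      using vmin[of "y /\<^sub>R norm y"] False by (simp add: \<mu>_def)
    also have "\<dots> = (inverse (norm y) * inverse (norm y)) * ((A *v y) \<bullet> y)"
      by (simp only: matrix_vector_mult_scaleR inner_scaleR_left inner_scaleR_right mult.assoc)
    also have "\<dots> = ((A *v y) \<bullet> y) / (y \<bullet> y)"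
      unfolding dot_square_norm power2_eq_square by (simp add: divide_inverse mult.commute)
    finally show ?thesis using False by (simp add: pos_le_divide_eq)
  qed simp
  define w where "w = A *v v - \<mu> *\<^sub>R v"
  have "w \<bullet> w = 0"
  proof (rule ccontr)
    assume ne: "w \<bullet> w \<noteq> 0"
    then have pos: "w \<bullet> w > 0" by (simp add: order_less_le)
    define b where "b = (A *v w) \<bullet> w - \<mu> * (w \<bullet> w)"
    have b: "b \<ge> 0" using low[of w] by (simp add: b_def)
    \<comment> \<open>any small step in the direction \<open>- w\<close> makes the nonnegative form negative\<close>
    define t where "t = (w \<bullet> w) / (b + 1)"
    have t: "t > 0" using pos b by (simp add: t_def)
    have "\<mu> * ((v - t *\<^sub>R w) \<bullet> (v - t *\<^sub>R w)) \<le> (A *v (v - t *\<^sub>R w)) \<bullet> (v - t *\<^sub>R w)" by (rule low)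
    moreover have "(A *v (v - t *\<^sub>R w)) \<bullet> (v - t *\<^sub>R w) - \<mu> * ((v - t *\<^sub>R w) \<bullet> (v - t *\<^sub>R w))
        = t * (t * b - 2 * (w \<bullet> w))"
    proof -
      have 1: "(A *v w) \<bullet> v = (A *v v) \<bullet> w" by (rule sym)
      have 2: "(A *v v) \<bullet> w = w \<bullet> w + \<mu> * (v \<bullet> w)"
      proof -
        have "A *v v = w + \<mu> *\<^sub>R v" by (simp add: w_def)
        then have "(A *v v) \<bullet> w = (w + \<mu> *\<^sub>R v) \<bullet> w" by (rule arg_cong)
        then show ?thesis by (simp only: inner_add_left inner_scaleR_left)
      qed
      have 3: "A *v (v - t *\<^sub>R w) = A *v v - t *\<^sub>R (A *v w)"
        by (simp only: matrix_vector_mult_diff_distrib matrix_vector_mult_scaleR)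
      have 4: "(A *v v) \<bullet> v = \<mu>" by (simp add: \<mu>_def)
      have "(A *v v - t *\<^sub>R (A *v w)) \<bullet> (v - t *\<^sub>R w) = \<mu> - 2 * t * ((A *v v) \<bullet> w) + t * t * ((A *v w) \<bullet> w)"
        unfolding inner_diff_left inner_diff_right inner_scaleR_left inner_scaleR_right 4 1 by algebra
      moreover have "(v - t *\<^sub>R w) \<bullet> (v - t *\<^sub>R w) = 1 - 2 * t * (v \<bullet> w) + t * t * (w \<bullet> w)"
        unfolding inner_diff_left inner_diff_right inner_scaleR_left inner_scaleR_right nv inner_commute[of w v] by algebra
      moreover have "(A *v w) \<bullet> w = b + \<mu> * (w \<bullet> w)" by (simp add: b_def)
      moreover note 2
      ultimately show ?thesis unfolding 3 by algebra
    qed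
    ultimately have "t * b - 2 * (w \<bullet> w) \<ge> 0" using t by (metis diff_ge_0_iff_ge linorder_not_le zero_le_mult_iff)
    moreover have "t * b \<le> w \<bullet> w" using pos b by (simp add: t_def field_simps)
    ultimately show False using pos by simp
  qed
  then have "A *v v = \<mu> *\<^sub>R v" by (simp add: w_def)
  then have "\<mu> \<in> {\<mu>. \<exists>v. v \<noteq> 0 \<and> A *v v = \<mu> *\<^sub>R v}" using nv by (auto intro!: exI[of _ v])
  then have "least_eigenvalue A \<le> \<mu>"
    unfolding least_eigenvalue_def using finite_eigenvalues_symmetric[OF sym] by (intro Min_le) auto
  then have "least_eigenvalue A * (x \<bullet> x) \<le> \<mu> * (x \<bullet> x)" by (intro mult_right_mono) auto
  then show ?thesis using low[of x] by (simp add: power2_norm_eq_inner)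
qed

locale invaded_potential =
  fixes V :: "real ^ 'n \<Rightarrow> real" and e :: "real ^ 'n"
  assumes V_C2: "C2 V" and V_coercive: "coercive V"
    and grad_e: "grad V e = 0" and V_e: "V e = 0"
    and V_min: "\<exists>m. (\<forall>u. V m \<le> V u) \<and> V m < 0"
begin

lemma V_derivative: "(V has_derivative (\<lambda>h. grad V u \<bullet> h)) (at u)"
  using V_C2 has_derivative_grad unfolding C2_def by blast

lemma V_continuous: "continuous_on S V"
  by (meson V_derivative continuous_at_imp_continuous_on has_derivative_continuous)

lemma grad_derivative: "(grad V has_derivative (\<lambda>h. hess V u *v h)) (at u)"
proof -
  have "grad V differentiable (at u)" using V_C2 unfolding C2_def by blast
  then have *: "(grad V has_derivative frechet_derivative (grad V) (at u)) (at u)"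
    using frechet_derivative_works by blast
  then have "linear (frechet_derivative (grad V) (at u))" using has_derivative_linear by blast
  then have "frechet_derivative (grad V) (at u) = (\<lambda>h. hess V u *v h)"
    unfolding hess_def by (simp add: fun_eq_iff matrix_works)
  then show ?thesis using * by metis
qed

lemma grad_continuous: "continuous_on S (grad V)"
  by (meson grad_derivative continuous_at_imp_continuous_on has_derivative_continuous)

lemma hess_symmetric: "(hess V u *v x) \<bullet> y = (hess V u *v y) \<bullet> x"
  by (rule second_derivative_symmetric[OF V_derivative grad_derivative])

lemma V_along_line:
  "((\<lambda>t. V (x + t *\<^sub>R h)) has_real_derivative (grad V (x + t *\<^sub>R h) \<bullet> h)) (at t)"
proof -
  have "((\<lambda>s. x + s *\<^sub>R h) has_derivative (\<lambda>s. s *\<^sub>R h)) (at t)"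
    by (auto intro!: derivative_eq_intros)
  from has_derivative_compose[OF this V_derivative] show ?thesis
    unfolding has_field_derivative_def by (rule has_derivative_eq_rhs) auto
qed

lemma grad_lipschitz:
  obtains K where "K > 0"
    "\<And>x y. x \<in> cball e R \<Longrightarrow> y \<in> cball e R \<Longrightarrow> norm (grad V x - grad V y) \<le> K * norm (x - y)"
proof -
  have "continuous_on (cball e R) (hess V)" using V_C2 unfolding C2_def by (meson continuous_on_subset subset_UNIV)
  then have "bounded (hess V ` cball e R)" by (intro compact_imp_bounded compact_continuous_image) auto
  then obtain B where B: "\<And>x. x \<in> cball e R \<Longrightarrow> norm (hess V x) \<le> B" unfolding bounded_iff by blast
  define K where "K = max 1 (real CARD('n) * real CARD('n) * B)"
  have on: "onorm (\<lambda>h. hess V x *v h) \<le> K" if "x \<in> cball e R" for x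
  proof -
    have "\<bar>hess V x $ i $ j\<bar> \<le> B" for i j
      using B[OF that] Finite_Cartesian_Product.norm_nth_le[of "hess V x" i] Finite_Cartesian_Product.norm_nth_le[of "hess V x $ i" j] 
      by simp
    then have "onorm (\<lambda>h. hess V x *v h) \<le> real CARD('n) * real CARD('n) * B"
      by (rule onorm_le_matrix_component)
    then show ?thesis by (simp add: K_def)
  qed
  have "K > 0" by (simp add: K_def)
  moreover have "norm (grad V x - grad V y) \<le> K * norm (x - y)" if "x \<in> cball e R" "y \<in> cball e R" for x y
    by (rule differentiable_bound[of "cball e R" "grad V" "\<lambda>u h. hess V u *v h"])
      (use that on has_derivative_at_withinI[OF grad_derivative] in auto)
  ultimately show ?thesis using that by blast
qed

lemma V_taylor:
  obtains K where "K > 0"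
    "\<And>x y. x \<in> cball e R \<Longrightarrow> y \<in> cball e R \<Longrightarrow> \<bar>V y - V x - grad V x \<bullet> (y - x)\<bar> \<le> K * (norm (y - x))\<^sup>2"
proof -
  obtain K where K: "K > 0"
    "\<And>x y. x \<in> cball e R \<Longrightarrow> y \<in> cball e R \<Longrightarrow> norm (grad V x - grad V y) \<le> K * norm (x - y)"
    using grad_lipschitz by blast
  have "\<bar>V y - V x - grad V x \<bullet> (y - x)\<bar> \<le> K * (norm (y - x))\<^sup>2" if xy: "x \<in> cball e R" "y \<in> cball e R" for x y
  proof -
    obtain z where z: "0 < z" "z < 1"
      and eq: "V (x + 1 *\<^sub>R (y - x)) - V (x + 0 *\<^sub>R (y - x)) = (1 - 0) * (grad V (x + z *\<^sub>R (y - x)) \<bullet> (y - x))"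
      using MVT2[of 0 1 "\<lambda>t. V (x + t *\<^sub>R (y - x))" "\<lambda>t. grad V (x + t *\<^sub>R (y - x)) \<bullet> (y - x)"] V_along_line
      by (metis zero_less_one)
    have "x + z *\<^sub>R (y - x) = (1 - z) *\<^sub>R x + z *\<^sub>R y" by (simp add: algebra_simps)
    then have zin: "x + z *\<^sub>R (y - x) \<in> cball e R"
      using xy z convexD_alt[OF convex_cball] by (metis less_eq_real_def)
    have "V y - V x - grad V x \<bullet> (y - x) = (grad V (x + z *\<^sub>R (y - x)) - grad V x) \<bullet> (y - x)"
      using eq by (simp add: inner_diff_left)
    also have "\<bar>\<dots>\<bar> \<le> norm (grad V (x + z *\<^sub>R (y - x)) - grad V x) * norm (y - x)"
      by (rule Cauchy_Schwarz_ineq2)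
    also have "\<dots> \<le> (K * norm (z *\<^sub>R (y - x))) * norm (y - x)"
      using K(2)[OF zin xy(1)] by (intro mult_right_mono) auto
    also have "\<dots> \<le> K * norm (y - x) * norm (y - x)"
      using z K(1) by (intro mult_right_mono mult_left_mono) (auto simp: mult_left_le_one_le)
    finally show ?thesis by (simp add: power2_eq_square mult.assoc)
  qed
  then show ?thesis using that K(1) by blast
qed

lemma V_quadratic_bound:
  obtains K where "K > 0" "\<And>u. u \<in> cball e R \<Longrightarrow> \<bar>V u\<bar> \<le> K * (norm (u - e))\<^sup>2"
proof (cases "R \<ge> 0")
  case True
  obtain K where K: "K > 0"
    "\<And>x y. x \<in> cball e R \<Longrightarrow> y \<in> cball e R \<Longrightarrow> \<bar>V y - V x - grad V x \<bullet> (y - x)\<bar> \<le> K * (norm (y - x))\<^sup>2"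
    using V_taylor by blast
  have "\<bar>V u\<bar> \<le> K * (norm (u - e))\<^sup>2" if "u \<in> cball e R" for u
    using K(2)[of e u] that True by (simp add: grad_e V_e)
  then show ?thesis using that K(1) by blast
next
  case False
  then show ?thesis using that[of 1] by auto
qed

text \<open>Taylor's formula serves near \<open>e\<close>; away from \<open>e\<close> the minimum of \<open>V\<close> is already a quadratic bound.\<close>
lemma V_lower_quadratic:
  obtains K where "K > 0" "\<And>u. V u \<ge> - K * (norm (u - e))\<^sup>2"
proof -
  obtain K where K: "K > 0" "\<And>u. u \<in> cball e 1 \<Longrightarrow> \<bar>V u\<bar> \<le> K * (norm (u - e))\<^sup>2"
    using V_quadratic_bound by blast
  obtain m where m: "\<And>u. V m \<le> V u" "V m < 0" using V_min by blast
  have "V u \<ge> - (K - V m) * (norm (u - e))\<^sup>2" for u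
  proof (cases "u \<in> cball e 1")
    case True
    have "V u \<ge> - K * (norm (u - e))\<^sup>2" using K(2)[OF True] by auto
    also have "- K * (norm (u - e))\<^sup>2 \<ge> - (K - V m) * (norm (u - e))\<^sup>2"
      using m by (intro mult_right_mono) auto
    finally show ?thesis by linarith
  next
    case False
    then have "1 \<le> norm (u - e)" by (simp add: dist_norm norm_minus_commute)
    then have "1 \<le> (norm (u - e))\<^sup>2" by (simp add: one_le_power)
    then have "(V m - K) * (norm (u - e))\<^sup>2 \<le> (V m - K) * 1"
      using m K by (intro mult_left_mono_neg) auto
    then show ?thesis using m(1)[of u] K by auto
  qed
  then show ?thesis using that[of "K - V m"] m K by auto
qed

text \<open>The hypothesis says \<open>c0\<^sup>2 / 4 + \<mu>\<^sub>1 > 0\<close> for the least eigenvalue \<open>\<mu>\<^sub>1\<close> of the Hessian at \<open>e\<close>: the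
  quadratic terms that the exponential weight adds dominate the instability of \<open>e\<close>. This is the only
  way in which the linear invasion speed enters.\<close>
lemma V_near_e:
  assumes c: "c0 > c_lin V e"
  obtains \<delta> \<epsilon> where "\<delta> > 0" "\<epsilon> > 0"
    "\<And>u. norm (u - e) \<le> \<delta> \<Longrightarrow> \<epsilon> * (norm (u - e))\<^sup>2 \<le> V u + c0\<^sup>2/8 * (norm (u - e))\<^sup>2"
    "\<And>u. norm (u - e) \<le> \<delta> \<Longrightarrow> \<epsilon> * (norm (u - e))\<^sup>2 \<le> grad V u \<bullet> (u - e) + c0\<^sup>2/4 * (norm (u - e))\<^sup>2"
proof -
  define \<mu> where "\<mu> = least_eigenvalue (hess V e)"
  have pos: "c0\<^sup>2 / 4 + \<mu> > 0"
  proof (cases "\<mu> < 0")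
    case True
    then have "2 * sqrt (- \<mu>) < c0" using c by (simp add: c_lin_def \<mu>_def Let_def)
    then have "(2 * sqrt (- \<mu>))\<^sup>2 < c0\<^sup>2" using True by (intro power_strict_mono) auto
    then show ?thesis using True by (simp add: power_mult_distrib)
  next
    case False
    then have "c0 > 0" using c by (simp add: c_lin_def \<mu>_def Let_def)
    then show ?thesis using False by (simp add: add_pos_nonneg)
  qed
  define \<epsilon> where "\<epsilon> = (c0\<^sup>2 / 4 + \<mu>) / 2"
  have \<epsilon>: "\<epsilon> > 0" using pos by (simp add: \<epsilon>_def)
  have \<mu>\<epsilon>: "\<mu> - \<epsilon> + c0\<^sup>2 / 4 = \<epsilon>" by (simp add: \<epsilon>_def field_simps)
  obtain d where d: "d > 0" and
    est: "\<And>y. norm (y - e) < d \<Longrightarrow> norm (grad V y - grad V e - hess V e *v (y - e)) \<le> \<epsilon> * norm (y - e)"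
    using grad_derivative[of e] \<epsilon> unfolding has_derivative_at_alt by blast
  have low: "(\<mu> - \<epsilon>) * (norm h)\<^sup>2 \<le> grad V (e + h) \<bullet> h" if "norm h < d" for h
  proof -
    define r where "r = grad V (e + h) - hess V e *v h"
    have "norm r \<le> \<epsilon> * norm h" using est[of "e + h"] that by (simp add: r_def grad_e)
    then have "\<bar>r \<bullet> h\<bar> \<le> (\<epsilon> * norm h) * norm h"
      using Cauchy_Schwarz_ineq2[of r h] by (meson mult_right_mono norm_ge_zero order_trans)
    moreover have "\<mu> * (norm h)\<^sup>2 \<le> (hess V e *v h) \<bullet> h"
      unfolding \<mu>_def by (rule least_eigenvalue_le_quadratic_form[OF hess_symmetric])
    moreover have "grad V (e + h) \<bullet> h = r \<bullet> h + (hess V e *v h) \<bullet> h"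
      by (simp add: r_def inner_diff_left)
    ultimately show ?thesis by (simp add: power2_eq_square algebra_simps abs_le_iff)
  qed
  have V: "(\<mu> - \<epsilon>) / 2 * (norm h)\<^sup>2 \<le> V (e + h)" if h: "norm h < d" for h
  proof -
    define p where "p t = V (e + t *\<^sub>R h) - (\<mu> - \<epsilon>) / 2 * (norm h)\<^sup>2 * t\<^sup>2" for t
    have "p 0 \<le> p 1"
    proof (rule DERIV_nonneg_imp_nondecreasing[of 0 1 p])
      fix t :: real assume t: "0 \<le> t" "t \<le> 1"
      have "(p has_real_derivative (grad V (e + t *\<^sub>R h) \<bullet> h - (\<mu> - \<epsilon>) * (norm h)\<^sup>2 * t)) (at t)"
        unfolding p_def by (auto intro!: derivative_eq_intros V_along_line)
      moreover have "grad V (e + t *\<^sub>R h) \<bullet> h - (\<mu> - \<epsilon>) * (norm h)\<^sup>2 * t \<ge> 0"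
      proof (cases "t = 0")
        case False
        have "norm (t *\<^sub>R h) < d" using h t mult_left_le_one_le[of "norm h" t] by simp
        from low[OF this] have "t * (t * ((\<mu> - \<epsilon>) * (norm h)\<^sup>2)) \<le> t * (grad V (e + t *\<^sub>R h) \<bullet> h)"
          by (simp add: power_mult_distrib power2_eq_square mult_ac)
        then show ?thesis using False t by (simp add: mult_le_cancel_left mult_ac)
      qed (simp add: grad_e)
      ultimately show "\<exists>y. (p has_real_derivative y) (at t) \<and> y \<ge> 0" by blast
    qed simp
    then show ?thesis by (simp add: p_def V_e)
  qed
  show ?thesis
  proof (rule that[of "d/2" "\<epsilon>/2"])
    fix u assume "norm (u - e) \<le> d / 2"
    then have *: "norm (u - e) < d" using d by simp
    have "\<epsilon>/2 * (norm (u - e))\<^sup>2 = (\<mu> - \<epsilon>) / 2 * (norm (u - e))\<^sup>2 + c0\<^sup>2 / 8 * (norm (u - e))\<^sup>2"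
    proof -
      have "\<epsilon>/2 = (\<mu> - \<epsilon>) / 2 + c0\<^sup>2 / 8" using \<mu>\<epsilon> by (simp add: field_simps)
      then show ?thesis by (simp only: flip: distrib_right)
    qed
    then show "\<epsilon>/2 * (norm (u - e))\<^sup>2 \<le> V u + c0\<^sup>2/8 * (norm (u - e))\<^sup>2"
      using V[OF *] by simp
    have "\<epsilon>/2 * (norm (u - e))\<^sup>2 \<le> \<epsilon> * (norm (u - e))\<^sup>2" using \<epsilon> by (intro mult_right_mono) auto
    also have "\<dots> = (\<mu> - \<epsilon>) * (norm (u - e))\<^sup>2 + c0\<^sup>2 / 4 * (norm (u - e))\<^sup>2"
      by (simp only: \<mu>\<epsilon> flip: distrib_right)
    finally show "\<epsilon>/2 * (norm (u - e))\<^sup>2 \<le> grad V u \<bullet> (u - e) + c0\<^sup>2/4 * (norm (u - e))\<^sup>2"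
      using low[OF *] by simp
  qed (use d \<epsilon> in auto)
qed

lemma V_coercive_bound:
  obtains R where "R > 0" "\<And>u. norm u \<ge> R \<Longrightarrow> u \<bullet> grad V u > 0"
proof -
  obtain L where L: "L > 0"
    "((\<lambda>R::real. INF u\<in>{u. norm u \<ge> R}. ereal ((u \<bullet> grad V u) / (norm u)\<^sup>2)) \<longlongrightarrow> L) at_top"
    using V_coercive unfolding coercive_def by blast
  have "eventually (\<lambda>R::real. 0 < (INF u\<in>{u. norm u \<ge> R}. ereal ((u \<bullet> grad V u) / (norm u)\<^sup>2))) at_top"
    using order_tendstoD(1)[OF L(2) L(1)] .
  then obtain R0 where R0: "\<And>R::real. R \<ge> R0 \<Longrightarrow> 0 < (INF u\<in>{u. norm u \<ge> R}. ereal ((u \<bullet> grad V u) / (norm u)\<^sup>2))"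
    unfolding eventually_at_top_linorder by blast
  define R where "R = max 1 R0"
  have "u \<bullet> grad V u > 0" if "norm u \<ge> R" for u
  proof -
    have "0 < (INF u\<in>{u. norm u \<ge> R}. ereal ((u \<bullet> grad V u) / (norm u)\<^sup>2))"
      by (rule R0) (simp add: R_def)
    also have "\<dots> \<le> ereal ((u \<bullet> grad V u) / (norm u)\<^sup>2)" using that by (intro INF_lower) auto
    finally have "(u \<bullet> grad V u) / (norm u)\<^sup>2 > 0" by simp
    then show ?thesis by (simp add: zero_less_divide_iff)
  qed
  then show ?thesis using that[of R] by (simp add: R_def)
qed

end

section \<open>Locally absolutely continuous functions\<close>

definition loc_integrable :: "(real \<Rightarrow> 'a::euclidean_space) \<Rightarrow> bool" where
  "loc_integrable g \<longleftrightarrow> (\<forall>a b. g absolutely_integrable_on {a..b})"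

text \<open>Local absolute continuity, with a chosen density of the derivative; carrying the density along
  avoids almost everywhere derivatives.\<close>
definition abs_cont :: "(real \<Rightarrow> 'a::euclidean_space) \<Rightarrow> (real \<Rightarrow> 'a) \<Rightarrow> bool" where
  "abs_cont w g \<longleftrightarrow> loc_integrable g \<and> (\<forall>a b. a \<le> b \<longrightarrow> (g has_integral (w b - w a)) {a..b})"

lemma abs_contD:
  assumes "abs_cont w g"
  shows "g absolutely_integrable_on {a..b}" "a \<le> b \<Longrightarrow> (g has_integral (w b - w a)) {a..b}"
    "g integrable_on {a..b}" "a \<le> b \<Longrightarrow> integral {a..b} g = w b - w a"
  using assms unfolding abs_cont_def loc_integrable_def
  by (auto simp: absolutely_integrable_on_def integral_unique)

lemma abs_cont_continuous:
  assumes "abs_cont w g"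
  shows "continuous_on S w"
proof -
  have "isCont w x" for x
  proof -
    have "continuous_on {x-1..x+1} (\<lambda>y. w (x-1) + integral {x-1..y} g)"
      by (intro continuous_intros indefinite_integral_continuous_1 abs_contD(3)[OF assms])
    then have "continuous_on {x-1..x+1} w"
      by (rule continuous_on_eq) (simp add: abs_contD(4)[OF assms])
    then show ?thesis by (rule continuous_on_interior) simp
  qed
  then show ?thesis by (simp add: continuous_at_imp_continuous_on)
qed

lemma loc_integrable_continuous:
  fixes f :: "real \<Rightarrow> 'a::euclidean_space"
  assumes "continuous_on UNIV f" shows "loc_integrable f"
  unfolding loc_integrable_def by (meson absolutely_integrable_continuous_real assms continuous_on_subset subset_UNIV)

lemma abs_cont_C1:
  fixes f :: "real \<Rightarrow> 'a::euclidean_space"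
  assumes "\<And>x. (f has_vector_derivative f' x) (at x)" "continuous_on UNIV f'"
  shows "abs_cont f f'"
  unfolding abs_cont_def
proof (intro conjI allI impI)
  show "loc_integrable f'" by (rule loc_integrable_continuous[OF assms(2)])
  show "(f' has_integral f b - f a) {a..b}" if "a \<le> b" for a b
    by (rule fundamental_theorem_of_calculus[OF that has_vector_derivative_at_within[OF assms(1)]])
qed

lemma continuous_lebesgue_measurable:
  fixes f :: "real \<Rightarrow> 'a::euclidean_space"
  assumes "continuous_on UNIV f" shows "f \<in> borel_measurable lebesgue"
  using borel_measurable_continuous_onI[OF assms] by (intro measurable_completion) simp

text \<open>An estimate by a telescoping majorant passes from short intervals to long ones by cutting into
  equal pieces.\<close>
lemma local_bound_imp_global:
  fixes D :: "real \<Rightarrow> real \<Rightarrow> 'a::real_normed_vector"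
  assumes add: "\<And>x y z. a \<le> x \<Longrightarrow> x \<le> y \<Longrightarrow> y \<le> z \<Longrightarrow> z \<le> b \<Longrightarrow> D x z = D x y + D y z"
    and loc: "\<And>x y. a \<le> x \<Longrightarrow> x \<le> y \<Longrightarrow> y \<le> b \<Longrightarrow> y - x < \<delta> \<Longrightarrow> norm (D x y) \<le> H y - (H x :: real)"
    and "\<delta> > 0" "a \<le> b"
  shows "norm (D a b) \<le> H b - H a"
proof -
  obtain N :: nat where N: "(b - a) / \<delta> < real N" using reals_Archimedean2 by blast
  have Npos: "N > 0"
  proof (rule ccontr)
    assume "\<not> 0 < N"
    then have "(b - a) / \<delta> < 0" using N by simp
    then show False using assms(3,4) by (simp add: divide_less_0_iff)
  qed
  define x where "x k = a + real k * ((b - a) / N)" for k :: nat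
  have "(b - a) / N < \<delta>" using N Npos \<open>\<delta> > 0\<close> by (simp add: pos_divide_less_eq mult.commute)
  moreover have "x (Suc k) - x k = (b - a) / N" for k unfolding x_def of_nat_Suc distrib_right by simp
  ultimately have step: "x (Suc k) - x k < \<delta>" for k by simp
  have x0: "x 0 = a" "x N = b" using Npos by (auto simp: x_def)
  have mono: "x k \<le> x l" if "k \<le> l" for k l
    unfolding x_def using that \<open>a \<le> b\<close> by (intro add_left_mono mult_right_mono divide_nonneg_nonneg) auto
  have "norm (D a (x k)) \<le> H (x k) - H a" if "k \<le> N" for k
    using that
  proof (induction k)
    case 0
    have "norm (D a a) \<le> H a - H a" using loc[of a a] assms(3,4) by simp
    then show ?case using x0 by simp
  next
    case (Suc k)
    have xs: "a \<le> x k" "x k \<le> x (Suc k)" "x (Suc k) \<le> b"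
    proof -
      show "a \<le> x k" using mono[of 0 k] x0(1) by simp
      show "x k \<le> x (Suc k)" by (rule mono) simp
      show "x (Suc k) \<le> b" using mono[OF Suc.prems] x0(2) by simp
    qed
    then have "D a (x (Suc k)) = D a (x k) + D (x k) (x (Suc k))" using xs by (intro add) auto
    moreover have "norm (D (x k) (x (Suc k))) \<le> H (x (Suc k)) - H (x k)"
      by (rule loc[OF xs step])
    moreover have "norm (D a (x k)) \<le> H (x k) - H a" using Suc by simp
    ultimately show ?case using norm_triangle_ineq[of "D a (x k)" "D (x k) (x (Suc k))"] by simp
  qed
  from this[of N] show ?thesis using x0 by simp
qed

lemma abs_cont_norm_primitive:
  assumes "abs_cont f f'" "a \<le> x" "x \<le> y"
  shows "integral {a..y} (\<lambda>t. norm (f' t)) - integral {a..x} (\<lambda>t. norm (f' t)) = integral {x..y} (\<lambda>t. norm (f' t))"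
proof -
  have "(\<lambda>t. norm (f' t)) integrable_on {a..y}" using abs_contD(1)[OF assms(1)] absolutely_integrable_on_def by blast
  then have "integral {a..x} (\<lambda>t. norm (f' t)) + integral {x..y} (\<lambda>t. norm (f' t)) = integral {a..y} (\<lambda>t. norm (f' t))"
    using assms by (intro Henstock_Kurzweil_Integration.integral_combine) auto
  then show ?thesis by simp
qed

lemma abs_integrable_bilinear:
  fixes prod :: "'a::euclidean_space \<Rightarrow> 'b::euclidean_space \<Rightarrow> 'c::euclidean_space"
  assumes "bounded_bilinear prod" "continuous_on {a..b} f" "g absolutely_integrable_on {a..b::real}"
  shows "(\<lambda>x. prod (f x) (g x)) absolutely_integrable_on {a..b}"
proof (rule absolutely_integrable_bounded_measurable_product[where h = prod])
  show "bilinear prod" using assms(1) bilinear_conv_bounded_bilinear by blast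
  show "f \<in> borel_measurable (lebesgue_on {a..b})"
    using assms by (intro continuous_imp_measurable_on_sets_lebesgue) auto
  show "bounded (f ` {a..b})"
    using assms by (intro compact_imp_bounded compact_continuous_image) auto
qed (use assms in auto)

text \<open>On a short interval \<open>[x, y]\<close> the error of the product rule is
  \<open>\<integral> f' (g y - g) + (f x - f) g'\<close>, at most \<open>\<epsilon> \<integral> \<bar>f'\<bar> + \<bar>g'\<bar>\<close> by uniform continuity. These bounds add up.\<close>
lemma abs_cont_product:
  fixes prod :: "'a::euclidean_space \<Rightarrow> 'b::euclidean_space \<Rightarrow> 'c::euclidean_space"
  assumes bb: "bounded_bilinear prod" and f: "abs_cont f f'" and g: "abs_cont g g'"
  shows "abs_cont (\<lambda>x. prod (f x) (g x)) (\<lambda>x. prod (f' x) (g x) + prod (f x) (g' x))"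
proof -
  interpret bounded_bilinear prod by (rule bb)
  obtain K where K: "K > 0" "\<And>a b. norm (prod a b) \<le> norm a * norm b * K" using pos_bounded by blast
  note cf = abs_cont_continuous[OF f] and cg = abs_cont_continuous[OF g]
  define P where "P x = prod (f' x) (g x) + prod (f x) (g' x)" for x
  have aiP: "P absolutely_integrable_on {a..b}" for a b
  proof -
    have "(\<lambda>x. prod (f' x) (g x)) absolutely_integrable_on {a..b}"
      using abs_integrable_bilinear[OF flip cg abs_contD(1)[OF f]] by simp
    moreover have "(\<lambda>x. prod (f x) (g' x)) absolutely_integrable_on {a..b}"
      by (rule abs_integrable_bilinear[OF bb cf abs_contD(1)[OF g]])
    ultimately show ?thesis unfolding P_def by (rule set_integral_add(1))
  qed
  have iP: "P integrable_on {a..b}" for a b using aiP absolutely_integrable_on_def by blast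
  define D where "D x y = prod (f y) (g y) - prod (f x) (g x) - integral {x..y} P" for x y
  have D0: "norm (D a b) \<le> \<epsilon> * (integral {a..b} (\<lambda>t. norm (f' t)) + integral {a..b} (\<lambda>t. norm (g' t)))"
    if ab: "a \<le> b" and \<epsilon>: "\<epsilon> > 0" for a b \<epsilon>
  proof -
    have "uniformly_continuous_on {a..b} f" "uniformly_continuous_on {a..b} g"
      using cf cg by (auto intro: compact_uniformly_continuous)
    then obtain d1 d2 where d: "d1 > 0" "d2 > 0" 
      "\<And>x y. x \<in> {a..b} \<Longrightarrow> y \<in> {a..b} \<Longrightarrow> dist y x < d1 \<Longrightarrow> dist (f y) (f x) < \<epsilon> / K"
      "\<And>x y. x \<in> {a..b} \<Longrightarrow> y \<in> {a..b} \<Longrightarrow> dist y x < d2 \<Longrightarrow> dist (g y) (g x) < \<epsilon> / K"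
      unfolding uniformly_continuous_on_def using \<epsilon> K(1) by (metis divide_pos_pos)
    define H where "H x = \<epsilon> * (integral {a..x} (\<lambda>t. norm (f' t)) + integral {a..x} (\<lambda>t. norm (g' t)))" for x
    have "norm (D a b) \<le> H b - H a"
    proof (rule local_bound_imp_global[where D = D and a = a and b = b and H = H and \<delta> = "min d1 d2"])
      fix x y z assume *: "a \<le> x" "x \<le> y" "y \<le> z" "z \<le> b"
      have eq: "integral {x..y} P + integral {y..z} P = integral {x..z} P"
        using * iP by (intro Henstock_Kurzweil_Integration.integral_combine) auto
      show "D x z = D x y + D y z" unfolding D_def eq[symmetric] by simp
    next
      fix x y assume *: "a \<le> x" "x \<le> y" "y \<le> b" "y - x < min d1 d2"
      have 1: "((\<lambda>t. prod (f' t) (g y)) has_integral prod (f y - f x) (g y)) {x..y}"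
        using has_integral_linear[OF abs_contD(2)[OF f *(2)] bounded_linear_left] by (simp add: o_def)
      have 2: "((\<lambda>t. prod (f x) (g' t)) has_integral prod (f x) (g y - g x)) {x..y}"
        using has_integral_linear[OF abs_contD(2)[OF g *(2)] bounded_linear_right] by (simp add: o_def)
      have "((\<lambda>t. prod (f' t) (g y) + prod (f x) (g' t) - P t) has_integral
          prod (f y - f x) (g y) + prod (f x) (g y - g x) - integral {x..y} P) {x..y}"
        by (intro has_integral_diff has_integral_add 1 2 integrable_integral iP)
      moreover have "prod (f y - f x) (g y) + prod (f x) (g y - g x) - integral {x..y} P = D x y"
        by (simp add: D_def diff_left diff_right)
      moreover have "prod (f' t) (g y) + prod (f x) (g' t) - P t = prod (f' t) (g y - g t) + prod (f x - f t) (g' t)" for t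
        by (simp add: P_def diff_left diff_right)
      ultimately have DI: "((\<lambda>t. prod (f' t) (g y - g t) + prod (f x - f t) (g' t)) has_integral D x y) {x..y}" by simp
      have nint: "(\<lambda>t. norm (f' t)) integrable_on {x..y}" "(\<lambda>t. norm (g' t)) integrable_on {x..y}"
        using abs_contD(1)[OF f] abs_contD(1)[OF g] absolutely_integrable_on_def by blast+
      have bound: "norm (prod (f' t) (g y - g t) + prod (f x - f t) (g' t)) \<le> \<epsilon> * (norm (f' t) + norm (g' t))"
        if t: "t \<in> {x..y}" for t
      proof -
        have "norm (g y - g t) \<le> \<epsilon> / K" "norm (f x - f t) \<le> \<epsilon> / K"
          using d(3)[of t x] d(4)[of t y] t * by (auto simp: dist_norm abs_real_def less_imp_le)
        then have "norm (f' t) * norm (g y - g t) * K \<le> norm (f' t) * (\<epsilon> / K) * K"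
          "norm (f x - f t) * norm (g' t) * K \<le> (\<epsilon> / K) * norm (g' t) * K"
          using K(1) by (intro mult_right_mono mult_left_mono; simp)+
        then show ?thesis
          using K(1) K(2)[of "f' t" "g y - g t"] K(2)[of "f x - f t" "g' t"]
          by (intro norm_triangle_le) (simp add: algebra_simps)
      qed
      have "norm (D x y) \<le> integral {x..y} (\<lambda>t. \<epsilon> * (norm (f' t) + norm (g' t)))"
        unfolding integral_unique[OF DI, symmetric]
        using bound nint DI
        by (intro integral_norm_bound_integral) (auto intro!: integrable_on_mult_right integrable_add simp: has_integral_integrable)
      also have "\<dots> = \<epsilon> * (integral {x..y} (\<lambda>t. norm (f' t)) + integral {x..y} (\<lambda>t. norm (g' t)))"
        using nint by (simp add: Henstock_Kurzweil_Integration.integral_add)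
      also have "\<dots> = H y - H x"
        unfolding H_def
        using abs_cont_norm_primitive[OF f *(1,2)] abs_cont_norm_primitive[OF g *(1,2)] by (simp add: algebra_simps)
      finally show "norm (D x y) \<le> H y - H x" .
    qed (use d ab in auto)
    then show ?thesis by (simp add: H_def)
  qed
  have "D a b = 0" if "a \<le> b" for a b
  proof -
    define I where "I = integral {a..b} (\<lambda>t. norm (f' t)) + integral {a..b} (\<lambda>t. norm (g' t))"
    have I: "I \<ge> 0" unfolding I_def 
      by (simp add: integral_nonneg abs_contD(1)[OF f] abs_contD(1)[OF g, unfolded absolutely_integrable_on_def] abs_contD(1)[OF f, unfolded absolutely_integrable_on_def])
    have "norm (D a b) \<le> \<eta>" if "\<eta> > 0" for \<eta>
    proof -
      have "norm (D a b) \<le> \<eta> / (I + 1) * I" using D0[OF \<open>a \<le> b\<close>, of "\<eta> / (I + 1)"] that I by (simp add: I_def)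
      also have "\<dots> \<le> \<eta>" using I that by (simp add: field_simps)
      finally show ?thesis .
    qed
    then have "norm (D a b) \<le> 0" by (rule field_le_epsilon) auto
    then show ?thesis by simp
  qed
  then have "(P has_integral prod (f b) (g b) - prod (f a) (g a)) {a..b}" if "a \<le> b" for a b
    using integrable_integral[OF iP, of a b] that by (simp add: D_def)
  then show ?thesis using aiP unfolding abs_cont_def loc_integrable_def P_def by blast
qed

definition prim :: "(real \<Rightarrow> 'a::euclidean_space) \<Rightarrow> real \<Rightarrow> 'a" where
  "prim g x = (if 0 \<le> x then integral {0..x} g else - integral {x..0} g)"

lemma prim_diff:
  assumes "loc_integrable g" "a \<le> b"
  shows "prim g b - prim g a = integral {a..b} g"
proof -
  have i: "g integrable_on {x..y}" for x y
    using assms absolutely_integrable_on_def unfolding loc_integrable_def by blast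
  have c: "integral {x..y} g + integral {y..z} g = integral {x..z} g" if "x \<le> y" "y \<le> z" for x y z
    using that i by (intro Henstock_Kurzweil_Integration.integral_combine) auto
  show ?thesis
    using assms(2) c[of 0 a b] c[of a 0 b] c[of a b 0] by (auto simp: prim_def algebra_simps)
qed

lemma abs_cont_prim:
  assumes "loc_integrable g" shows "abs_cont (prim g) g"
  unfolding abs_cont_def using assms
  by (auto simp: prim_diff loc_integrable_def absolutely_integrable_on_def intro!: integrable_integral)

lemma prim_derivative:
  assumes "continuous_on UNIV g"
  shows "(prim g has_vector_derivative g x) (at x)"
proof -
  note g = loc_integrable_continuous[OF assms]
  have "((\<lambda>y. prim g (x - 1) + integral {x-1..y} g) has_vector_derivative 0 + g x) (at x within {x-1..x+1})"
    by (intro has_vector_derivative_add has_vector_derivative_const integral_has_vector_derivative continuous_on_subset[OF assms]) auto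
  then have "(prim g has_vector_derivative 0 + g x) (at x within {x-1..x+1})"
    by (rule has_vector_derivative_transform[rotated 2]) (auto simp: prim_diff[OF g, symmetric])
  moreover have "at x within {x-1..x+1} = at x" by (rule at_within_Icc_at) auto
  ultimately show ?thesis by simp
qed

lemma abs_cont_eq_prim:
  assumes "abs_cont w g" shows "w x = w 0 + prim g x"
  using abs_contD(4)[OF assms, of 0 x] abs_contD(4)[OF assms, of x 0] by (auto simp: prim_def)

lemma abs_cont_lincomb:
  assumes "abs_cont v g" "abs_cont w h"
  shows "abs_cont (\<lambda>x. r *\<^sub>R v x + s *\<^sub>R w x) (\<lambda>x. r *\<^sub>R g x + s *\<^sub>R h x)"
  unfolding abs_cont_def loc_integrable_def
proof (intro conjI allI impI)
  fix a b :: real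
  show "(\<lambda>x. r *\<^sub>R g x + s *\<^sub>R h x) absolutely_integrable_on {a..b}"
    by (intro set_integral_add absolutely_integrable_scaleR_left abs_contD(1)[OF assms(1)] abs_contD(1)[OF assms(2)])
  assume "a \<le> b"
  then have "((\<lambda>x. r *\<^sub>R g x + s *\<^sub>R h x) has_integral r *\<^sub>R (v b - v a) + s *\<^sub>R (w b - w a)) {a..b}"
    by (intro has_integral_add has_integral_cmul abs_contD(2)[OF assms(1)] abs_contD(2)[OF assms(2)])
  then show "((\<lambda>x. r *\<^sub>R g x + s *\<^sub>R h x) has_integral r *\<^sub>R v b + s *\<^sub>R w b - (r *\<^sub>R v a + s *\<^sub>R w a)) {a..b}"
    by (simp add: algebra_simps)
qed

lemma abs_cont_const: "abs_cont (\<lambda>x. k) (\<lambda>x. 0)"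
  by (rule abs_cont_C1) auto

section \<open>The fundamental lemma of the calculus of variations\<close>

lemma test_functionE:
  assumes "test_function \<eta>"
  obtains A where "A > 0" "\<And>x. (\<eta> has_real_derivative deriv \<eta> x) (at x)" "continuous_on UNIV (deriv \<eta>)"
    "\<And>x. \<bar>x\<bar> \<ge> A \<Longrightarrow> \<eta> x = 0" "\<And>x. \<bar>x\<bar> \<ge> A \<Longrightarrow> deriv \<eta> x = 0"
proof -
  obtain D where D: "\<And>x. (\<eta> has_vector_derivative D x) (at x)" "continuous_on UNIV D"
    using assms unfolding test_function_def C1_differentiable_on_def by auto
  have d: "(\<eta> has_real_derivative D x) (at x)" for x
    using D(1) by (simp add: has_real_derivative_iff_has_vector_derivative)
  then have deq: "deriv \<eta> = D" using DERIV_imp_deriv by blast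
  have "bounded {x. \<eta> x \<noteq> 0}"
    using assms compact_imp_bounded bounded_closure_image bounded_subset[OF _ closure_subset] unfolding test_function_def by blast
  then obtain B where B: "\<And>x. \<eta> x \<noteq> 0 \<Longrightarrow> \<bar>x\<bar> \<le> B" unfolding bounded_iff by auto
  define A where "A = \<bar>B\<bar> + 1"
  have z: "\<eta> x = 0" if "\<bar>x\<bar> > B" for x using B[of x] that by force
  have "D x = 0" if "\<bar>x\<bar> \<ge> A" for x
  proof -
    have "\<forall>y. \<bar>x - y\<bar> < 1 \<longrightarrow> \<eta> x = \<eta> y"
      using that by (auto simp: A_def intro!: z[THEN trans] z[symmetric])
    then show ?thesis using DERIV_local_const[OF d, of 1 x] by simp
  qed
  moreover have "\<eta> x = 0" if "\<bar>x\<bar> \<ge> A" for x by (rule z) (use that A_def in auto)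
  ultimately show ?thesis using that[of A] d D(2) unfolding deq by (simp add: A_def)
qed

lemma test_functionI:
  assumes "\<And>x. (\<eta> has_real_derivative \<psi> x) (at x)" "continuous_on UNIV \<psi>"
    "\<And>x. \<bar>x\<bar> \<ge> A \<Longrightarrow> \<eta> x = 0"
  shows "test_function \<eta>"
proof -
  have "{x. \<eta> x \<noteq> 0} \<subseteq> {-A..A}" using assms(3) by force
  then have "bounded {x. \<eta> x \<noteq> 0}" by (rule bounded_subset[rotated]) auto
  then have "compact (closure {x. \<eta> x \<noteq> 0})" by (simp add: compact_closure)
  moreover have "\<eta> C1_differentiable_on UNIV"
    unfolding C1_differentiable_on_def using assms by (auto simp: has_real_derivative_iff_has_vector_derivative)
  ultimately show ?thesis by (simp add: test_function_def)
qed

lemma LINT_supported: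
  fixes f :: "real \<Rightarrow> 'a::euclidean_space"
  assumes "f absolutely_integrable_on {a..b}" "\<And>x. x \<notin> {a..b} \<Longrightarrow> f x = 0"
  shows "integrable lebesgue f" "(LINT x|lebesgue. f x) = integral {a..b} f"
proof -
  have eq: "(\<lambda>x. indicator {a..b} x *\<^sub>R f x) = f" using assms(2) by (auto simp: indicator_def fun_eq_iff)
  show "integrable lebesgue f" using assms(1) unfolding set_integrable_def eq .
  show "(LINT x|lebesgue. f x) = integral {a..b} f"
    using set_lebesgue_integral_eq_integral(2)[OF assms(1)] unfolding set_lebesgue_integral_def eq .
qed

lemma abs_cont_weak_derivative:
  assumes w: "abs_cont w g"
  shows "has_weak_derivative w g"
  unfolding has_weak_derivative_def
proof (intro allI impI)
  fix \<eta> :: "real \<Rightarrow> real" assume "test_function \<eta>"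
  then obtain A where A: "A > 0" "\<And>x. (\<eta> has_real_derivative deriv \<eta> x) (at x)" "continuous_on UNIV (deriv \<eta>)"
    "\<And>x. \<bar>x\<bar> \<ge> A \<Longrightarrow> \<eta> x = 0" "\<And>x. \<bar>x\<bar> \<ge> A \<Longrightarrow> deriv \<eta> x = 0" using test_functionE by metis
  have \<eta>: "abs_cont \<eta> (deriv \<eta>)"
    using A(2,3) by (intro abs_cont_C1) (auto simp: has_real_derivative_iff_has_vector_derivative)
  have p: "abs_cont (\<lambda>x. \<eta> x *\<^sub>R w x) (\<lambda>x. deriv \<eta> x *\<^sub>R w x + \<eta> x *\<^sub>R g x)"
    by (rule abs_cont_product[OF bounded_bilinear_scaleR \<eta> w])
  have zero: "integral {-A..A} (\<lambda>x. deriv \<eta> x *\<^sub>R w x + \<eta> x *\<^sub>R g x) = 0"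
    using abs_contD(4)[OF p, of "-A" A] A(1) A(4)[of A] A(4)[of "-A"] by simp
  have ai1: "(\<lambda>x. deriv \<eta> x *\<^sub>R w x) absolutely_integrable_on {-A..A}"
    by (intro absolutely_integrable_continuous_real continuous_intros continuous_on_subset[OF A(3)] abs_cont_continuous[OF w]) auto
  have ai2: "(\<lambda>x. \<eta> x *\<^sub>R g x) absolutely_integrable_on {-A..A}"
    by (rule abs_integrable_bilinear[OF bounded_bilinear_scaleR abs_cont_continuous[OF \<eta>] abs_contD(1)[OF w]])
  have "(LINT x|lebesgue. deriv \<eta> x *\<^sub>R w x) = integral {-A..A} (\<lambda>x. deriv \<eta> x *\<^sub>R w x)"
    by (rule LINT_supported(2)[OF ai1]) (use A in force)
  moreover have "(LINT x|lebesgue. \<eta> x *\<^sub>R g x) = integral {-A..A} (\<lambda>x. \<eta> x *\<^sub>R g x)"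
    by (rule LINT_supported(2)[OF ai2]) (use A in force)
  moreover have "integral {-A..A} (\<lambda>x. deriv \<eta> x *\<^sub>R w x) + integral {-A..A} (\<lambda>x. \<eta> x *\<^sub>R g x) = 0"
    using zero ai1 ai2 by (subst (asm) Henstock_Kurzweil_Integration.integral_add) (auto simp: absolutely_integrable_on_def)
  ultimately show "(LINT x|lebesgue. deriv \<eta> x *\<^sub>R w x) = - (LINT x|lebesgue. \<eta> x *\<^sub>R g x)"
    by (simp add: add_eq_0_iff2)
qed

text \<open>This is Lebesgue's differentiation theorem.\<close>
lemma AE_zero_of_interval_integrals:
  fixes u :: "real \<Rightarrow> 'a::euclidean_space"
  assumes "loc_integrable u" "\<And>a b. a < b \<Longrightarrow> integral {a..b} u = 0"
  shows "AE x in lebesgue. u x = 0"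
proof -
  have "u integrable_on cbox a b" for a b :: real
    using assms(1) by (auto simp: loc_integrable_def absolutely_integrable_on_def)
  then obtain N where N: "negligible N"
    "\<And>x e. \<lbrakk>x \<notin> N; 0 < e\<rbrakk> \<Longrightarrow> \<exists>d>0. \<forall>h. 0 < h \<and> h < d \<longrightarrow>
        norm (integral (cbox x (x + h *\<^sub>R One)) u /\<^sub>R h ^ DIM(real) - u x) < e"
    using integrable_ccontinuous_explicit[of u] by blast
  have "u x = 0" if "x \<notin> N" for x
  proof (rule ccontr)
    assume "u x \<noteq> 0"
    then have "norm (u x) > 0" by simp
    from N(2)[OF that this] obtain d where d: "d > 0" "\<And>h. 0 < h \<Longrightarrow> h < d \<Longrightarrow>
       norm (integral (cbox x (x + h *\<^sub>R One)) u /\<^sub>R h ^ DIM(real) - u x) < norm (u x)" by blast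
    have "integral (cbox x (x + (d/2) *\<^sub>R One)) u = 0" using assms(2)[of x "x + d/2"] d(1) by simp
    then show False using d(2)[of "d/2"] d(1) by simp
  qed
  then have "{x. u x \<noteq> 0} \<subseteq> N" by blast
  moreover have "N \<in> null_sets lebesgue" using N(1) negligible_iff_null_sets by blast
  ultimately show ?thesis by (intro AE_I'[of N]) auto
qed

text \<open>The derivatives of test functions are the continuous functions of compact support and mean zero.
  Testing with combinations of two trapezoids and letting them tend to indicators of intervals shows
  that the mean value of \<open>u\<close> is the same over all intervals.\<close>
lemma weakly_constant_imp_constant:
  fixes u :: "real \<Rightarrow> 'a::euclidean_space"
  assumes u: "loc_integrable u"
    and weak: "\<And>\<eta>. test_function \<eta> \<Longrightarrow> (LINT x|lebesgue. deriv \<eta> x *\<^sub>R u x) = 0"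
  obtains k where "AE x in lebesgue. u x = k"
proof -
  have ui: "u absolutely_integrable_on {a..b}" for a b using u by (simp add: loc_integrable_def)
  have mean: "(LINT x|lebesgue. \<psi> x *\<^sub>R u x) = 0"
    if \<psi>: "continuous_on UNIV \<psi>" "\<And>x. \<bar>x\<bar> \<ge> A \<Longrightarrow> \<psi> x = 0" "integral {-A..A} \<psi> = 0" "A > 0" for \<psi> :: "real \<Rightarrow> real" and A
  proof -
    note li = loc_integrable_continuous[OF \<psi>(1)]
    define \<eta> where "\<eta> x = prim \<psi> x - prim \<psi> (-A)" for x
    have d: "(\<eta> has_real_derivative \<psi> x) (at x)" for x
      unfolding \<eta>_def has_real_derivative_iff_has_vector_derivative
      using has_vector_derivative_diff[OF prim_derivative[OF \<psi>(1)] has_vector_derivative_const] by simp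
    have zero_int: "integral {a..b} \<psi> = 0" if "b \<le> -A \<or> a \<ge> A" for a b
      using that \<psi>(2,4) by (intro integral_unique has_integral_is_0) auto
    have "\<eta> x = 0" if "\<bar>x\<bar> \<ge> A" for x
    proof (cases "x \<ge> A")
      case True
      have "prim \<psi> x - prim \<psi> A = 0" "prim \<psi> A - prim \<psi> (-A) = 0"
        using prim_diff[OF li, of A x] prim_diff[OF li, of "-A" A] \<psi>(3,4) True zero_int[of x A] by auto
      then show ?thesis by (simp add: \<eta>_def)
    next
      case False
      then have "x \<le> -A" using that by auto
      then have "prim \<psi> (-A) - prim \<psi> x = 0"
        using prim_diff[OF li, of x "-A"] zero_int[of "-A" x] by auto
      then show ?thesis by (simp add: \<eta>_def)
    qed
    then have "test_function \<eta>" by (rule test_functionI[OF d \<psi>(1)])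
    moreover have "deriv \<eta> = \<psi>" using d DERIV_imp_deriv by blast
    ultimately show ?thesis using weak by metis
  qed
  \<comment> \<open>continuous trapezoids approximating the indicator of an interval\<close>
  define T where "T a b n x = max 0 (1 - real (Suc n) * max 0 (max (a - x) (x - b)))" for a b x :: real and n
  have T_cont: "continuous_on UNIV (T a b n)" for a b n
    unfolding T_def by (intro continuous_intros)
  have T_range: "0 \<le> T a b n x" "T a b n x \<le> 1" for a b n x
    unfolding T_def by (auto intro!: mult_nonneg_nonneg)
  have T_zero: "T a b n x = 0" if "x \<notin> {a-1..b+1}" for a b n x
  proof -
    have "1 * 1 \<le> real (Suc n) * max 0 (max (a - x) (x - b))"
      using that by (intro mult_mono) auto
    then show ?thesis by (simp add: T_def)
  qed
  have T_lim: "(\<lambda>n. T a b n x) \<longlonglongrightarrow> indicator {a..b} x" for a b x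
  proof (cases "x \<in> {a..b}")
    case True
    then have "max 0 (max (a - x) (x - b)) = 0" by auto
    then have "T a b n x = 1" for n by (simp add: T_def)
    then show ?thesis using True by simp
  next
    case False
    define m where "m = max 0 (max (a - x) (x - b))"
    have m: "m > 0" using False by (auto simp: m_def)
    obtain N :: nat where N: "1 / m < real N" using reals_Archimedean2 by blast
    have "T a b n x = 0" if "n \<ge> N" for n
    proof -
      have "1 / m \<le> real (Suc n)" using N that by simp
      then have "1 \<le> real (Suc n) * m" using m by (simp add: pos_divide_le_eq)
      then show ?thesis by (simp add: T_def m_def[symmetric])
    qed
    then have "eventually (\<lambda>n. T a b n x = 0) sequentially" unfolding eventually_sequentially by blast
    then show ?thesis using False by (simp add: tendsto_eventually)
  qed
  have lim: "(\<lambda>n. LINT x|lebesgue. T a b n x *\<^sub>R f x) \<longlonglongrightarrow> integral {a..b} f"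
    if f: "loc_integrable f" for f :: "real \<Rightarrow> 'b::euclidean_space" and a b
  proof -
    have fi: "f absolutely_integrable_on {a..b}" for a b using f by (simp add: loc_integrable_def)
    have Tf: "(\<lambda>x. T a b n x *\<^sub>R f x) absolutely_integrable_on {a-1..b+1}" for n
      by (rule abs_integrable_bilinear[OF bounded_bilinear_scaleR continuous_on_subset[OF T_cont] fi]) auto
    have "(\<lambda>n. LINT x|lebesgue. T a b n x *\<^sub>R f x) \<longlonglongrightarrow> (LINT x|lebesgue. indicator {a..b} x *\<^sub>R f x)"
    proof (rule integral_dominated_convergence)
      show "integrable lebesgue (\<lambda>x. norm (indicator {a-1..b+1} x *\<^sub>R f x))"
        using fi[of "a-1" "b+1"] by (intro integrable_norm) (simp add: set_integrable_def)
      show "(\<lambda>x. indicator {a..b} x *\<^sub>R f x) \<in> borel_measurable lebesgue"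
        using fi[of a b] borel_measurable_integrable unfolding set_integrable_def by blast
      show "(\<lambda>x. T a b n x *\<^sub>R f x) \<in> borel_measurable lebesgue" for n
        by (rule borel_measurable_integrable, rule LINT_supported(1)[OF Tf]) (simp add: T_zero)
      show "AE x in lebesgue. (\<lambda>n. T a b n x *\<^sub>R f x) \<longlonglongrightarrow> indicator {a..b} x *\<^sub>R f x"
        by (intro AE_I2 tendsto_intros T_lim)
      show "AE x in lebesgue. norm (T a b n x *\<^sub>R f x) \<le> norm (indicator {a-1..b+1} x *\<^sub>R f x)" for n
      proof (intro AE_I2)
        fix x
        show "norm (T a b n x *\<^sub>R f x) \<le> norm (indicator {a-1..b+1} x *\<^sub>R f x)"
          using T_range[of a b n x] T_zero[of x a b n] by (cases "x \<in> {a-1..b+1}") (auto intro: mult_left_le_one_le)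
      qed
    qed
    then show ?thesis
      using set_lebesgue_integral_eq_integral(2)[OF fi[of a b]] by (simp add: set_lebesgue_integral_def)
  qed
  define I where "I a b n = (LINT x|lebesgue. T a b n x)" for a b n
  define U where "U a b n = (LINT x|lebesgue. T a b n x *\<^sub>R u x)" for a b n
  have T_ai: "(T a b n) absolutely_integrable_on {c..d}" for a b n c d
    using loc_integrable_continuous[OF T_cont] by (simp add: loc_integrable_def)
  have Tint: "integrable lebesgue (T a b n)" for a b n
  proof (rule LINT_supported(1))
    show "T a b n absolutely_integrable_on {a-1..b+1}" by (rule T_ai)
  qed (simp add: T_zero)
  have Tu: "integrable lebesgue (\<lambda>x. T a b n x *\<^sub>R u x)" for a b n
  proof (rule LINT_supported(1))
    show "(\<lambda>x. T a b n x *\<^sub>R u x) absolutely_integrable_on {a-1..b+1}"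
      by (rule abs_integrable_bilinear[OF bounded_bilinear_scaleR continuous_on_subset[OF T_cont] ui]) auto
  qed (simp add: T_zero)
  have eq: "I 0 1 n *\<^sub>R U a b n = I a b n *\<^sub>R U 0 1 n" if "a < b" for a b n
  proof -
    define A where "A = \<bar>a\<bar> + \<bar>b\<bar> + 3"
    define \<psi> where "\<psi> x = I 0 1 n * T a b n x - I a b n * T 0 1 n x" for x
    have z: "T a b n x = 0 \<and> T 0 1 n x = 0" if "\<bar>x\<bar> \<ge> A" for x
      using that by (intro conjI T_zero) (auto simp: A_def)
    have c: "continuous_on UNIV \<psi>" unfolding \<psi>_def by (intro continuous_intros T_cont)
    have "integrable lebesgue \<psi>" unfolding \<psi>_def using Tint by auto
    have "(LINT x|lebesgue. \<psi> x) = 0"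
      unfolding \<psi>_def using Tint by (simp add: I_def)
    moreover have "(LINT x|lebesgue. \<psi> x) = integral {-A..A} \<psi>"
    proof (rule LINT_supported(2))
      show "\<psi> absolutely_integrable_on {- A..A}"
        using loc_integrable_continuous[OF c] by (simp add: loc_integrable_def)
      show "\<psi> x = 0" if "x \<notin> {-A..A}" for x using z[of x] that by (auto simp: \<psi>_def)
    qed
    ultimately have "(LINT x|lebesgue. \<psi> x *\<^sub>R u x) = 0"
      using z by (intro mean[OF c, of A]) (auto simp: \<psi>_def A_def)
    moreover have "(LINT x|lebesgue. \<psi> x *\<^sub>R u x) = (LINT x|lebesgue. I 0 1 n *\<^sub>R (T a b n x *\<^sub>R u x) - I a b n *\<^sub>R (T 0 1 n x *\<^sub>R u x))"
      by (simp add: \<psi>_def scaleR_diff_left)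
    moreover have "\<dots> = I 0 1 n *\<^sub>R U a b n - I a b n *\<^sub>R U 0 1 n"
      using Tu by (simp add: U_def del: scaleR_scaleR)
    ultimately show ?thesis by simp
  qed
  have I_lim: "I a b \<longlonglongrightarrow> b - a" if "a < b" for a b
    using lim[OF loc_integrable_continuous[OF continuous_on_const], of a b "1::real"] that by (simp add: I_def[abs_def])
  have U_lim: "U a b \<longlonglongrightarrow> integral {a..b} u" for a b
    using lim[OF u] by (simp add: U_def[abs_def])
  have int: "integral {a..b} u = (b - a) *\<^sub>R integral {0..1} u" if "a < b" for a b
  proof -
    have "(\<lambda>n. I 0 1 n *\<^sub>R U a b n) \<longlonglongrightarrow> (1 - 0) *\<^sub>R integral {a..b} u"
      by (intro tendsto_intros I_lim U_lim) auto
    moreover have "(\<lambda>n. I a b n *\<^sub>R U 0 1 n) \<longlonglongrightarrow> (b - a) *\<^sub>R integral {0..1} u"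
      by (intro tendsto_intros I_lim U_lim that)
    ultimately show ?thesis using eq[OF that] LIMSEQ_unique by fastforce
  qed
  define k where "k = integral {0..1} u"
  have "AE x in lebesgue. u x - k = 0"
  proof (rule AE_zero_of_interval_integrals)
    show "loc_integrable (\<lambda>x. u x - k)"
      using ui by (auto simp: loc_integrable_def intro!: set_integral_diff)
    show "integral {a..b} (\<lambda>x. u x - k) = 0" if "a < b" for a b
      using int[OF that] ui[of a b] that
      by (subst Henstock_Kurzweil_Integration.integral_diff) (auto simp: absolutely_integrable_on_def k_def)
  qed
  then show ?thesis using that by simp
qed

text \<open>The difference of \<open>w\<close> and a primitive of \<open>g\<close> has weak derivative zero.\<close>
lemma weak_derivative_imp_abs_cont:
  fixes w :: "real \<Rightarrow> 'a::euclidean_space"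
  assumes w: "loc_integrable w" and g: "loc_integrable g" and wd: "has_weak_derivative w g"
  obtains w' where "abs_cont w' g" "AE x in lebesgue. w x = w' x"
proof -
  note P = abs_cont_prim[OF g]
  define u where "u x = w x - prim g x" for x
  have pi: "loc_integrable (prim g)" by (rule loc_integrable_continuous[OF abs_cont_continuous[OF P]])
  have u: "loc_integrable u" using w pi unfolding u_def loc_integrable_def by (auto intro: set_integral_diff)
  have "(LINT x|lebesgue. deriv \<eta> x *\<^sub>R u x) = 0" if \<eta>: "test_function \<eta>" for \<eta>
  proof -
    obtain A where A: "A > 0" "continuous_on UNIV (deriv \<eta>)" "\<And>x. \<bar>x\<bar> \<ge> A \<Longrightarrow> deriv \<eta> x = 0"
      using test_functionE[OF \<eta>] by metis
    have i: "integrable lebesgue (\<lambda>x. deriv \<eta> x *\<^sub>R f x)" if "loc_integrable f" for f :: "real \<Rightarrow> 'a"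
    proof (rule LINT_supported(1))
      show "(\<lambda>x. deriv \<eta> x *\<^sub>R f x) absolutely_integrable_on {-A..A}"
        using that by (intro abs_integrable_bilinear[OF bounded_bilinear_scaleR] continuous_on_subset[OF A(2)])
          (auto simp: loc_integrable_def)
      show "deriv \<eta> x *\<^sub>R f x = 0" if "x \<notin> {-A..A}" for x using A(3)[of x] that by auto
    qed
    have "(LINT x|lebesgue. deriv \<eta> x *\<^sub>R u x) = (LINT x|lebesgue. deriv \<eta> x *\<^sub>R w x) - (LINT x|lebesgue. deriv \<eta> x *\<^sub>R prim g x)"
      unfolding u_def scaleR_diff_right by (rule Bochner_Integration.integral_diff[OF i[OF w] i[OF pi]])
    then show ?thesis
      using wd abs_cont_weak_derivative[OF P] \<eta> by (simp add: has_weak_derivative_def)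
  qed
  then obtain k where k: "AE x in lebesgue. u x = k" using weakly_constant_imp_constant[OF u] by blast
  have "abs_cont (\<lambda>x. 1 *\<^sub>R k + 1 *\<^sub>R prim g x) (\<lambda>x. 1 *\<^sub>R 0 + 1 *\<^sub>R g x)"
    by (rule abs_cont_lincomb[OF abs_cont_const P])
  then have "abs_cont (\<lambda>x. k + prim g x) g" by simp
  moreover have "AE x in lebesgue. w x = k + prim g x" using k by eventually_elim (auto simp: u_def algebra_simps)
  ultimately show ?thesis using that by blast
qed

lemma AE_continuous_eq:
  fixes f g :: "real \<Rightarrow> 'a::euclidean_space"
  assumes "continuous_on UNIV f" "continuous_on UNIV g" "AE x in lebesgue. f x = g x"
  shows "f = g"
proof (rule ccontr)
  assume "f \<noteq> g"
  define S where "S = {x. f x - g x \<noteq> 0}"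
  have "open S" unfolding S_def using assms by (intro open_Collect_neq continuous_intros)
  moreover have "S \<noteq> {}" using \<open>f \<noteq> g\<close> by (auto simp: S_def fun_eq_iff)
  ultimately have "\<not> negligible S" using open_not_negligible by blast
  moreover have "negligible S"
  proof -
    obtain N where N: "\<And>x. x \<in> space lebesgue - N \<Longrightarrow> f x = g x" "N \<in> null_sets lebesgue"
      using AE_E3[OF assms(3)] by blast
    have "S \<subseteq> N" using N(1) by (force simp: S_def)
    then show ?thesis using negligible_subset N(2) negligible_iff_null_sets by blast
  qed
  ultimately show False by blast
qed

lemma weak_derivative_unique:
  fixes w :: "real \<Rightarrow> 'a::euclidean_space"
  assumes v: "abs_cont v g" and w: "loc_integrable w" "AE x in lebesgue. w x = v x"
    and h: "loc_integrable h" "has_weak_derivative w h"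
  shows "AE x in lebesgue. h x = g x"
proof -
  obtain w' where w': "abs_cont w' h" "AE x in lebesgue. w x = w' x"
    using weak_derivative_imp_abs_cont[OF w(1) h] by blast
  have "AE x in lebesgue. w' x = v x" using w(2) w'(2) by eventually_elim auto
  then have "w' = v" by (rule AE_continuous_eq[OF abs_cont_continuous[OF w'(1)] abs_cont_continuous[OF v]])
  have "AE x in lebesgue. h x - g x = 0"
  proof (rule AE_zero_of_interval_integrals)
    show "loc_integrable (\<lambda>x. h x - g x)"
      using v h(1) by (auto simp: loc_integrable_def abs_cont_def intro: set_integral_diff)
    show "integral {a..b} (\<lambda>x. h x - g x) = 0" if "a < b" for a b
      using abs_contD(3,4)[OF v, of a b] abs_contD(3,4)[OF w'(1), of a b] that \<open>w' = v\<close>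
      by (subst Henstock_Kurzweil_Integration.integral_diff) auto
  qed
  then show ?thesis by simp
qed

section \<open>Square integrable functions\<close>

abbreviation sq_int :: "(real \<Rightarrow> 'a::euclidean_space) \<Rightarrow> real" where
  "sq_int f \<equiv> (LINT x|lebesgue. (norm (f x))\<^sup>2)"

lemma L2D:
  assumes "L2 f" shows "f \<in> borel_measurable lebesgue" "integrable lebesgue (\<lambda>x. (norm (f x))\<^sup>2)"
  using assms by (auto simp: L2_def)

lemma L2_bounded_by:
  assumes "f \<in> borel_measurable lebesgue" "integrable lebesgue b" "\<And>x. (norm (f x))\<^sup>2 \<le> b x"
  shows "L2 f"
  unfolding L2_def
proof
  show "integrable lebesgue (\<lambda>x. (norm (f x))\<^sup>2)"
    by (rule Bochner_Integration.integrable_bound[OF assms(2)]) (use assms in \<open>auto intro!: AE_I2 order_trans[OF assms(3)]\<close>)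
qed (rule assms)

lemma norm_add_sq_le: "(norm (x + y))\<^sup>2 \<le> 2 * (norm x)\<^sup>2 + 2 * (norm (y::'a::real_inner))\<^sup>2"
proof -
  have "(norm (x + y))\<^sup>2 + (norm (x - y))\<^sup>2 = 2 * (norm x)\<^sup>2 + 2 * (norm y)\<^sup>2"
    by (simp add: power2_norm_eq_inner inner_add_left inner_add_right inner_diff_left inner_diff_right inner_commute)
  then show ?thesis by (smt (verit) zero_le_power2)
qed

lemma L2_scaleR: "L2 f \<Longrightarrow> L2 (\<lambda>x. r *\<^sub>R f x)"
  unfolding L2_def by (auto simp: power_mult_distrib)

lemma L2_add: "L2 f \<Longrightarrow> L2 g \<Longrightarrow> L2 (\<lambda>x. f x + g x)"
  by (rule L2_bounded_by[where b = "\<lambda>x. 2 * (norm (f x))\<^sup>2 + 2 * (norm (g x))\<^sup>2"])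
    (auto simp: L2_def norm_add_sq_le)

lemma L2_diff: "L2 f \<Longrightarrow> L2 g \<Longrightarrow> L2 (\<lambda>x. f x - g x)"
  using L2_add[of f "\<lambda>x. (-1) *\<^sub>R g x"] L2_scaleR[of g "-1"] by simp

lemma L2_inner:
  assumes "L2 f" "L2 g" shows "integrable lebesgue (\<lambda>x. f x \<bullet> g x)"
proof (rule Bochner_Integration.integrable_bound)
  show "integrable lebesgue (\<lambda>x. (norm (f x))\<^sup>2 + (norm (g x))\<^sup>2)" using assms by (simp add: L2_def)
  show "(\<lambda>x. f x \<bullet> g x) \<in> borel_measurable lebesgue"
    by (intro borel_measurable_inner L2D(1) assms)
  show "AE x in lebesgue. norm (f x \<bullet> g x) \<le> norm ((norm (f x))\<^sup>2 + (norm (g x))\<^sup>2)"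
  proof (intro AE_I2)
    fix x
    have "\<bar>f x \<bullet> g x\<bar> \<le> norm (f x) * norm (g x)" by (rule Cauchy_Schwarz_ineq2)
    also have "\<dots> \<le> (norm (f x))\<^sup>2 + (norm (g x))\<^sup>2"
      using sum_squares_bound[of "norm (f x)" "norm (g x)"] mult_nonneg_nonneg[OF norm_ge_zero[of "f x"] norm_ge_zero[of "g x"]] by linarith
    finally show "norm (f x \<bullet> g x) \<le> norm ((norm (f x))\<^sup>2 + (norm (g x))\<^sup>2)" by simp
  qed
qed

lemma integrable_imp_abs_int:
  fixes f :: "real \<Rightarrow> 'a::euclidean_space"
  assumes "integrable lebesgue f" shows "loc_integrable f"
  unfolding loc_integrable_def
proof (intro allI)
  fix a b
  have "set_integrable lebesgue UNIV f" using assms by (simp add: set_integrable_def)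
  then show "f absolutely_integrable_on {a..b}" by (rule set_integrable_subset) auto
qed

lemma square_integrable_imp_integrable:
  fixes f :: "real \<Rightarrow> 'a::euclidean_space"
  assumes "f \<in> borel_measurable lebesgue" "set_integrable lebesgue {a..b} (\<lambda>x. (norm (f x))\<^sup>2)"
  shows "f absolutely_integrable_on {a..b}"
  unfolding set_integrable_def
proof (rule Bochner_Integration.integrable_bound)
  have "set_integrable lebesgue {a..b} (\<lambda>x. 1::real)"
    by (rule absolutely_integrable_continuous_real) auto
  then have "set_integrable lebesgue {a..b} (\<lambda>x. 1 + (norm (f x))\<^sup>2)"
    using assms(2) by (rule set_integral_add)
  then show "integrable lebesgue (\<lambda>x. indicator {a..b} x *\<^sub>R (1 + (norm (f x))\<^sup>2))"
    by (simp add: set_integrable_def)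
  show "(\<lambda>x. indicat_real {a..b} x *\<^sub>R f x) \<in> borel_measurable lebesgue"
    using assms(1) by (intro borel_measurable_scaleR borel_measurable_indicator) auto
  show "AE x in lebesgue. norm (indicat_real {a..b} x *\<^sub>R f x) \<le> norm (indicat_real {a..b} x *\<^sub>R (1 + (norm (f x))\<^sup>2))"
  proof (intro AE_I2)
    fix x
    have "norm (f x) \<le> 1 + (norm (f x))\<^sup>2"
      using sum_squares_bound[of 1 "norm (f x)"] by (simp add: power2_eq_square) (smt (verit) norm_ge_zero)
    then show "norm (indicat_real {a..b} x *\<^sub>R f x) \<le> norm (indicat_real {a..b} x *\<^sub>R (1 + (norm (f x))\<^sup>2))"
      by (auto simp: indicator_def)
  qed
qed

lemma L2_loc_integrable: "L2_loc f \<Longrightarrow> loc_integrable f"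
  unfolding L2_loc_def loc_integrable_def using square_integrable_imp_integrable by blast

lemma L2_imp_L2_loc: "L2 f \<Longrightarrow> L2_loc f"
  using integrable_imp_abs_int[of "\<lambda>x. (norm (f x))\<^sup>2"] by (simp add: L2_loc_def L2_def loc_integrable_def)

lemma integral_interval_le_LINT:
  fixes f :: "real \<Rightarrow> real"
  assumes "integrable lebesgue f" "\<And>x. f x \<ge> 0"
  shows "integral {a..b} f \<le> (LINT x|lebesgue. f x)"
proof -
  have "integral {a..b} f \<le> integral UNIV f"
    using assms integrable_imp_abs_int[OF assms(1)] integrable_on_lebesgue[OF assms(1)]
    by (intro integral_subset_le) (auto simp: loc_integrable_def absolutely_integrable_on_def)
  then show ?thesis using integral_lebesgue[OF assms(1)] by simp
qed

text \<open>Expand \<open>\<integral> (\<bar>f\<bar> - s)\<^sup>2 \<ge> 0\<close>, with \<open>s\<close> the mean value of \<open>\<bar>f\<bar>\<close> over the interval.\<close>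
lemma L2_Cauchy_Schwarz:
  fixes f :: "real \<Rightarrow> 'a::euclidean_space"
  assumes f: "L2 f" and "a \<le> b"
  shows "(norm (integral {a..b} f))\<^sup>2 \<le> (b - a) * sq_int f"
proof (cases "a = b")
  case False
  then have ab: "a < b" using assms by simp
  have fi: "f absolutely_integrable_on {a..b}"
    using L2_loc_integrable[OF L2_imp_L2_loc[OF f]] by (simp add: loc_integrable_def)
  then have nf: "(\<lambda>x. norm (f x)) integrable_on {a..b}" "f integrable_on {a..b}" by (auto simp: absolutely_integrable_on_def)
  have nf2: "(\<lambda>x. (norm (f x))\<^sup>2) integrable_on {a..b}"
    using integrable_imp_abs_int[OF L2D(2)[OF f]] by (simp add: loc_integrable_def absolutely_integrable_on_def)
  define I where "I = integral {a..b} (\<lambda>x. norm (f x))"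
  define S where "S = integral {a..b} (\<lambda>x. (norm (f x))\<^sup>2)"
  define s where "s = I / (b - a)"
  have "((\<lambda>x. (norm (f x))\<^sup>2 - 2 * s * norm (f x) + s\<^sup>2) has_integral S - 2 * s * I + s\<^sup>2 * (b - a)) {a..b}"
    unfolding S_def I_def using nf nf2 has_integral_const_real[of "s\<^sup>2" a b] ab
    by (intro has_integral_add has_integral_diff has_integral_mult_right integrable_integral) (auto simp: mult.commute)
  then have "S - 2 * s * I + s\<^sup>2 * (b - a) \<ge> 0"
  proof (rule has_integral_nonneg)
    fix x
    have "(norm (f x) - s)\<^sup>2 \<ge> 0" by simp
    then show "0 \<le> (norm (f x))\<^sup>2 - 2 * s * norm (f x) + s\<^sup>2" by (simp add: power2_diff algebra_simps)
  qed
  then have "(b - a) * (S - 2 * s * I + s\<^sup>2 * (b - a)) \<ge> 0" using ab by simp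
  moreover have "s * (b - a) = I" using ab by (simp add: s_def)
  moreover have "(b - a) * (S - 2 * s * I + s\<^sup>2 * (b - a)) = (b - a) * S - 2 * (s * (b - a)) * I + (s * (b - a))\<^sup>2"
    by (simp add: power2_eq_square algebra_simps)
  ultimately have "I\<^sup>2 \<le> (b - a) * S" by (simp add: power2_eq_square)
  moreover have "norm (integral {a..b} f) \<le> I" unfolding I_def
    by (rule integral_norm_bound_integral) (use nf in auto)
  then have "(norm (integral {a..b} f))\<^sup>2 \<le> I\<^sup>2" by (simp add: power_mono)
  moreover have "S \<le> sq_int f"
    unfolding S_def by (rule integral_interval_le_LINT[OF L2D(2)[OF f]]) simp
  then have "(b - a) * S \<le> (b - a) * sq_int f" using ab by (intro mult_left_mono) auto
  ultimately show ?thesis by linarith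
qed simp

text \<open>Riesz and Fischer: a subsequence with increments of squared norm below \<open>4 ^ -k\<close> converges almost
  everywhere, because the weighted sum of squares \<open>F\<close> below has finite integral and bounds the
  \<open>k\<close>-th increment by \<open>sqrt (F / 2 ^ k)\<close>; Fatou's lemma identifies the limit in the mean.\<close>
lemma L2_complete:
  fixes h :: "nat \<Rightarrow> real \<Rightarrow> 'a::euclidean_space"
  assumes h: "\<And>n. L2 (h n)"
    and cauchy: "\<And>\<epsilon>. \<epsilon> > 0 \<Longrightarrow> \<exists>N. \<forall>m\<ge>N. \<forall>n\<ge>N. (LINT x|lebesgue. (norm (h m x - h n x))\<^sup>2) < \<epsilon>"
  obtains g where "L2 g" "(\<lambda>n. LINT x|lebesgue. (norm (h n x - g x))\<^sup>2) \<longlonglongrightarrow> 0"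
proof -
  have "\<exists>N. \<forall>m\<ge>N. \<forall>n\<ge>N. (LINT x|lebesgue. (norm (h m x - h n x))\<^sup>2) < (1/4)^k" for k by (rule cauchy) simp
  then obtain N where N: "\<And>k m n. m \<ge> N k \<Longrightarrow> n \<ge> N k \<Longrightarrow> (LINT x|lebesgue. (norm (h m x - h n x))\<^sup>2) < (1/4)^k"
    by metis
  define r where "r k = (\<Sum>i\<le>k. N i)" for k
  have rN: "N k \<le> r k" "r k \<le> r (Suc k)" for k
    by (auto simp: r_def intro: member_le_sum)
  have hm: "h n \<in> borel_measurable lebesgue" for n using h L2D by blast
  have nn: "(\<integral>\<^sup>+x. ennreal ((norm (h m x - h n x))\<^sup>2) \<partial>lebesgue) = ennreal (LINT x|lebesgue. (norm (h m x - h n x))\<^sup>2)" for m n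
    using L2D(2)[OF L2_diff[OF h h]] by (intro nn_integral_eq_integral) auto
  define F where "F x = (\<Sum>k. ennreal (2^k * (norm (h (r (Suc k)) x - h (r k) x))\<^sup>2))" for x
  have "(\<integral>\<^sup>+x. F x \<partial>lebesgue) = (\<Sum>k. \<integral>\<^sup>+x. ennreal (2^k * (norm (h (r (Suc k)) x - h (r k) x))\<^sup>2) \<partial>lebesgue)"
    unfolding F_def by (rule nn_integral_suminf) (use hm in measurable)
  also have "\<dots> \<le> (\<Sum>k. ennreal ((1/2)^k))"
  proof (intro suminf_le summableI)
    fix k
    have "(\<integral>\<^sup>+x. ennreal (2^k * (norm (h (r (Suc k)) x - h (r k) x))\<^sup>2) \<partial>lebesgue)
       = ennreal (2^k) * (\<integral>\<^sup>+x. ennreal ((norm (h (r (Suc k)) x - h (r k) x))\<^sup>2) \<partial>lebesgue)"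
      using hm by (subst nn_integral_cmult[symmetric]) (auto simp: ennreal_mult)
    also have "\<dots> \<le> ennreal (2^k) * ennreal ((1/4)^k)"
      unfolding nn using N[of k "r (Suc k)" "r k"] rN[of k] by (intro mult_left_mono ennreal_leI) auto
    also have "\<dots> = ennreal ((1/2)^k)" by (simp flip: ennreal_mult power_mult_distrib)
    finally show "(\<integral>\<^sup>+x. ennreal (2^k * (norm (h (r (Suc k)) x - h (r k) x))\<^sup>2) \<partial>lebesgue) \<le> ennreal ((1/2)^k)" .
  qed
  also have "\<dots> = ennreal (\<Sum>k. (1/2::real)^k)" by (intro suminf_ennreal2 summable_geometric) auto
  also have "\<dots> < \<infinity>" by simp
  finally have "(\<integral>\<^sup>+x. F x \<partial>lebesgue) \<noteq> \<infinity>" by simp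
  moreover have "F \<in> borel_measurable lebesgue" unfolding F_def using hm by measurable
  ultimately have "AE x in lebesgue. F x \<noteq> \<infinity>" using nn_integral_noteq_infinite by blast
  moreover have conv: "convergent (\<lambda>k. h (r k) x)" if Fx: "F x \<noteq> \<infinity>" for x
  proof -
    define C where "C = enn2real (F x)"
    have FC: "F x = ennreal C" using Fx by (simp add: C_def top.not_eq_extremum)
    have C0: "C \<ge> 0" by (simp add: C_def)
    define a where "a k = norm (h (r (Suc k)) x - h (r k) x)" for k
    have ak: "a k \<le> sqrt C * (sqrt (1/2))^k" for k
    proof -
      have "ennreal (2^k * (a k)\<^sup>2) \<le> F x"
        unfolding F_def a_def using sum_le_suminf[OF summableI, of "{k}"] by force
      then have "2^k * (a k)\<^sup>2 \<le> C" using FC C0 by simp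
      then have "(a k)\<^sup>2 \<le> C * (1/2)^k" by (simp add: power_one_over field_simps)
      then have "sqrt ((a k)\<^sup>2) \<le> sqrt (C * (1/2)^k)" by (rule real_sqrt_le_mono)
      then show ?thesis by (simp add: real_sqrt_mult real_sqrt_power a_def)
    qed
    have "summable (\<lambda>k. sqrt C * (sqrt (1/2))^k)" by (intro summable_mult summable_geometric) (simp add: real_sqrt_divide)
    then have "summable (\<lambda>k. h (r (Suc k)) x - h (r k) x)"
      by (rule summable_comparison_test') (use ak a_def in auto)
    then obtain L where "(\<lambda>n. \<Sum>k<n. h (r (Suc k)) x - h (r k) x) \<longlonglongrightarrow> L"
      unfolding summable_def sums_def by blast
    moreover have "(\<Sum>k<n. h (r (Suc k)) x - h (r k) x) = h (r n) x - h (r 0) x" for n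
      by (rule sum_lessThan_telescope)
    ultimately have "(\<lambda>n. (h (r n) x - h (r 0) x) + h (r 0) x) \<longlonglongrightarrow> L + h (r 0) x"
      by (intro tendsto_add tendsto_const) simp
    then show ?thesis by (auto simp: convergent_def)
  qed
  define g where "g x = lim (\<lambda>k. h (r k) x)" for x
  have gm: "g \<in> borel_measurable lebesgue" unfolding g_def using hm by measurable
  have lim: "AE x in lebesgue. (\<lambda>k. h (r k) x) \<longlonglongrightarrow> g x"
    using calculation by eventually_elim (use conv g_def convergent_LIMSEQ_iff in auto)
  have fatou: "(\<integral>\<^sup>+x. ennreal ((norm (h n x - g x))\<^sup>2) \<partial>lebesgue) \<le> ennreal ((1/4)^j)" if "n \<ge> N j" for n j
  proof -
    have "(\<integral>\<^sup>+x. ennreal ((norm (h n x - g x))\<^sup>2) \<partial>lebesgue) = (\<integral>\<^sup>+x. liminf (\<lambda>k. ennreal ((norm (h n x - h (r k) x))\<^sup>2)) \<partial>lebesgue)"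
    proof (rule nn_integral_cong_AE, use lim in eventually_elim)
      fix x assume "(\<lambda>k. h (r k) x) \<longlonglongrightarrow> g x"
      then have "(\<lambda>k. ennreal ((norm (h n x - h (r k) x))\<^sup>2)) \<longlonglongrightarrow> ennreal ((norm (h n x - g x))\<^sup>2)"
        by (intro tendsto_intros)
      then show "ennreal ((norm (h n x - g x))\<^sup>2) = liminf (\<lambda>k. ennreal ((norm (h n x - h (r k) x))\<^sup>2))"
        using lim_imp_Liminf trivial_limit_sequentially by metis
    qed
    also have "\<dots> \<le> liminf (\<lambda>k. \<integral>\<^sup>+x. ennreal ((norm (h n x - h (r k) x))\<^sup>2) \<partial>lebesgue)"
      by (rule nn_integral_liminf) (use hm in measurable)
    also have "\<dots> \<le> liminf (\<lambda>k::nat. ennreal ((1/4)^j))"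
    proof (rule Liminf_mono, rule eventually_sequentiallyI[of j])
      fix k assume "j \<le> k"
      then have "N j \<le> r k" unfolding r_def by (intro member_le_sum) auto
      then show "(\<integral>\<^sup>+x. ennreal ((norm (h n x - h (r k) x))\<^sup>2) \<partial>lebesgue) \<le> ennreal ((1/4)^j)"
        unfolding nn using N[OF that] by (intro ennreal_leI less_imp_le) auto
    qed
    also have "\<dots> = ennreal ((1/4)^j)" by (simp add: Liminf_const)
    finally show ?thesis .
  qed
  have hg: "L2 (\<lambda>x. h n x - g x)" if "n \<ge> N j" for n j
    unfolding L2_def
  proof
    show "(\<lambda>x. h n x - g x) \<in> borel_measurable lebesgue" using hm gm by measurable
    show "integrable lebesgue (\<lambda>x. (norm (h n x - g x))\<^sup>2)"
      using fatou[OF that] hm gm by (intro integrableI_bounded) (auto intro: le_less_trans)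
  qed
  have g: "L2 g" using L2_diff[OF h hg[OF order_refl], of "N 0" 0] by simp
  have "(\<lambda>n. LINT x|lebesgue. (norm (h n x - g x))\<^sup>2) \<longlonglongrightarrow> 0"
  proof (rule LIMSEQ_I)
    fix \<epsilon> :: real assume "\<epsilon> > 0"
    obtain j where j: "(1/4::real)^j < \<epsilon>" using real_arch_pow_inv[OF \<open>\<epsilon> > 0\<close>, of "1/4"] by auto
    have "norm (sq_int (\<lambda>x. h n x - g x) - 0) < \<epsilon>" if "n \<ge> N j" for n
    proof -
      have "ennreal (sq_int (\<lambda>x. h n x - g x)) \<le> ennreal ((1/4)^j)"
        using fatou[OF that] L2D(2)[OF hg[OF that]] by (subst nn_integral_eq_integral[symmetric]) auto
      then have "sq_int (\<lambda>x. h n x - g x) \<le> (1/4)^j" by (subst (asm) ennreal_le_iff) auto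
      then show ?thesis using j by simp
    qed
    then show "\<exists>no. \<forall>n\<ge>no. norm (sq_int (\<lambda>x. h n x - g x) - 0) < \<epsilon>" by blast
  qed
  then show ?thesis using that g by blast
qed

lemma L2_norm_sq_perturb:
  fixes f g :: "real \<Rightarrow> 'a::euclidean_space"
  assumes "L2 f" "L2 g" "\<eta> > 0"
  shows "sq_int g \<le>
     (1 + \<eta>) * sq_int f + (1 + 1/\<eta>) * (LINT x|lebesgue. (norm (f x - g x))\<^sup>2)"
proof -
  have pt: "(norm b)\<^sup>2 \<le> (1 + \<eta>) * (norm a)\<^sup>2 + (1 + 1/\<eta>) * (norm (a - b))\<^sup>2" for a b :: 'a
  proof -
    have "norm b \<le> norm a + norm (a - b)" by (metis norm_triangle_sub norm_minus_commute add.commute)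
    then have "(norm b)\<^sup>2 \<le> (norm a + norm (a - b))\<^sup>2" by (intro power_mono) auto
    moreover have "0 \<le> (sqrt \<eta> * norm a - norm (a - b) / sqrt \<eta>)\<^sup>2" by simp
    then have "2 * norm a * norm (a - b) \<le> \<eta> * (norm a)\<^sup>2 + (norm (a - b))\<^sup>2 / \<eta>"
      using assms(3) by (simp add: power2_diff power_mult_distrib power_divide)
    ultimately show ?thesis by (simp add: power2_sum algebra_simps)
  qed
  have i: "integrable lebesgue (\<lambda>x. (1 + \<eta>) * (norm (f x))\<^sup>2)"
    "integrable lebesgue (\<lambda>x. (1 + 1/\<eta>) * (norm (f x - g x))\<^sup>2)"
    using L2D(2)[OF assms(1)] L2D(2)[OF L2_diff[OF assms(1,2)]] by auto
  have "sq_int g \<le> (LINT x|lebesgue. (1 + \<eta>) * (norm (f x))\<^sup>2 + (1 + 1/\<eta>) * (norm (f x - g x))\<^sup>2)"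
    by (rule integral_mono[OF L2D(2)[OF assms(2)] Bochner_Integration.integrable_add[OF i]]) (rule pt)
  also have "\<dots> = (1 + \<eta>) * sq_int f + (1 + 1/\<eta>) * (LINT x|lebesgue. (norm (f x - g x))\<^sup>2)"
    by (simp only: Bochner_Integration.integral_add[OF i] integral_mult_right_zero)
  finally show ?thesis .
qed

lemma L2_parallelogram:
  fixes f g :: "real \<Rightarrow> 'a::euclidean_space"
  assumes "L2 f" "L2 g"
  shows "(LINT x|lebesgue. (norm (f x - g x))\<^sup>2) =
     2 * sq_int f + 2 * sq_int g
     - 4 * (LINT x|lebesgue. (norm ((1/2) *\<^sub>R f x + (1/2) *\<^sub>R g x))\<^sup>2)"
proof -
  have pt: "(norm (a - b))\<^sup>2 = 2 * (norm a)\<^sup>2 + 2 * (norm b)\<^sup>2 - 4 * (norm ((1/2) *\<^sub>R a + (1/2) *\<^sub>R b))\<^sup>2" for a b :: 'a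
    by (simp add: power2_norm_eq_inner inner_add_left inner_add_right inner_diff_left inner_diff_right inner_commute)
  have i: "integrable lebesgue (\<lambda>x. 2 * (norm (f x))\<^sup>2)" "integrable lebesgue (\<lambda>x. 2 * (norm (g x))\<^sup>2)"
    "integrable lebesgue (\<lambda>x. 4 * (norm ((1/2) *\<^sub>R f x + (1/2) *\<^sub>R g x))\<^sup>2)"
    using L2D(2)[OF assms(1)] L2D(2)[OF assms(2)] L2D(2)[OF L2_add[OF L2_scaleR[OF assms(1)] L2_scaleR[OF assms(2)]]] by auto
  show ?thesis
    unfolding pt
    by (simp only: Bochner_Integration.integral_diff[OF Bochner_Integration.integrable_add[OF i(1,2)] i(3)]
        Bochner_Integration.integral_add[OF i(1,2)] integral_mult_right_zero)
qed

lemma abs_cont_prim_eq: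
  assumes "abs_cont v g" shows "prim g x = v x - v 0"
  using abs_cont_eq_prim[OF assms, of x] by simp

lemma prim_lincomb:
  assumes "loc_integrable g" "loc_integrable h"
  shows "prim (\<lambda>x. r *\<^sub>R g x + s *\<^sub>R h x) x = r *\<^sub>R prim g x + s *\<^sub>R prim h x"
  using abs_cont_prim_eq[OF abs_cont_lincomb[OF abs_cont_prim[OF assms(1)] abs_cont_prim[OF assms(2)]], of r s x]
  by (simp add: prim_def)

lemma L2_prim_bound:
  fixes f :: "real \<Rightarrow> 'a::euclidean_space"
  assumes "L2 f" shows "(norm (prim f x))\<^sup>2 \<le> \<bar>x\<bar> * sq_int f"
  using L2_Cauchy_Schwarz[OF assms, of 0 x] L2_Cauchy_Schwarz[OF assms, of x 0] by (auto simp: prim_def)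

text \<open>Weak lower semicontinuity of the Dirichlet integral, without weak topologies. The functions \<open>h\<close>
  whose primitives from 0 are \<open>1 / (N + 1)\<close>-close to \<open>v - v 0\<close> on \<open>[-N, N]\<close> form convex sets \<open>A N\<close>, decreasing in \<open>N\<close>, and
  \<open>gn n\<close> eventually lies in each of them, so that the infima \<open>d N\<close> of the squared norm increase to
  some \<open>D \<le> \<kappa>\<close>. By the parallelogram identity near-minimisers in \<open>A N\<close> form a Cauchy sequence; its
  limit is the derivative of \<open>v\<close>.\<close>
lemma L2_weak_limit:
  fixes v :: "real \<Rightarrow> 'a::euclidean_space"
  assumes vn: "\<And>n. abs_cont (vn n) (gn n)" and gn: "\<And>n. L2 (gn n)"
    and \<kappa>: "(\<lambda>n. LINT x|lebesgue. (norm (gn n x))\<^sup>2) \<longlonglongrightarrow> \<kappa>"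
    and lim: "\<And>R \<epsilon>. \<epsilon> > 0 \<Longrightarrow> \<exists>N. \<forall>n\<ge>N. \<forall>x. \<bar>x\<bar> \<le> R \<longrightarrow> norm (vn n x - v x) \<le> \<epsilon>"
  obtains g where "L2 g" "abs_cont v g" "sq_int g \<le> \<kappa>"
proof -
  define Q where "Q h = sq_int h" for h :: "real \<Rightarrow> 'a"
  have Q0: "Q h \<ge> 0" for h by (simp add: Q_def)
  define A where "A N = {h. L2 h \<and> (\<forall>x. \<bar>x\<bar> \<le> real N \<longrightarrow> norm (prim h x - (v x - v 0)) \<le> 1 / real (Suc N))}" for N :: nat
  have L2li: "loc_integrable h" if "L2 h" for h :: "real \<Rightarrow> 'a" by (rule L2_loc_integrable[OF L2_imp_L2_loc[OF that]])
  have ev: "eventually (\<lambda>n. gn n \<in> A N) sequentially" for N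
  proof -
    have "1 / real (Suc N) / 2 > 0" by simp
    then obtain M where M: "\<And>n x. n \<ge> M \<Longrightarrow> \<bar>x\<bar> \<le> real N \<Longrightarrow> norm (vn n x - v x) \<le> 1 / real (Suc N) / 2"
      using lim[of _ "real N"] by blast
    have "gn n \<in> A N" if n: "n \<ge> M" for n
    proof -
      have "norm (prim (gn n) x - (v x - v 0)) \<le> 1 / real (Suc N)" if x: "\<bar>x\<bar> \<le> real N" for x
      proof -
        have "prim (gn n) x - (v x - v 0) = (vn n x - v x) - (vn n 0 - v 0)"
          by (simp add: abs_cont_prim_eq[OF vn])
        also have "norm \<dots> \<le> norm (vn n x - v x) + norm (vn n 0 - v 0)" by (rule norm_triangle_ineq4)
        also have "\<dots> \<le> 1 / real (Suc N) / 2 + 1 / real (Suc N) / 2"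
          using M[OF n x] M[OF n, of 0] by (intro add_mono) auto
        also have "\<dots> = 1 / real (Suc N)" by (rule field_sum_of_halves)
        finally show ?thesis .
      qed
      then show ?thesis using gn by (simp add: A_def)
    qed
    then show ?thesis unfolding eventually_sequentially by blast
  qed
  have A_anti: "A M \<subseteq> A N" if "N \<le> M" for N M
  proof
    fix h assume h: "h \<in> A M"
    have "1 / real (Suc M) \<le> 1 / real (Suc N)" using that by (simp add: frac_le)
    have "norm (prim h x - (v x - v 0)) \<le> 1 / real (Suc N)" if "\<bar>x\<bar> \<le> real N" for x
    proof -
      have "norm (prim h x - (v x - v 0)) \<le> 1 / real (Suc M)"
        using h that \<open>N \<le> M\<close> unfolding A_def by simp
      then show ?thesis using \<open>1 / real (Suc M) \<le> 1 / real (Suc N)\<close> by (rule order_trans)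
    qed
    then show "h \<in> A N" using h unfolding A_def by simp
  qed
  have A_ne: "A N \<noteq> {}" for N using ev[of N] unfolding eventually_sequentially by blast
  have A_mid: "(\<lambda>x. (1/2) *\<^sub>R f x + (1/2) *\<^sub>R h x) \<in> A N" if f: "f \<in> A N" and h: "h \<in> A N" for f h N
  proof -
    have L: "L2 f" "L2 h" using f h by (auto simp: A_def)
    have "norm (prim (\<lambda>x. (1/2) *\<^sub>R f x + (1/2) *\<^sub>R h x) x - (v x - v 0)) \<le> 1 / real (Suc N)" if x: "\<bar>x\<bar> \<le> real N" for x
    proof -
      have "prim (\<lambda>x. (1/2) *\<^sub>R f x + (1/2) *\<^sub>R h x) x - (v x - v 0)
         = (1/2) *\<^sub>R (prim f x - (v x - v 0)) + (1/2) *\<^sub>R (prim h x - (v x - v 0))"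
        unfolding prim_lincomb[OF L2li[OF L(1)] L2li[OF L(2)]] scaleR_diff_right
        by (simp add: algebra_simps flip: scaleR_add_left)
      also have "norm \<dots> \<le> (1/2) * norm (prim f x - (v x - v 0)) + (1/2) * norm (prim h x - (v x - v 0))"
        by (rule order_trans[OF norm_triangle_ineq]) simp
      also have "\<dots> \<le> (1/2) * (1 / real (Suc N)) + (1/2) * (1 / real (Suc N))"
        using f h x unfolding A_def by (intro add_mono mult_left_mono) auto
      also have "\<dots> = 1 / real (Suc N)" by (simp add: field_simps)
      finally show ?thesis .
    qed
    then show ?thesis using L by (auto simp: A_def intro!: L2_add L2_scaleR)
  qed
  define d where "d N = Inf (Q ` A N)" for N
  have bdd: "bdd_below (Q ` A N)" for N using Q0 by (intro bdd_belowI[of _ 0]) auto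
  have d_le: "d N \<le> Q h" if "h \<in> A N" for N h unfolding d_def using that bdd by (intro cInf_lower) auto
  have d\<kappa>: "d N \<le> \<kappa>" for N
    by (rule tendsto_lowerbound[OF \<kappa>]) (use ev[of N] in \<open>auto elim!: eventually_mono dest: d_le simp: Q_def[symmetric]\<close>)
  have "incseq d"
    unfolding incseq_def d_def using A_anti A_ne bdd by (auto intro!: cInf_superset_mono image_mono)
  then obtain D where D: "d \<longlonglongrightarrow> D" "\<And>N. d N \<le> D"
    using incseq_convergent[of d \<kappa>] d\<kappa> by blast
  have D\<kappa>: "D \<le> \<kappa>" using D(1) d\<kappa> LIMSEQ_le_const2 by blast
  have "\<exists>h. h \<in> A N \<and> Q h < d N + 1 / real (Suc N)" for N
  proof -
    have "Inf (Q ` A N) < d N + 1 / real (Suc N)" by (simp add: d_def)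
    then show ?thesis using cInf_lessD[of "Q ` A N"] A_ne[of N] by auto
  qed
  then obtain h where h: "\<And>N. h N \<in> A N" "\<And>N. Q (h N) < d N + 1 / real (Suc N)" by metis
  have hL: "L2 (h N)" for N using h(1)[of N] by (simp add: A_def)
  have close: "(LINT x|lebesgue. (norm (h N x - h M x))\<^sup>2) \<le> 2 * (D - d N) + 4 / real (Suc N)" if "N \<le> M" for N M
  proof -
    have "d N \<le> Q (\<lambda>x. (1/2) *\<^sub>R h N x + (1/2) *\<^sub>R h M x)"
      using A_anti[OF that] h(1) by (intro d_le A_mid) auto
    moreover have "(LINT x|lebesgue. (norm (h N x - h M x))\<^sup>2) = 2 * Q (h N) + 2 * Q (h M) - 4 * Q (\<lambda>x. (1/2) *\<^sub>R h N x + (1/2) *\<^sub>R h M x)"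
      unfolding Q_def by (rule L2_parallelogram[OF hL hL])
    moreover have "1 / real (Suc M) \<le> 1 / real (Suc N)" using that by (simp add: frac_le)
    moreover have "q \<le> 2 * (D - p) + 4 * s"
      if "p \<le> m" "q = 2 * a + 2 * b - 4 * m" "t \<le> s" "a < p + s" "b < r + t" "r \<le> D" for p q a b m r s t :: real
      using that by argo
    ultimately have "(LINT x|lebesgue. (norm (h N x - h M x))\<^sup>2) \<le> 2 * (D - d N) + 4 * (1 / real (Suc N))"
      using h(2)[of N] h(2)[of M] D(2)[of M] by blast
    then show ?thesis by simp
  qed
  have "(\<lambda>N. 2 * (D - d N) + 4 * (1 / real (Suc N))) \<longlonglongrightarrow> 2 * (D - D) + 4 * 0"
    by (intro tendsto_intros D(1) LIMSEQ_Suc[OF lim_1_over_n])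
  then have small: "(\<lambda>N. 2 * (D - d N) + 4 / real (Suc N)) \<longlonglongrightarrow> 0" by simp
  obtain g where g: "L2 g" "(\<lambda>n. LINT x|lebesgue. (norm (h n x - g x))\<^sup>2) \<longlonglongrightarrow> 0"
  proof (rule L2_complete[of h])
    fix \<epsilon> :: real assume "\<epsilon> > 0"
    then obtain N where N: "\<And>n. n \<ge> N \<Longrightarrow> 2 * (D - d n) + 4 / real (Suc n) < \<epsilon>"
      using order_tendstoD(2)[OF small] unfolding eventually_sequentially by blast
    have "(LINT x|lebesgue. (norm (h m x - h n x))\<^sup>2) < \<epsilon>" if "m \<ge> N" "n \<ge> N" for m n
    proof (cases "m \<le> n")
      case True
      then show ?thesis using close[of m n] N[OF that(1)] by simp
    next
      case False
      have "(LINT x|lebesgue. (norm (h m x - h n x))\<^sup>2) = (LINT x|lebesgue. (norm (h n x - h m x))\<^sup>2)"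
        by (simp add: norm_minus_commute)
      then show ?thesis using False close[of n m] N[OF that(2)] by simp
    qed
    then show "\<exists>N. \<forall>m\<ge>N. \<forall>n\<ge>N. (LINT x|lebesgue. (norm (h m x - h n x))\<^sup>2) < \<epsilon>" by blast
  qed (use hL in auto)
  have Qh: "(\<lambda>N. Q (h N)) \<longlonglongrightarrow> D"
  proof (rule tendsto_sandwich[OF _ _ D(1)])
    show "eventually (\<lambda>N. d N \<le> Q (h N)) sequentially" using d_le[OF h(1)] by (intro always_eventually) auto
    show "eventually (\<lambda>N. Q (h N) \<le> d N + 1 / real (Suc N)) sequentially"
      using h(2) by (intro always_eventually) (auto intro: less_imp_le)
    have "(\<lambda>N. d N + 1 / real (Suc N)) \<longlonglongrightarrow> D + 0" by (intro tendsto_intros D(1) LIMSEQ_Suc[OF lim_1_over_n])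
    then show "(\<lambda>N. d N + 1 / real (Suc N)) \<longlonglongrightarrow> D" by simp
  qed
  have "Q g \<le> (1 + \<eta>) * D" if "\<eta> > 0" for \<eta>
  proof (rule LIMSEQ_le_const)
    show "(\<lambda>N. (1 + \<eta>) * Q (h N) + (1 + 1/\<eta>) * (LINT x|lebesgue. (norm (h N x - g x))\<^sup>2)) \<longlonglongrightarrow> (1 + \<eta>) * D"
      using tendsto_add[OF tendsto_mult_left[OF Qh, of "1+\<eta>"] tendsto_mult_left[OF g(2), of "1 + 1/\<eta>"]] by simp
    show "\<exists>N. \<forall>n\<ge>N. Q g \<le> (1 + \<eta>) * Q (h n) + (1 + 1/\<eta>) * sq_int (\<lambda>x. h n x - g x)"
      unfolding Q_def using L2_norm_sq_perturb[OF hL g(1) that] by blast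
  qed
  note Q\<eta> = this
  have "Q g \<le> D"
  proof (rule LIMSEQ_le_const)
    have "(\<lambda>N. (1 + 1 / real (Suc N)) * D) \<longlonglongrightarrow> (1 + 0) * D" by (intro tendsto_intros LIMSEQ_Suc[OF lim_1_over_n])
    then show "(\<lambda>N. (1 + 1 / real (Suc N)) * D) \<longlonglongrightarrow> D" by simp
    show "\<exists>N. \<forall>n\<ge>N. Q g \<le> (1 + 1 / real (Suc n)) * D" using Q\<eta> by auto
  qed
  then have Qg: "Q g \<le> \<kappa>" using D\<kappa> by simp
  have pg: "prim g x = v x - v 0" for x
  proof -
    have "(\<lambda>N. prim (h N) x) \<longlonglongrightarrow> prim g x"
    proof (rule Lim_transform2)
      show "(\<lambda>N. prim g x) \<longlonglongrightarrow> prim g x" by simp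
      have "(\<lambda>N. (norm (prim (h N) x - prim g x))\<^sup>2) \<longlonglongrightarrow> 0"
      proof (rule tendsto_sandwich[OF _ _ tendsto_const])
        show "eventually (\<lambda>N. 0 \<le> (norm (prim (h N) x - prim g x))\<^sup>2) sequentially" by simp
        have "(norm (prim (h N) x - prim g x))\<^sup>2 \<le> \<bar>x\<bar> * (LINT x|lebesgue. (norm (h N x - g x))\<^sup>2)" for N
          using L2_prim_bound[OF L2_diff[OF hL[of N] g(1)], of x] prim_lincomb[OF L2li[OF hL[of N]] L2li[OF g(1)], of 1 "-1" x] by simp
        then show "eventually (\<lambda>N. (norm (prim (h N) x - prim g x))\<^sup>2 \<le> \<bar>x\<bar> * (LINT x|lebesgue. (norm (h N x - g x))\<^sup>2)) sequentially"
          by simp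
        show "(\<lambda>N. \<bar>x\<bar> * (LINT x|lebesgue. (norm (h N x - g x))\<^sup>2)) \<longlonglongrightarrow> 0"
          using tendsto_mult_left[OF g(2), of "\<bar>x\<bar>"] by simp
      qed
      then have "(\<lambda>N. norm (prim (h N) x - prim g x)) \<longlonglongrightarrow> 0"
        using tendsto_real_sqrt[of "\<lambda>N. (norm (prim (h N) x - prim g x))\<^sup>2" 0] by simp
      then show "(\<lambda>N. prim g x - prim (h N) x) \<longlonglongrightarrow> 0"
        by (subst (asm) norm_minus_commute) (rule tendsto_norm_zero_cancel)
    qed
    moreover have "(\<lambda>N. prim (h N) x) \<longlonglongrightarrow> v x - v 0"
    proof (rule Lim_transform2)
      show "(\<lambda>N. v x - v 0) \<longlonglongrightarrow> v x - v 0" by simp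
      obtain M :: nat where M: "\<bar>x\<bar> \<le> real M" using real_arch_simple by blast
      show "(\<lambda>N. v x - v 0 - prim (h N) x) \<longlonglongrightarrow> 0"
      proof (rule Lim_null_comparison)
        show "eventually (\<lambda>N. norm (v x - v 0 - prim (h N) x) \<le> 1 / real (Suc N)) sequentially"
          using M h(1) by (intro eventually_sequentiallyI[of M]) (auto simp: A_def norm_minus_commute)
        show "(\<lambda>N. 1 / real (Suc N)) \<longlonglongrightarrow> 0" by (rule LIMSEQ_Suc[OF lim_1_over_n])
      qed
    qed
    ultimately show ?thesis by (rule LIMSEQ_unique)
  qed
  have "abs_cont (\<lambda>x. 1 *\<^sub>R v 0 + 1 *\<^sub>R prim g x) (\<lambda>x. 1 *\<^sub>R 0 + 1 *\<^sub>R g x)"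
    by (rule abs_cont_lincomb[OF abs_cont_const abs_cont_prim[OF L2li[OF g(1)]]])
  then have "abs_cont v g" by (simp add: pg)
  then show ?thesis using that g(1) Qg by (simp add: Q_def)
qed

section \<open>The Sobolev space of the line\<close>

text \<open>The Sobolev space of order one, as pairs of a function and its derivative.\<close>
definition sobolev :: "(real \<Rightarrow> 'a::euclidean_space) \<Rightarrow> (real \<Rightarrow> 'a) \<Rightarrow> bool" where
  "sobolev v g \<longleftrightarrow> L2 v \<and> L2 g \<and> abs_cont v g"

text \<open>Barbalat's argument: by uniform continuity a value of norm at least \<open>\<epsilon>\<close> forces a fixed amount of
  the integral of the square onto an interval of fixed length, but the increments of the bounded
  monotone function \<open>G\<close> tend to 0.\<close>
lemma square_integral_tendsto_0_at_top:
  fixes F :: "real \<Rightarrow> 'a::euclidean_space"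
  assumes uc: "uniformly_continuous_on UNIV F"
    and G: "\<And>a b. a \<le> b \<Longrightarrow> ((\<lambda>t. (norm (F t))\<^sup>2) has_integral (G b - G a)) {a..b}"
    and bdd: "bounded (range G)"
  shows "(F \<longlongrightarrow> 0) at_top"
proof (rule tendstoI)
  fix \<epsilon> :: real assume \<epsilon>: "\<epsilon> > 0"
  then obtain \<delta> where \<delta>: "\<delta> > 0" "\<And>x y. dist y x < \<delta> \<Longrightarrow> dist (F y) (F x) < \<epsilon>/2"
    using uc unfolding uniformly_continuous_on_def by (metis UNIV_I half_gt_zero)
  define c where "c = (\<delta>/2) * (\<epsilon>/2)\<^sup>2"
  have c: "c > 0" using \<epsilon> \<delta> by (simp add: c_def)
  have mono: "G a \<le> G b" if "a \<le> b" for a b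
    using has_integral_nonneg[OF G[OF that]] by simp
  have ba: "bdd_above (range G)" by (rule bounded_imp_bdd_above[OF bdd])
  have "Sup (range G) - c < Sup (range G)" using c by simp
  then obtain x0 where x0: "Sup (range G) - c < G x0" using less_cSup_iff[OF _ ba] by auto
  have "dist (F x) 0 < \<epsilon>" if x: "x \<ge> x0" for x
  proof (rule ccontr)
    assume "\<not> dist (F x) 0 < \<epsilon>"
    then have Fx: "norm (F x) \<ge> \<epsilon>" by simp
    have low: "(\<epsilon>/2)\<^sup>2 \<le> (norm (F t))\<^sup>2" if "t \<in> {x..x+\<delta>/2}" for t
    proof -
      have "dist (F t) (F x) < \<epsilon>/2" using that \<delta>(1) by (intro \<delta>(2)) (auto simp: dist_real_def)
      then have "norm (F x) - norm (F t) < \<epsilon>/2"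
        using norm_triangle_ineq2[of "F x" "F t"] by (simp add: dist_norm norm_minus_commute)
      then show ?thesis using Fx \<epsilon> by (intro power_mono) auto
    qed
    have "((\<lambda>t. (\<epsilon>/2)\<^sup>2) has_integral c) {x..x+\<delta>/2}"
      using has_integral_const_real[of "(\<epsilon>/2)\<^sup>2" x "x + \<delta>/2"] \<delta>(1) by (simp add: c_def)
    then have "c \<le> G (x + \<delta>/2) - G x"
      using \<delta>(1) low by (intro has_integral_le[OF _ G]) auto
    moreover have "G (x + \<delta>/2) \<le> Sup (range G)" using ba by (intro cSup_upper) auto
    moreover have "G x0 \<le> G x" using mono x by blast
    ultimately show False using x0 by linarith
  qed
  then show "eventually (\<lambda>x. dist (F x) 0 < \<epsilon>) at_top" unfolding eventually_at_top_linorder by blast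
qed

lemma square_integral_tendsto_0_at_bot:
  fixes F :: "real \<Rightarrow> 'a::euclidean_space"
  assumes uc: "uniformly_continuous_on UNIV F"
    and G: "\<And>a b. a \<le> b \<Longrightarrow> ((\<lambda>t. (norm (F t))\<^sup>2) has_integral (G b - G a)) {a..b}"
    and bdd: "bounded (range G)"
  shows "(F \<longlongrightarrow> 0) at_bot"
proof -
  have "((\<lambda>x. F (- x)) \<longlongrightarrow> 0) at_top"
  proof (rule square_integral_tendsto_0_at_top[where G = "\<lambda>x. - G (- x)"])
    have "dist (- y) (- x) = dist y x" for x y :: real by (simp add: dist_real_def)
    then show "uniformly_continuous_on UNIV (\<lambda>x. F (- x))"
      using uc unfolding uniformly_continuous_on_def by (metis UNIV_I)
    show "((\<lambda>t. (norm (F (- t)))\<^sup>2) has_integral - G (- b) - - G (- a)) {a..b}" if "a \<le> b" for a b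
      using G[of "-b" "-a"] that by (subst has_integral_reflect_real[symmetric]) (simp add: algebra_simps)
    have "range (\<lambda>x. - G (- x)) = uminus ` range G" by (auto simp: image_iff) (metis minus_minus)
    then show "bounded (range (\<lambda>x. - G (- x)))" using bdd bounded_uminus by metis
  qed
  then show ?thesis by (simp add: filterlim_at_bot_mirror)
qed

lemma integrable_imp_bounded_prim:
  fixes f :: "real \<Rightarrow> real"
  assumes "integrable lebesgue f" "\<And>x. f x \<ge> 0"
  shows "bounded (range (prim f))"
proof -
  have "\<bar>prim f x\<bar> \<le> (LINT x|lebesgue. f x)" for x
    using integral_interval_le_LINT[OF assms, of 0 x] integral_interval_le_LINT[OF assms, of x 0]
      integral_nonneg[OF abs_contD(3)[OF abs_cont_prim[OF integrable_imp_abs_int[OF assms(1)]]], of 0 x]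
      integral_nonneg[OF abs_contD(3)[OF abs_cont_prim[OF integrable_imp_abs_int[OF assms(1)]]], of x 0] assms(2)
    by (auto simp: prim_def abs_if)
  then show ?thesis unfolding bounded_iff by auto
qed

lemma sobolev_hoelder:
  assumes "sobolev v g" "sq_int g \<le> K"
  shows "(norm (v y - v x))\<^sup>2 \<le> \<bar>y - x\<bar> * K"
proof -
  have g: "L2 g" "abs_cont v g" using assms by (auto simp: sobolev_def)
  have *: "(norm (v b - v a))\<^sup>2 \<le> (b - a) * K" if "a \<le> b" for a b
  proof -
    have "(norm (v b - v a))\<^sup>2 \<le> (b - a) * sq_int g"
      using L2_Cauchy_Schwarz[OF g(1) that] abs_contD(4)[OF g(2) that] by simp
    also have "\<dots> \<le> (b - a) * K" using assms(2) that by (intro mult_left_mono) auto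
    finally show ?thesis .
  qed
  show ?thesis using *[of x y] *[of y x] by (cases "x \<le> y") (auto simp: norm_minus_commute)
qed

lemma sobolev_tendsto:
  assumes v: "sobolev v g"
  shows "(v \<longlongrightarrow> 0) at_top" "(v \<longlongrightarrow> 0) at_bot"
proof -
  define K where "K = sq_int g"
  have K: "K \<ge> 0" by (simp add: K_def)
  have uc: "uniformly_continuous_on UNIV v"
    unfolding uniformly_continuous_on_def
  proof (intro allI impI)
    fix \<epsilon> :: real assume \<epsilon>: "\<epsilon> > 0"
    show "\<exists>d>0. \<forall>x\<in>UNIV. \<forall>x'\<in>UNIV. dist x' x < d \<longrightarrow> dist (v x') (v x) < \<epsilon>"
    proof (intro exI conjI ballI impI)
      show "\<epsilon>\<^sup>2 / (K + 1) > 0" using \<epsilon> K by (simp add: add_nonneg_pos)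
      fix x y :: real assume d: "dist y x < \<epsilon>\<^sup>2 / (K + 1)"
      have "(norm (v y - v x))\<^sup>2 \<le> \<bar>y - x\<bar> * K" by (rule sobolev_hoelder[OF v]) (simp add: K_def)
      also have "\<dots> \<le> \<bar>y - x\<bar> * (K + 1)" by (intro mult_left_mono) auto
      also have "\<dots> < \<epsilon>\<^sup>2" using d K by (simp add: dist_real_def pos_less_divide_eq)
      finally show "dist (v y) (v x) < \<epsilon>" using \<epsilon> by (simp add: dist_norm power2_less_imp_less)
    qed
  qed
  have i: "integrable lebesgue (\<lambda>x. (norm (v x))\<^sup>2)" using v by (auto simp: sobolev_def L2_def)
  have G: "((\<lambda>t. (norm (v t))\<^sup>2) has_integral prim (\<lambda>t. (norm (v t))\<^sup>2) b - prim (\<lambda>t. (norm (v t))\<^sup>2) a) {a..b}" if "a \<le> b" for a b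
    using abs_contD(2)[OF abs_cont_prim[OF integrable_imp_abs_int[OF i]] that] .
  have b: "bounded (range (prim (\<lambda>t. (norm (v t))\<^sup>2)))" by (rule integrable_imp_bounded_prim[OF i]) simp
  show "(v \<longlongrightarrow> 0) at_top" by (rule square_integral_tendsto_0_at_top[OF uc G b])
  show "(v \<longlongrightarrow> 0) at_bot" by (rule square_integral_tendsto_0_at_bot[OF uc G b])
qed

lemma LINT_limit_of_intervals:
  fixes f :: "real \<Rightarrow> 'a::euclidean_space"
  assumes "integrable lebesgue f"
  shows "(\<lambda>n. integral {- real n..real n} f) \<longlonglongrightarrow> (LINT x|lebesgue. f x)"
proof -
  have ai: "f absolutely_integrable_on {a..b}" for a b using integrable_imp_abs_int[OF assms] by (simp add: loc_integrable_def)
  have "(\<lambda>n. LINT x|lebesgue. indicator {- real n..real n} x *\<^sub>R f x) \<longlonglongrightarrow> (LINT x|lebesgue. f x)"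
  proof (rule integral_dominated_convergence[where w = "\<lambda>x. norm (f x)"])
    show "AE x in lebesgue. (\<lambda>n. indicator {- real n..real n} x *\<^sub>R f x) \<longlonglongrightarrow> f x"
    proof (intro AE_I2 tendsto_eventually)
      fix x
      obtain N :: nat where "\<bar>x\<bar> \<le> real N" using real_arch_simple by blast
      then show "eventually (\<lambda>n. indicator {- real n..real n} x *\<^sub>R f x = f x) sequentially"
        by (intro eventually_sequentiallyI[of N]) (auto simp: indicator_def)
    qed
    show "(\<lambda>x. indicator {- real n..real n} x *\<^sub>R f x) \<in> borel_measurable lebesgue" for n
      using ai[of "- real n" "real n"] borel_measurable_integrable unfolding set_integrable_def by blast
  qed (use assms in \<open>auto simp: indicator_def\<close>)
  then show ?thesis
    using set_lebesgue_integral_eq_integral(2)[OF ai] by (simp add: set_lebesgue_integral_def)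
qed

text \<open>The integrand is half the derivative of \<open>v \<bullet> v\<close>, which vanishes at both ends.\<close>
lemma sobolev_inner_integral:
  fixes v g :: "real \<Rightarrow> 'a::euclidean_space"
  assumes v: "sobolev v g"
  shows "integrable lebesgue (\<lambda>x. v x \<bullet> g x)" "(LINT x|lebesgue. v x \<bullet> g x) = 0"
proof -
  have vg: "L2 v" "L2 g" "abs_cont v g" using v by (auto simp: sobolev_def)
  show i: "integrable lebesgue (\<lambda>x. v x \<bullet> g x)" by (rule L2_inner[OF vg(1,2)])
  have p: "abs_cont (\<lambda>x. v x \<bullet> v x) (\<lambda>x. g x \<bullet> v x + v x \<bullet> g x)"
    by (rule abs_cont_product[OF bounded_bilinear_inner vg(3) vg(3)])
  have eq: "2 * integral {- real n..real n} (\<lambda>x. v x \<bullet> g x) = v (real n) \<bullet> v (real n) - v (- real n) \<bullet> v (- real n)" for n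
    using abs_contD(4)[OF p, of "- real n" "real n"] by (simp add: inner_commute flip: mult_2)
  have 1: "(\<lambda>n. v (real n)) \<longlonglongrightarrow> 0"
    by (rule filterlim_compose[OF sobolev_tendsto(1)[OF v] filterlim_real_sequentially])
  have 2: "(\<lambda>n. v (- real n)) \<longlonglongrightarrow> 0"
    by (rule filterlim_compose[OF sobolev_tendsto(2)[OF v] filterlim_compose[OF filterlim_uminus_at_bot_at_top filterlim_real_sequentially]])
  have "(\<lambda>n. v (real n) \<bullet> v (real n) - v (- real n) \<bullet> v (- real n)) \<longlonglongrightarrow> (0::'a) \<bullet> 0 - (0::'a) \<bullet> 0"
    by (intro tendsto_diff tendsto_inner 1 2)
  then have "(\<lambda>n. 2 * integral {- real n..real n} (\<lambda>x. v x \<bullet> g x)) \<longlonglongrightarrow> 0" unfolding eq by simp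
  moreover have "(\<lambda>n. 2 * integral {- real n..real n} (\<lambda>x. v x \<bullet> g x)) \<longlonglongrightarrow> 2 * (LINT x|lebesgue. v x \<bullet> g x)"
    by (intro tendsto_intros LINT_limit_of_intervals[OF i])
  ultimately show "(LINT x|lebesgue. v x \<bullet> g x) = 0" using LIMSEQ_unique by fastforce
qed

section \<open>The energy in the exponentially weighted variable\<close>

lemma integrable_translate:
  fixes f :: "real \<Rightarrow> 'a::euclidean_space"
  shows "integrable lebesgue (\<lambda>x. f (x - a)) \<longleftrightarrow> integrable lebesgue f"
    "(LINT x|lebesgue. f (x - a)) = (LINT x|lebesgue. f x)"
  using lebesgue_integrable_real_affine_iff[of 1 f "-a"] lebesgue_integral_real_affine[of 1 f "-a"] by simp_all

lemma lebesgue_measurable_translate: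
  fixes f :: "real \<Rightarrow> 'a::euclidean_space"
  assumes "f \<in> borel_measurable lebesgue"
  shows "(\<lambda>x. f (x - a)) \<in> borel_measurable lebesgue"
proof -
  have "(\<lambda>x. -a + 1 * x) \<in> lebesgue \<rightarrow>\<^sub>M lebesgue"
    using lebesgue_affine_measurable[where c= "\<lambda>x::real. 1" and t = "-a"] by simp
  from measurable_compose[OF this assms] show ?thesis by simp
qed

lemma L2_translate: "L2 f \<Longrightarrow> L2 (\<lambda>x. f (x - a))"
  using integrable_translate(1)[of "\<lambda>x. (norm (f x))\<^sup>2" a] lebesgue_measurable_translate[of f a]
  by (simp add: L2_def)

lemma abs_cont_translate:
  assumes "abs_cont v g" shows "abs_cont (\<lambda>x. v (x - a)) (\<lambda>x. g (x - a))"
  unfolding abs_cont_def loc_integrable_def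
proof (intro conjI allI impI)
  fix x y :: real
  have "integrable lebesgue (\<lambda>t. indicator {x-a..y-a} t *\<^sub>R g t)"
    using abs_contD(1)[OF assms] by (simp add: set_integrable_def)
  then have "integrable lebesgue (\<lambda>t. indicator {x-a..y-a} (t - a) *\<^sub>R g (t - a))"
    using integrable_translate(1)[of "\<lambda>t. indicator {x-a..y-a} t *\<^sub>R g t" a] by simp
  moreover have "(indicator {x-a..y-a} (t - a) :: real) = indicator {x..y} t" for t by (auto simp: indicator_def)
  ultimately show "(\<lambda>x. g (x - a)) absolutely_integrable_on {x..y}" by (simp add: set_integrable_def)
  assume "x \<le> y"
  then have "(g has_integral v (y - a) - v (x - a)) {x - a..y - a}" by (intro abs_contD(2)[OF assms]) simp
  then show "((\<lambda>x. g (x - a)) has_integral v (y - a) - v (x - a)) {x..y}"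
    using has_integral_shift_Icc_real[of g "-a" "v (y - a) - v (x - a)" x y] by (simp add: o_def)
qed

lemma sobolev_translate: "sobolev v g \<Longrightarrow> sobolev (\<lambda>x. r *\<^sub>R v (x - a)) (\<lambda>x. r *\<^sub>R g (x - a))"
  unfolding sobolev_def
  using L2_scaleR[OF L2_translate, of v r a] L2_scaleR[OF L2_translate, of g r a]
    abs_cont_lincomb[OF abs_cont_translate abs_cont_const, of v g r a 0] by simp

lemma exp_abs_cont: "abs_cont (\<lambda>x. exp (k * x)) (\<lambda>x. k * exp (k * x))"
proof (rule abs_cont_C1)
  show "((\<lambda>x. exp (k * x)) has_vector_derivative k * exp (k * x)) (at x)" for x
    unfolding has_real_derivative_iff_has_vector_derivative[symmetric] by (auto intro!: derivative_eq_intros)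
qed (intro continuous_intros)

lemma continuous_L2_loc:
  fixes w :: "real \<Rightarrow> 'a::euclidean_space"
  assumes "continuous_on UNIV w" shows "L2_loc w"
  unfolding L2_loc_def
proof (intro conjI allI)
  show "w \<in> borel_measurable lebesgue" by (rule continuous_lebesgue_measurable[OF assms])
  have "continuous_on UNIV (\<lambda>x. (norm (w x))\<^sup>2)" by (intro continuous_intros assms)
  from loc_integrable_continuous[OF this] show "set_integrable lebesgue {a..b} (\<lambda>x. (norm (w x))\<^sup>2)" for a b
    by (simp add: loc_integrable_def)
qed

lemma L2_loc_mult_continuous:
  fixes g :: "real \<Rightarrow> 'a::euclidean_space"
  assumes "L2_loc g" "continuous_on UNIV (f :: real \<Rightarrow> real)"
  shows "L2_loc (\<lambda>x. f x *\<^sub>R g x)"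
  unfolding L2_loc_def
proof (intro conjI allI)
  show "(\<lambda>x. f x *\<^sub>R g x) \<in> borel_measurable lebesgue"
    using assms(1) by (intro borel_measurable_scaleR continuous_lebesgue_measurable[OF assms(2)]) (simp add: L2_loc_def)
  have "continuous_on UNIV (\<lambda>x. (f x)\<^sup>2)" by (intro continuous_intros assms)
  from abs_integrable_bilinear[OF bounded_bilinear_mult continuous_on_subset[OF this]]
  have "(\<lambda>x. (f x)\<^sup>2 * (norm (g x))\<^sup>2) absolutely_integrable_on {a..b}" for a b
    using assms(1) by (auto simp: L2_loc_def)
  then show "set_integrable lebesgue {a..b} (\<lambda>x. (norm (f x *\<^sub>R g x))\<^sup>2)" for a b
    by (simp add: power_mult_distrib)
qed

lemma H1_locI:
  fixes w :: "real \<Rightarrow> 'a::euclidean_space"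
  assumes "abs_cont w h" "L2_loc h"
  shows "w \<in> H1_loc" "AE x in lebesgue. weak_deriv w x = h x" "weak_deriv w \<in> borel_measurable lebesgue"
proof -
  have w: "L2_loc w" by (rule continuous_L2_loc[OF abs_cont_continuous[OF assms(1)]])
  have ex: "\<exists>g. L2_loc g \<and> has_weak_derivative w g" using assms abs_cont_weak_derivative by blast
  then show "w \<in> H1_loc" using w by (simp add: H1_loc_def)
  have wd: "L2_loc (weak_deriv w)" "has_weak_derivative w (weak_deriv w)"
    using someI_ex[OF ex] unfolding weak_deriv_def by auto
  show "AE x in lebesgue. weak_deriv w x = h x"
    by (rule weak_derivative_unique[OF assms(1) L2_loc_integrable[OF w] _ L2_loc_integrable[OF wd(1)] wd(2)]) simp
  show "weak_deriv w \<in> borel_measurable lebesgue" using wd(1) by (simp add: L2_loc_def)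
qed

lemma H1_loc_abs_cont:
  fixes w :: "real \<Rightarrow> 'a::euclidean_space"
  assumes "w \<in> H1_loc"
  obtains w' where "abs_cont w' (weak_deriv w)" "AE x in lebesgue. w x = w' x" "L2_loc (weak_deriv w)"
proof -
  have w: "L2_loc w" and ex: "\<exists>g. L2_loc g \<and> has_weak_derivative w g" using assms by (auto simp: H1_loc_def)
  have wd: "L2_loc (weak_deriv w)" "has_weak_derivative w (weak_deriv w)"
    using someI_ex[OF ex] unfolding weak_deriv_def by auto
  then show ?thesis
    using weak_derivative_imp_abs_cont[OF L2_loc_integrable[OF w] L2_loc_integrable[OF wd(1)] wd(2)] that by blast
qed

lemma L2_cong_AE:
  fixes f :: "real \<Rightarrow> 'a::euclidean_space"
  assumes "L2 f" "AE x in lebesgue. f x = g x" "g \<in> borel_measurable lebesgue"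
  shows "L2 g"
  unfolding L2_def
proof
  have "integrable lebesgue (\<lambda>x. (norm (f x))\<^sup>2) \<longleftrightarrow> integrable lebesgue (\<lambda>x. (norm (g x))\<^sup>2)"
    using assms(2) by (intro integrable_cong_AE) (use L2D[OF assms(1)] assms(3) in auto)
  then show "integrable lebesgue (\<lambda>x. (norm (g x))\<^sup>2)" using L2D(2)[OF assms(1)] by simp
qed (rule assms)

text \<open>This substitution turns the exponentially weighted space into the unweighted one
  (\<open>profile_in_H1_affine\<close>, \<open>H1_affine_profile\<close>).\<close>

definition profile :: "'a::euclidean_space \<Rightarrow> real \<Rightarrow> (real \<Rightarrow> 'a) \<Rightarrow> real \<Rightarrow> 'a" where
  "profile e c v x = e + exp (- (c / 2) * x) *\<^sub>R v x"

lemma exp_cancel: "exp (c * x / 2) * exp (- (c / 2) * x) = (1::real)" "exp (- (c / 2) * x) * exp (c * x / 2) = (1::real)"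
  "exp (c * x / 2) * exp (- (c * x / 2)) = (1::real)" "exp (- (c * x / 2)) * exp (c * x / 2) = (1::real)"
  by (simp_all flip: exp_add)

lemma profile_abs_cont:
  assumes "abs_cont v g"
  shows "abs_cont (\<lambda>x. profile e c v x) (\<lambda>x. exp (- (c / 2) * x) *\<^sub>R (g x - (c / 2) *\<^sub>R v x))"
proof -
  have "abs_cont (\<lambda>x. exp (- (c / 2) * x) *\<^sub>R v x) (\<lambda>x. (- (c / 2) * exp (- (c / 2) * x)) *\<^sub>R v x + exp (- (c / 2) * x) *\<^sub>R g x)"
    by (rule abs_cont_product[OF bounded_bilinear_scaleR exp_abs_cont assms])
  from abs_cont_lincomb[OF abs_cont_const this, of 1 e 1]
  show ?thesis by (simp add: profile_def[abs_def] scaleR_diff_right mult.commute)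
qed

lemma profile_in_H1_affine:
  fixes v :: "real \<Rightarrow> 'a::euclidean_space"
  assumes "sobolev v g"
  shows "profile e c v \<in> H1_affine c e"
    "AE x in lebesgue. weak_deriv (profile e c v) x = exp (- (c / 2) * x) *\<^sub>R (g x - (c / 2) *\<^sub>R v x)"
proof -
  have v: "L2 v" "L2 g" "abs_cont v g" using assms by (auto simp: sobolev_def)
  define h where "h x = exp (- (c / 2) * x) *\<^sub>R (g x - (c / 2) *\<^sub>R v x)" for x
  have ac: "abs_cont (profile e c v) h" for e using profile_abs_cont[OF v(3), of e c] by (simp add: h_def[abs_def])
  have gv: "L2 (\<lambda>x. g x - (c / 2) *\<^sub>R v x)" by (intro L2_diff L2_scaleR v)
  have h: "L2_loc h" unfolding h_def by (intro L2_loc_mult_continuous L2_imp_L2_loc gv continuous_intros)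
  show "AE x in lebesgue. weak_deriv (profile e c v) x = exp (- (c / 2) * x) *\<^sub>R (g x - (c / 2) *\<^sub>R v x)"
    using H1_locI(2)[OF ac h] by (simp add: h_def)
  have eq: "(\<lambda>x. profile e c v x - e) = profile 0 c v" by (simp add: profile_def fun_eq_iff)
  have "profile 0 c v \<in> H1_weighted c"
    unfolding H1_weighted_def
  proof (intro CollectI conjI)
    show "profile 0 c v \<in> H1_loc" by (rule H1_locI(1)[OF ac h])
    have "exp (c * x / 2) *\<^sub>R profile 0 c v x = v x" for x by (simp add: profile_def exp_cancel)
    then show "L2 (\<lambda>x. exp (c * x / 2) *\<^sub>R profile 0 c v x)" using v(1) by simp
    show "L2 (\<lambda>x. exp (c * x / 2) *\<^sub>R weak_deriv (profile 0 c v) x)"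
    proof (rule L2_cong_AE[OF gv])
      show "AE x in lebesgue. g x - (c / 2) *\<^sub>R v x = exp (c * x / 2) *\<^sub>R weak_deriv (profile 0 c v) x"
        using H1_locI(2)[OF ac[of 0] h] by eventually_elim (simp add: h_def exp_cancel)
      show "(\<lambda>x. exp (c * x / 2) *\<^sub>R weak_deriv (profile 0 c v) x) \<in> borel_measurable lebesgue"
        by (intro borel_measurable_scaleR continuous_lebesgue_measurable continuous_intros H1_locI(3)[OF ac h]) simp
    qed
  qed
  then show "profile e c v \<in> H1_affine c e"
    unfolding H1_affine_def using H1_locI(1)[OF ac h, of e] eq by simp
qed

lemma H1_affine_profile:
  fixes w :: "real \<Rightarrow> 'a::euclidean_space"
  assumes "w \<in> H1_affine c e"
  obtains v g where "sobolev v g" "AE x in lebesgue. w x = profile e c v x"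
    "AE x in lebesgue. weak_deriv w x = exp (- (c / 2) * x) *\<^sub>R (g x - (c / 2) *\<^sub>R v x)"
proof -
  define u where "u x = w x - e" for x
  have w: "w \<in> H1_loc" and u: "u \<in> H1_loc" "L2 (\<lambda>x. exp (c * x / 2) *\<^sub>R u x)" "L2 (\<lambda>x. exp (c * x / 2) *\<^sub>R weak_deriv u x)"
    using assms by (auto simp: H1_affine_def H1_weighted_def u_def[abs_def])
  obtain u' where u': "abs_cont u' (weak_deriv u)" "AE x in lebesgue. u x = u' x" "L2_loc (weak_deriv u)"
    using H1_loc_abs_cont[OF u(1)] by blast
  define v where "v x = exp ((c / 2) * x) *\<^sub>R u' x" for x
  define g where "g x = ((c / 2) * exp ((c / 2) * x)) *\<^sub>R u' x + exp ((c / 2) * x) *\<^sub>R weak_deriv u x" for x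
  have ac: "abs_cont v g"
    unfolding v_def[abs_def] g_def[abs_def] by (rule abs_cont_product[OF bounded_bilinear_scaleR exp_abs_cont u'(1)])
  have v: "L2 v"
  proof (rule L2_cong_AE[OF u(2)])
    show "AE x in lebesgue. exp (c * x / 2) *\<^sub>R u x = v x" using u'(2) by eventually_elim (simp add: v_def)
    show "v \<in> borel_measurable lebesgue" by (rule continuous_lebesgue_measurable[OF abs_cont_continuous[OF ac]])
  qed
  have g_eq: "g x = (c / 2) *\<^sub>R v x + exp (c * x / 2) *\<^sub>R weak_deriv u x" for x by (simp add: g_def v_def)
  have "L2 g" unfolding g_eq[abs_def] by (intro L2_add L2_scaleR v u(3))
  then have "sobolev v g" using v ac by (simp add: sobolev_def)
  moreover have w_eq: "AE x in lebesgue. w x = profile e c v x"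
    using u'(2) by eventually_elim (simp add: profile_def v_def u_def algebra_simps flip: exp_add)
  moreover have "AE x in lebesgue. weak_deriv w x = exp (- (c / 2) * x) *\<^sub>R (g x - (c / 2) *\<^sub>R v x)"
  proof -
    have "L2_loc w" and ex: "\<exists>g. L2_loc g \<and> has_weak_derivative w g" using w by (auto simp: H1_loc_def)
    moreover have "L2_loc (weak_deriv w)" "has_weak_derivative w (weak_deriv w)"
      using someI_ex[OF ex] unfolding weak_deriv_def by auto
    ultimately have "AE x in lebesgue. weak_deriv w x = exp (- (c / 2) * x) *\<^sub>R (g x - (c / 2) *\<^sub>R v x)"
      using weak_derivative_unique[OF profile_abs_cont[OF ac, of e c] L2_loc_integrable w_eq L2_loc_integrable] by blast
    then show ?thesis .
  qed
  ultimately show ?thesis using that by blast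
qed

text \<open>The negative part of \<open>F\<close> is dominated by \<open>b\<close>, so the difference is never of the form infinity
  minus infinity.\<close>
lemma integral_parts_value:
  fixes f F :: "real \<Rightarrow> real"
  assumes AE: "AE x in lebesgue. f x = F x" and F: "F \<in> borel_measurable lebesgue"
    and b: "integrable lebesgue b" "\<And>x. F x \<ge> - b x"
  shows "enn2ereal (\<integral>\<^sup>+ x. ennreal (f x) \<partial>lebesgue) - enn2ereal (\<integral>\<^sup>+ x. ennreal (- f x) \<partial>lebesgue)
     = (if integrable lebesgue F then ereal (LINT x|lebesgue. F x) else \<infinity>)"
proof -
  define P where "P = (\<integral>\<^sup>+ x. ennreal (F x) \<partial>lebesgue)"
  define N where "N = (\<integral>\<^sup>+ x. ennreal (- F x) \<partial>lebesgue)"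
  have eqs: "(\<integral>\<^sup>+ x. ennreal (f x) \<partial>lebesgue) = P" "(\<integral>\<^sup>+ x. ennreal (- f x) \<partial>lebesgue) = N"
    unfolding P_def N_def using AE by (auto intro!: nn_integral_cong_AE)
  have "N \<le> (\<integral>\<^sup>+ x. ennreal (norm (b x)) \<partial>lebesgue)"
    unfolding N_def
  proof (intro nn_integral_mono ennreal_leI)
    fix x show "- F x \<le> norm (b x)" using b(2)[of x] by simp
  qed
  also have "\<dots> < \<infinity>" using b(1) by (simp add: integrable_iff_bounded)
  finally have Nfin: "N \<noteq> \<infinity>" by simp
  have int: "integrable lebesgue F \<longleftrightarrow> P \<noteq> \<infinity>"
    using real_integrable_def[of lebesgue F] F Nfin by (simp add: P_def N_def)
  show ?thesis
  proof (cases "P = \<infinity>")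
    case True
    obtain r where "enn2ereal N = ereal r" using Nfin by (cases N) (auto simp: enn2ereal_ennreal)
    then show ?thesis unfolding eqs using int True by simp
  next
    case False
    have "(LINT x|lebesgue. F x) = enn2real P - enn2real N"
      using real_lebesgue_integral_def[of lebesgue F] int False by (simp add: P_def N_def)
    moreover have "enn2ereal P = ereal (enn2real P)" "enn2ereal N = ereal (enn2real N)"
      using False Nfin by (cases P; cases N; auto simp: enn2ereal_ennreal)+
    ultimately show ?thesis unfolding eqs using int False by simp
  qed
qed

lemma exp_left_integral:
  assumes "(k::real) > 0"
  shows "integrable lebesgue (\<lambda>x::real. indicator {..0} x * exp (k * x))"
    "(LINT x::real|lebesgue. indicator {..0} x * exp (k * x)) = 1 / k"
proof -
  have hi: "((\<lambda>x. exp (- k * x)) has_integral 1 / k) {0..}"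
    using has_integral_exp_minus_to_infinity[OF assms, of 0] by simp
  then have ai: "(\<lambda>x. exp (- k * x)) absolutely_integrable_on {0..}"
    by (intro nonnegative_absolutely_integrable_1) (auto simp: has_integral_integrable)
  have eq: "indicator {..0} (0 + -1 * x) * exp (k * (0 + -1 * x)) = indicator {0..} x *\<^sub>R exp (- k * x)" for x :: real
    by (auto simp: indicator_def)
  show "integrable lebesgue (\<lambda>x. indicator {..0} x * exp (k * x))"
    using lebesgue_integrable_real_affine_iff[of "-1" "\<lambda>x::real. indicator {..0} x * exp (k * x) :: real" 0] ai
    unfolding eq set_integrable_def by simp
  have "(LINT x|lebesgue. indicator {..0} x * exp (k * x)) = (LINT x|lebesgue. indicator {0..} x *\<^sub>R exp (- k * x))"
    using lebesgue_integral_real_affine[of "-1" "\<lambda>x::real. indicator {..0} x * exp (k * x) :: real" 0] unfolding eq by simp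
  also have "\<dots> = 1 / k"
    using set_lebesgue_integral_eq_integral(2)[OF ai] integral_unique[OF hi] by (simp add: set_lebesgue_integral_def)
  finally show "(LINT x|lebesgue. indicator {..0} x * exp (k * x)) = 1 / k" .
qed

lemma exp_right_integrable:
  assumes "(k::real) > 0" shows "integrable lebesgue (\<lambda>x::real. indicator {0..} x * exp (- k * x))"
proof -
  have "integrable lebesgue (\<lambda>x. indicator {..0} (0 + -1 * x) * exp (k * (0 + -1 * x)))"
    using lebesgue_integrable_real_affine_iff[of "-1" "\<lambda>x::real. indicator {..0} x * exp (k * x) :: real" 0] exp_left_integral(1)[OF assms] by simp
  moreover have "(\<lambda>x::real. indicator {..0} (0 + -1 * x) * exp (k * (0 + -1 * x))) = (\<lambda>x. indicator {0..} x * exp (- k * x) :: real)"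
    by (auto simp: indicator_def)
  ultimately show ?thesis by simp
qed

lemma abs_cont_piecewise:
  fixes f :: "real \<Rightarrow> 'a::euclidean_space"
  assumes f: "continuous_on UNIV f" and S: "finite S" and d: "\<And>x. x \<notin> S \<Longrightarrow> (f has_vector_derivative f' x) (at x)"
    and m: "f' \<in> borel_measurable lebesgue" and b: "\<And>a b. \<exists>B. \<forall>x\<in>{a..b}. norm (f' x) \<le> B"
  shows "abs_cont f f'"
  unfolding abs_cont_def loc_integrable_def
proof (intro conjI allI impI)
  fix a b :: real
  obtain B where B: "\<And>x. x \<in> {a..b} \<Longrightarrow> norm (f' x) \<le> B" using b by blast
  have "set_integrable lebesgue {a..b} (\<lambda>x. \<bar>B\<bar>)" by (rule absolutely_integrable_continuous_real) auto
  then show "f' absolutely_integrable_on {a..b}"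
    unfolding set_integrable_def
  proof (rule Bochner_Integration.integrable_bound)
    show "(\<lambda>x. indicat_real {a..b} x *\<^sub>R f' x) \<in> borel_measurable lebesgue"
      using m by (intro borel_measurable_scaleR borel_measurable_indicator) auto
    show "AE x in lebesgue. norm (indicat_real {a..b} x *\<^sub>R f' x) \<le> norm (indicat_real {a..b} x *\<^sub>R \<bar>B\<bar>)"
      using B by (intro AE_I2) (auto simp: indicator_def intro: order_trans[OF _ abs_ge_self])
  qed
  show "(f' has_integral f b - f a) {a..b}" if "a \<le> b"
    by (rule fundamental_theorem_of_calculus_interior_strong[OF S that]) (use d continuous_on_subset[OF f] in auto)
qed

context invaded_potential
begin

text \<open>The energy density of \<open>profile e c v\<close> in terms of \<open>v\<close> and \<open>g = v'\<close>, the factor \<open>exp (c x)\<close> having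
  been absorbed into the kinetic term. In \<open>pot\<close> the part \<open>c\<^sup>2 / 8 \<bar>v\<bar>\<^sup>2\<close> of the expanded square is
  moved to the potential.\<close>
definition dens :: "real \<Rightarrow> (real \<Rightarrow> real ^ 'n) \<Rightarrow> (real \<Rightarrow> real ^ 'n) \<Rightarrow> real \<Rightarrow> real" where
  "dens c v g x = (norm (g x - (c / 2) *\<^sub>R v x))\<^sup>2 / 2 + exp (c * x) * V (profile e c v x)"

definition pot :: "real \<Rightarrow> (real \<Rightarrow> real ^ 'n) \<Rightarrow> real \<Rightarrow> real" where
  "pot c v x = exp (c * x) * V (profile e c v x) + c\<^sup>2 / 8 * (norm (v x))\<^sup>2"

lemma weight_cancel: "exp (c * x) * (norm (profile e c v x - e))\<^sup>2 = (norm (v x))\<^sup>2"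
proof -
  have "exp (c * x) * (exp (- (c / 2) * x))\<^sup>2 = 1" by (simp add: power2_eq_square flip: exp_add)
  then show ?thesis by (simp add: profile_def power_mult_distrib mult.assoc[symmetric])
qed

lemma V_measurable: "w \<in> borel_measurable lebesgue \<Longrightarrow> (\<lambda>x. V (w x)) \<in> borel_measurable lebesgue"
  using measurable_compose[of w lebesgue borel V borel] borel_measurable_continuous_onI[OF V_continuous] by blast

lemma profile_measurable:
  assumes "v \<in> borel_measurable lebesgue" shows "profile a c v \<in> borel_measurable lebesgue"
  unfolding profile_def[abs_def]
  by (intro borel_measurable_add borel_measurable_scaleR continuous_lebesgue_measurable[of "\<lambda>x. exp (- (c / 2) * x)"]
     continuous_intros assms) simp_all

lemma weight_measurable: "(\<lambda>x::real. exp (k * x) :: real) \<in> borel_measurable lebesgue"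
  by (intro continuous_lebesgue_measurable continuous_intros)

lemma pot_measurable:
  assumes "v \<in> borel_measurable lebesgue" shows "pot c v \<in> borel_measurable lebesgue"
  unfolding pot_def[abs_def] using assms
  by (intro borel_measurable_add borel_measurable_times weight_measurable V_measurable profile_measurable) auto

lemma dens_measurable:
  assumes "v \<in> borel_measurable lebesgue" "g \<in> borel_measurable lebesgue" shows "dens c v g \<in> borel_measurable lebesgue"
  unfolding dens_def[abs_def] using assms
  by (intro borel_measurable_add borel_measurable_times weight_measurable V_measurable profile_measurable) auto

lemma dens_pot: "dens c v g x = (norm (g x))\<^sup>2 / 2 + pot c v x - (c / 2) * (v x \<bullet> g x)"
proof -
  have "(norm (g x - (c / 2) *\<^sub>R v x))\<^sup>2 = (norm (g x))\<^sup>2 - c * (v x \<bullet> g x) + c\<^sup>2 / 4 * (norm (v x))\<^sup>2"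
    unfolding power2_norm_eq_inner
    by (simp add: inner_diff_left inner_diff_right inner_commute power2_eq_square field_simps)
  then show ?thesis by (simp add: dens_def pot_def field_simps)
qed

text \<open>The cross term \<open>(c / 2) (v \<bullet> g)\<close> of the expanded square integrates to 0.\<close>
lemma dens_integral:
  assumes v: "sobolev v g"
  shows "integrable lebesgue (dens c v g) \<longleftrightarrow> integrable lebesgue (pot c v)"
    "integrable lebesgue (pot c v) \<Longrightarrow>
       (LINT x|lebesgue. dens c v g x) = sq_int g / 2 + (LINT x|lebesgue. pot c v x)"
proof -
  have i: "integrable lebesgue (\<lambda>x. (norm (g x))\<^sup>2 / 2)" using v by (auto simp: sobolev_def L2_def)
  have j: "integrable lebesgue (\<lambda>x. (c / 2) * (v x \<bullet> g x))" using sobolev_inner_integral(1)[OF v] by simp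
  have eq: "dens c v g = (\<lambda>x. ((norm (g x))\<^sup>2 / 2 + pot c v x) - (c / 2) * (v x \<bullet> g x))" by (simp add: dens_pot fun_eq_iff)
  have eq': "pot c v = (\<lambda>x. (dens c v g x - (norm (g x))\<^sup>2 / 2) + (c / 2) * (v x \<bullet> g x))" by (simp add: dens_pot fun_eq_iff)
  show "integrable lebesgue (dens c v g) \<longleftrightarrow> integrable lebesgue (pot c v)"
  proof
    assume "integrable lebesgue (dens c v g)"
    then show "integrable lebesgue (pot c v)"
      by (subst eq') (intro Bochner_Integration.integrable_add Bochner_Integration.integrable_diff i j)
  next
    assume "integrable lebesgue (pot c v)"
    then show "integrable lebesgue (dens c v g)"
      by (subst eq) (intro Bochner_Integration.integrable_add Bochner_Integration.integrable_diff i j)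
  qed
  assume p: "integrable lebesgue (pot c v)"
  have "(LINT x|lebesgue. dens c v g x) = (LINT x|lebesgue. (norm (g x))\<^sup>2 / 2) + (LINT x|lebesgue. pot c v x) - (LINT x|lebesgue. (c / 2) * (v x \<bullet> g x))"
    unfolding eq by (simp only: Bochner_Integration.integral_diff[OF Bochner_Integration.integrable_add[OF i p] j] Bochner_Integration.integral_add[OF i p])
  then show "(LINT x|lebesgue. dens c v g x) = sq_int g / 2 + (LINT x|lebesgue. pot c v x)"
    using sobolev_inner_integral(2)[OF v] by simp
qed

lemma dens_lower:
  "\<exists>K>0. (\<forall>c v g x. dens c v g x \<ge> - (K * (norm (v x))\<^sup>2)) \<and>
    (\<forall>c v x. pot c v x \<ge> (c\<^sup>2 / 8 - K) * (norm (v x))\<^sup>2)"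
proof -
  obtain K where K: "K > 0" "\<And>u. V u \<ge> - K * (norm (u - e))\<^sup>2" using V_lower_quadratic by blast
  have *: "exp (c * x) * V (profile e c v x) \<ge> - (K * (norm (v x))\<^sup>2)" for c v x
  proof -
    have low: "exp (c * x) * V (profile e c v x) \<ge> exp (c * x) * (- K * (norm (profile e c v x - e))\<^sup>2)"
      by (intro mult_left_mono K(2)) simp
    have eq: "exp (c * x) * (- K * (norm (profile e c v x - e))\<^sup>2) = - (K * (norm (v x))\<^sup>2)"
      unfolding weight_cancel[of c x v, symmetric] by simp
    show ?thesis using low unfolding eq .
  qed
  have "dens c v g x \<ge> - (K * (norm (v x))\<^sup>2)" for c v g x
    using *[of v x c] zero_le_power2[of "norm (g x - (c / 2) *\<^sub>R v x)"] unfolding dens_def by argo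
  moreover have "pot c v x \<ge> (c\<^sup>2 / 8 - K) * (norm (v x))\<^sup>2" for c v x
    using *[of v x c] unfolding pot_def by (simp add: algebra_simps)
  ultimately show ?thesis using K(1) by blast
qed

lemma energy_eq_dens:
  assumes v: "sobolev v g"
    and w: "AE x in lebesgue. w x = profile e c v x"
      "AE x in lebesgue. weak_deriv w x = exp (- (c / 2) * x) *\<^sub>R (g x - (c / 2) *\<^sub>R v x)"
  shows "energy V c w = (if integrable lebesgue (dens c v g) then ereal (LINT x|lebesgue. dens c v g x) else \<infinity>)"
proof -
  obtain K where K: "K > 0" "\<forall>c v g x. dens c v g x \<ge> - (K * (norm (v x))\<^sup>2)"
    using dens_lower by blast
  have i: "integrable lebesgue (\<lambda>x. K * (norm (v x))\<^sup>2)" using v by (simp add: sobolev_def L2_def)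
  have m: "dens c v g \<in> borel_measurable lebesgue" using v by (intro dens_measurable) (auto simp: sobolev_def L2_def)
  have AE: "AE x in lebesgue. energy_density V c w x = dens c v g x"
    using w
  proof eventually_elim
    case (elim x)
    have "exp (c * x) * (exp (- (c / 2) * x))\<^sup>2 = 1" by (simp add: power2_eq_square flip: exp_add)
    then have "exp (c * x) * ((norm (exp (- (c / 2) * x) *\<^sub>R (g x - (c / 2) *\<^sub>R v x)))\<^sup>2 / 2) = (norm (g x - (c / 2) *\<^sub>R v x))\<^sup>2 / 2"
      by (simp add: power_mult_distrib mult.assoc[symmetric])
    then show ?case unfolding energy_density_def dens_def elim by (simp only: distrib_left)
  qed
  show ?thesis unfolding energy_def by (rule integral_parts_value[OF AE m i K(2)[rule_format]])
qed

definition negative_energy :: "real \<Rightarrow> (real \<Rightarrow> real ^ 'n) \<Rightarrow> (real \<Rightarrow> real ^ 'n) \<Rightarrow> bool" where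
  "negative_energy c v g \<longleftrightarrow> sobolev v g \<and> integrable lebesgue (dens c v g) \<and> (LINT x|lebesgue. dens c v g x) < 0"

lemma profile_translate:
  "profile e c (\<lambda>x. exp (c * a / 2) *\<^sub>R v (x - a)) x = profile e c v (x - a)"
proof -
  have "exp (- (c / 2) * x) * exp (c * a / 2) = exp (- (c / 2) * (x - a))"
    by (simp add: field_simps flip: exp_add)
  then show ?thesis unfolding profile_def by (simp only: scaleR_scaleR)
qed

lemma dens_translate:
  "dens c (\<lambda>x. exp (c * a / 2) *\<^sub>R v (x - a)) (\<lambda>x. exp (c * a / 2) *\<^sub>R g (x - a)) x = exp (c * a) * dens c v g (x - a)"
proof -
  have 1: "(exp (c * a / 2))\<^sup>2 = exp (c * a)" by (simp add: power2_eq_square flip: exp_add)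
  have 2: "exp (c * x) = exp (c * a) * exp (c * (x - a))" by (simp add: algebra_simps flip: exp_add)
  have 3: "exp (c * a / 2) *\<^sub>R g (x - a) - (c / 2) *\<^sub>R exp (c * a / 2) *\<^sub>R v (x - a) = exp (c * a / 2) *\<^sub>R (g (x - a) - (c / 2) *\<^sub>R v (x - a))"
    by (simp add: scaleR_diff_right mult.commute)
  show ?thesis unfolding dens_def profile_translate 3 2 norm_scaleR power_mult_distrib power2_abs 1 by (simp add: algebra_simps)
qed

lemma dens_translate_integral:
  assumes "integrable lebesgue (dens c v g)"
  shows "integrable lebesgue (dens c (\<lambda>x. exp (c * a / 2) *\<^sub>R v (x - a)) (\<lambda>x. exp (c * a / 2) *\<^sub>R g (x - a)))"
    "(LINT x|lebesgue. dens c (\<lambda>x. exp (c * a / 2) *\<^sub>R v (x - a)) (\<lambda>x. exp (c * a / 2) *\<^sub>R g (x - a)) x)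
      = exp (c * a) * (LINT x|lebesgue. dens c v g x)"
proof -
  have eq: "dens c (\<lambda>x. exp (c * a / 2) *\<^sub>R v (x - a)) (\<lambda>x. exp (c * a / 2) *\<^sub>R g (x - a)) = (\<lambda>x. exp (c * a) * dens c v g (x - a))"
    by (rule ext) (rule dens_translate)
  show "integrable lebesgue (dens c (\<lambda>x. exp (c * a / 2) *\<^sub>R v (x - a)) (\<lambda>x. exp (c * a / 2) *\<^sub>R g (x - a)))"
    unfolding eq using integrable_translate(1)[of "dens c v g" a] assms by simp
  show "(LINT x|lebesgue. dens c (\<lambda>x. exp (c * a / 2) *\<^sub>R v (x - a)) (\<lambda>x. exp (c * a / 2) *\<^sub>R g (x - a)) x)
      = exp (c * a) * (LINT x|lebesgue. dens c v g x)"
    unfolding eq using integrable_translate(2)[of "dens c v g" a] by simp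
qed

text \<open>Translating by \<open>a\<close> multiplies the energy by \<open>exp (c a)\<close>, so a single negative value makes the infimum
  \<open>-\<infinity>\<close>.\<close>
lemma C_minus_infinity_iff:
  "c \<in> C_minus_infinity V e \<longleftrightarrow> c > 0 \<and> (\<exists>v g. negative_energy c v g)"
proof
  assume "c \<in> C_minus_infinity V e"
  then have c: "c > 0" "(INF w\<in>H1_affine c e. energy V c w) < 0" by (auto simp: C_minus_infinity_def)
  then obtain w where w: "w \<in> H1_affine c e" "energy V c w < 0" by (auto simp: INF_less_iff)
  obtain v g where v: "sobolev v g" "AE x in lebesgue. w x = profile e c v x"
    "AE x in lebesgue. weak_deriv w x = exp (- (c / 2) * x) *\<^sub>R (g x - (c / 2) *\<^sub>R v x)"
    using H1_affine_profile[OF w(1)] by blast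
  have "negative_energy c v g"
    using energy_eq_dens[OF v] w(2) v(1) by (auto simp: negative_energy_def zero_ereal_def split: if_splits)
  then show "c > 0 \<and> (\<exists>v g. negative_energy c v g)" using c by blast
next
  assume "c > 0 \<and> (\<exists>v g. negative_energy c v g)"
  then obtain v g where c: "c > 0" and v: "sobolev v g" "integrable lebesgue (dens c v g)" "(LINT x|lebesgue. dens c v g x) < 0"
    by (auto simp: negative_energy_def)
  define E where "E = (LINT x|lebesgue. dens c v g x)"
  have "(INF w\<in>H1_affine c e. energy V c w) \<le> ereal B" for B
  proof -
    define a where "a = ln (max 1 (B / E)) / c"
    have E: "E < 0" using v(3) by (simp add: E_def)
    have "exp (c * a) = max 1 (B / E)" using c by (simp add: a_def)
    then have "B / E \<le> exp (c * a)" by simp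
    then have le: "exp (c * a) * E \<le> B" using E by (simp add: neg_divide_le_eq)
    define v' where "v' x = exp (c * a / 2) *\<^sub>R v (x - a)" for x
    define g' where "g' x = exp (c * a / 2) *\<^sub>R g (x - a)" for x
    have s: "sobolev v' g'" unfolding v'_def g'_def by (rule sobolev_translate[OF v(1)])
    have "energy V c (profile e c v') = ereal (exp (c * a) * E)"
      using energy_eq_dens[OF s _ profile_in_H1_affine(2)[OF s], of e c] dens_translate_integral[OF v(2), of a]
      unfolding E_def v'_def[abs_def] g'_def[abs_def] by simp
    then have "energy V c (profile e c v') \<le> ereal B" using le by simp
    then show ?thesis using INF_lower2[OF profile_in_H1_affine(1)[OF s, of e c]] by blast
  qed
  then have "(INF w\<in>H1_affine c e. energy V c w) = - \<infinity>" by (rule ereal_bot)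
  then show "c \<in> C_minus_infinity V e" using c by (simp add: C_minus_infinity_def)
qed

text \<open>For \<open>c\<^sup>2 / 8\<close> larger than the constant in the quadratic lower bound of \<open>V\<close>, \<open>pot\<close> is nonnegative.\<close>
lemma C_minus_infinity_bdd_above: "bdd_above (C_minus_infinity V e)"
proof -
  obtain K where K: "K > 0" "\<forall>c v x. pot c v x \<ge> (c\<^sup>2 / 8 - K) * (norm (v x))\<^sup>2"
    using dens_lower by blast
  have "c \<le> 8 * K + 1" if cC: "c \<in> C_minus_infinity V e" for c
  proof (rule ccontr)
    assume nc: "\<not> c \<le> 8 * K + 1"
    have "c\<^sup>2 \<ge> c" using nc K(1) by (simp add: power2_eq_square)
    then have c: "c\<^sup>2 / 8 - K \<ge> 0" using nc by simp
    obtain v g where v: "sobolev v g" "integrable lebesgue (dens c v g)" "(LINT x|lebesgue. dens c v g x) < 0"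
      using cC unfolding C_minus_infinity_iff negative_energy_def by blast
    have "pot c v x \<ge> 0" for x using K(2)[rule_format, of c v x] c by (meson mult_nonneg_nonneg order_trans zero_le_power2)
    then have "(LINT x|lebesgue. pot c v x) \<ge> 0" by simp
    then have "sq_int g / 2 + (LINT x|lebesgue. pot c v x) \<ge> 0"
      by (intro add_nonneg_nonneg divide_nonneg_nonneg) auto
    then show False using dens_integral[OF v(1), of c] v(2,3) by simp
  qed
  then show ?thesis by (intro bdd_aboveI) auto
qed

lemma sobolev_bounded_right:
  assumes "sobolev v g"
  obtains M where "\<And>x::real. x \<ge> 0 \<Longrightarrow> norm (v x) \<le> (M::real)"
proof -
  have "eventually (\<lambda>x. norm (v x) < 1) at_top"
    using tendstoD[OF sobolev_tendsto(1)[OF assms], of 1] by simp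
  then obtain X where X: "\<And>x. x \<ge> X \<Longrightarrow> norm (v x) < 1" unfolding eventually_at_top_linorder by blast
  have "continuous_on {0..X} v" using assms abs_cont_continuous by (auto simp: sobolev_def)
  then have "bounded (v ` {0..X})" by (intro compact_imp_bounded compact_continuous_image) auto
  then obtain B where B: "\<And>x. x \<in> {0..X} \<Longrightarrow> norm (v x) \<le> B" unfolding bounded_iff by blast
  have "norm (v x) \<le> max 1 B" if "x \<ge> 0" for x
    using B[of x] X[of x] that by (cases "x \<le> X") auto
  then show ?thesis using that by blast
qed

text \<open>For speeds \<open>c' > c\<close> near \<open>c\<close>, use the same \<open>v\<close> on the right half-line and the same profile on the
  left one. On the left the density is then \<open>exp ((c' - c) x)\<close> times the old one. On the right \<open>v\<close> is
  bounded, which dominates the potential quadratically. (The same \<open>v\<close> on the left would give larger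
  profiles, beyond any control of \<open>V\<close>; the same profile on the right might leave the weighted space.)\<close>
lemma negative_energy_faster:
  assumes ne: "negative_energy c v g" and c: "c > 0"
  obtains c' v' g' where "c' > c" "negative_energy c' v' g'"
proof -
  have v: "sobolev v g" and int: "integrable lebesgue (dens c v g)" and neg: "(LINT x|lebesgue. dens c v g x) < 0"
    using ne by (auto simp: negative_energy_def)
  have L: "L2 v" "L2 g" "abs_cont v g" using v by (auto simp: sobolev_def)
  obtain M where M: "\<And>x. x \<ge> 0 \<Longrightarrow> norm (v x) \<le> M" by (rule sobolev_bounded_right[OF v]) blast
  obtain K where K: "K > 0" "\<And>u. u \<in> cball e M \<Longrightarrow> \<bar>V u\<bar> \<le> K * (norm (u - e))\<^sup>2"
    by (rule V_quadratic_bound[of M]) blast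
  \<comment> \<open>the speeds are \<open>c + k n\<close>, with competitors \<open>w n\<close> and their derivatives \<open>h n\<close>\<close>
  define k where "k n = 1 / real (Suc n)" for n
  have k: "k n > 0" "k n \<le> 1" for n by (auto simp: k_def)
  have k0: "k \<longlonglongrightarrow> 0" unfolding k_def by (rule LIMSEQ_Suc[OF lim_1_over_n])
  define s where "s n x = exp (k n / 2 * min x 0)" for n and x :: real
  define s' where "s' n x = indicator {..<0} x * (k n / 2 * exp (k n / 2 * x))" for n and x :: real
  define w where "w n x = s n x *\<^sub>R v x" for n x
  define h where "h n x = s' n x *\<^sub>R v x + s n x *\<^sub>R g x" for n x
  have s_cont: "continuous_on UNIV (s n)" for n unfolding s_def by (intro continuous_intros)
  have s'_m: "s' n \<in> borel_measurable lebesgue" for n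
    unfolding s'_def by (intro borel_measurable_times continuous_lebesgue_measurable[of "\<lambda>x. k n / 2 * exp (k n / 2 * x)"] continuous_intros borel_measurable_indicator) auto
  have s_bd: "0 \<le> s n x" "s n x \<le> 1" for n x
    using k(1)[of n] by (auto simp: s_def mult_nonneg_nonpos)
  have s'_bd: "0 \<le> s' n x" "s' n x \<le> 1" for n x
  proof -
    have "k n / 2 * exp (k n / 2 * x) \<le> 1 * 1" if "x < 0"
      using k[of n] that by (intro mult_mono) (auto simp: mult_nonneg_nonpos)
    then show "0 \<le> s' n x" "s' n x \<le> 1" using k(1)[of n] by (auto simp: s'_def indicator_def)
  qed
  have s_ac: "abs_cont (s n) (s' n)" for n
  proof (rule abs_cont_piecewise[where S = "{0}"])
    show "(s n has_vector_derivative s' n x) (at x)" if "x \<notin> {0}" for x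
    proof (cases "x < 0")
      case True
      have "((\<lambda>x. exp (k n / 2 * x)) has_real_derivative k n / 2 * exp (k n / 2 * x)) (at x)"
        by (auto intro!: derivative_eq_intros)
      then have "(s n has_real_derivative k n / 2 * exp (k n / 2 * x)) (at x)"
        by (rule has_field_derivative_transform_within_open[of _ _ _ "{..<0}"]) (use True in \<open>auto simp: s_def\<close>)
      then show ?thesis using True by (simp add: s'_def has_real_derivative_iff_has_vector_derivative)
    next
      case False
      then have x: "x > 0" using that by simp
      have "((\<lambda>x. 1::real) has_real_derivative 0) (at x)" by simp
      then have "(s n has_real_derivative 0) (at x)"
        by (rule has_field_derivative_transform_within_open[of _ _ _ "{0<..}"]) (use x in \<open>auto simp: s_def\<close>)
      then show ?thesis using x by (simp add: s'_def has_real_derivative_iff_has_vector_derivative)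
    qed
    show "\<exists>B. \<forall>x\<in>{a..b}. norm (s' n x) \<le> B" for a b using s'_bd by (intro exI[of _ 1] ballI) (simp add: abs_of_nonneg)
  qed (use s_cont s'_m in auto)
  have w_ac: "abs_cont (w n) (h n)" for n
    unfolding w_def h_def by (rule abs_cont_product[OF bounded_bilinear_scaleR s_ac L(3)])
  have w_m: "w n \<in> borel_measurable lebesgue" for n by (rule continuous_lebesgue_measurable[OF abs_cont_continuous[OF w_ac]])
  have h_m: "h n \<in> borel_measurable lebesgue" for n
    unfolding h_def[abs_def] by (intro borel_measurable_add borel_measurable_scaleR s'_m continuous_lebesgue_measurable[OF s_cont] L2D(1) L)
  have w_sob: "sobolev (w n) (h n)" for n
    unfolding sobolev_def
  proof (intro conjI w_ac)
    show "L2 (w n)"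
    proof (rule L2_bounded_by[OF w_m L2D(2)[OF L(1)]])
      show "(norm (w n x))\<^sup>2 \<le> (norm (v x))\<^sup>2" for x
        using s_bd[of n x] by (intro power_mono) (auto simp: w_def mult_left_le_one_le)
    qed
    show "L2 (h n)"
    proof (rule L2_bounded_by[OF h_m])
      show "integrable lebesgue (\<lambda>x. 2 * (norm (v x))\<^sup>2 + 2 * (norm (g x))\<^sup>2)" using L2D(2)[OF L(1)] L2D(2)[OF L(2)] by simp
      fix x
      have "(norm (s' n x *\<^sub>R v x))\<^sup>2 \<le> (norm (v x))\<^sup>2" "(norm (s n x *\<^sub>R g x))\<^sup>2 \<le> (norm (g x))\<^sup>2"
        using s_bd[of n x] s'_bd[of n x] by (auto intro!: power_mono simp: mult_left_le_one_le)
      then show "(norm (h n x))\<^sup>2 \<le> 2 * (norm (v x))\<^sup>2 + 2 * (norm (g x))\<^sup>2"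
        using norm_add_sq_le[of "s' n x *\<^sub>R v x" "s n x *\<^sub>R g x"] unfolding h_def by argo
    qed
  qed
  define D where "D n = dens (c + k n) (w n) (h n)" for n
  have D_neg: "D n x = exp (k n * x) * dens c v g x" if x: "x < 0" for n x
  proof -
    have s_eq: "s n x = exp (k n / 2 * x)" "s' n x = k n / 2 * exp (k n / 2 * x)" using x by (auto simp: s_def s'_def)
    have "exp (- ((c + k n) / 2) * x) * exp (k n / 2 * x) = exp (- (c / 2) * x)" by (simp add: field_simps flip: exp_add)
    then have pr: "profile e (c + k n) (w n) x = profile e c v x" unfolding profile_def w_def s_eq by (simp only: scaleR_scaleR)
    have "h n x - ((c + k n) / 2) *\<^sub>R w n x = exp (k n / 2 * x) *\<^sub>R (g x - (c / 2) *\<^sub>R v x)"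
      unfolding h_def w_def s_eq by (simp add: scaleR_diff_right add_divide_distrib algebra_simps)
    moreover have "(exp (k n / 2 * x))\<^sup>2 = exp (k n * x)" by (simp add: power2_eq_square flip: exp_add)
    ultimately have "(norm (h n x - ((c + k n) / 2) *\<^sub>R w n x))\<^sup>2 = exp (k n * x) * (norm (g x - (c / 2) *\<^sub>R v x))\<^sup>2"
      by (simp add: power_mult_distrib)
    moreover have "exp ((c + k n) * x) = exp (k n * x) * exp (c * x)" by (simp add: algebra_simps flip: exp_add)
    ultimately show ?thesis unfolding D_def dens_def pr by (simp add: algebra_simps)
  qed
  have D_pos: "D n x = dens (c + k n) v g x" if x: "x \<ge> 0" for n x
  proof -
    have "s n x = 1" "s' n x = 0" using x by (auto simp: s_def s'_def)
    then show ?thesis by (simp add: D_def dens_def profile_def w_def h_def)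
  qed
  define b where "b x = \<bar>dens c v g x\<bar> + (norm (g x))\<^sup>2 + (norm (v x))\<^sup>2 * (c + 1)\<^sup>2 + K * (norm (v x))\<^sup>2" for x
  have b_int: "integrable lebesgue b"
    unfolding b_def using int L2D(2)[OF L(1)] L2D(2)[OF L(2)] by simp
  have D_bd: "\<bar>D n x\<bar> \<le> b x" for n x
  proof (cases "x < 0")
    case True
    then have "exp (k n * x) \<le> 1" using k(1)[of n] by (simp add: mult_nonneg_nonpos)
    then have "\<bar>D n x\<bar> \<le> 1 * \<bar>dens c v g x\<bar>" unfolding D_neg[OF True] abs_mult by (intro mult_right_mono) auto
    also have "\<dots> \<le> b x" using K(1) by (simp add: b_def)
    finally show ?thesis .
  next
    case False
    define c' where "c' = c + k n"
    have c': "0 \<le> c'" "c' \<le> c + 1" using k[of n] c by (auto simp: c'_def)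
    have x: "x \<ge> 0" using False by simp
    have "c' / 2 * norm (v x) \<le> (c + 1) * norm (v x)" using c' by (intro mult_right_mono) auto
    then have "(norm ((c' / 2) *\<^sub>R v x))\<^sup>2 \<le> ((c + 1) * norm (v x))\<^sup>2" using c' by (intro power_mono) auto
    then have q: "(norm (g x - (c' / 2) *\<^sub>R v x))\<^sup>2 \<le> 2 * (norm (g x))\<^sup>2 + 2 * ((norm (v x))\<^sup>2 * (c + 1)\<^sup>2)"
      using norm_add_sq_le[of "g x" "- ((c' / 2) *\<^sub>R v x)"] by (simp add: power_mult_distrib mult.commute)
    have "exp (- (c' / 2) * x) \<le> 1" using c' x by simp
    then have "norm (exp (- (c' / 2) * x) *\<^sub>R v x) \<le> 1 * M"
      unfolding norm_scaleR using M[OF x] by (intro mult_mono) auto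
    then have "profile e c' v x \<in> cball e M" by (simp add: profile_def dist_norm)
    then have "exp (c' * x) * \<bar>V (profile e c' v x)\<bar> \<le> exp (c' * x) * (K * (norm (profile e c' v x - e))\<^sup>2)"
      using K(2) by (intro mult_left_mono) auto
    also have "\<dots> = K * (norm (v x))\<^sup>2" unfolding weight_cancel[of c' x v, symmetric] by simp
    finally have p: "\<bar>exp (c' * x) * V (profile e c' v x)\<bar> \<le> K * (norm (v x))\<^sup>2" by (simp add: abs_mult)
    have "\<bar>D n x\<bar> \<le> (norm (g x - (c' / 2) *\<^sub>R v x))\<^sup>2 / 2 + \<bar>exp (c' * x) * V (profile e c' v x)\<bar>"
      unfolding D_pos[OF x] dens_def c'_def[symmetric]
      by (rule order_trans[OF abs_triangle_ineq]) simp
    also have "\<dots> \<le> ((norm (g x))\<^sup>2 + (norm (v x))\<^sup>2 * (c + 1)\<^sup>2) + K * (norm (v x))\<^sup>2"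
      using q p by (intro add_mono) auto
    also have "\<dots> \<le> b x" by (simp add: b_def)
    finally show ?thesis .
  qed
  have D_lim: "(\<lambda>n. D n x) \<longlonglongrightarrow> dens c v g x" for x
  proof (cases "x < 0")
    case True
    have "(\<lambda>n. exp (k n * x) * dens c v g x) \<longlonglongrightarrow> exp (0 * x) * dens c v g x" by (intro tendsto_intros k0)
    then show ?thesis unfolding D_neg[OF True] by simp
  next
    case False
    then have x: "x \<ge> 0" by simp
    have ck: "(\<lambda>n. c + k n) \<longlonglongrightarrow> c" using tendsto_add[OF tendsto_const k0, of c] by simp
    have "(\<lambda>n. profile e (c + k n) v x) \<longlonglongrightarrow> profile e c v x"
      unfolding profile_def by (intro tendsto_intros ck) simp
    then have "(\<lambda>n. V (profile e (c + k n) v x)) \<longlonglongrightarrow> V (profile e c v x)"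
      using V_derivative has_derivative_continuous isCont_tendsto_compose by blast
    then show ?thesis unfolding D_pos[OF x] dens_def by (intro tendsto_intros ck) simp_all
  qed
  have D_m: "D n \<in> borel_measurable lebesgue" for n unfolding D_def by (rule dens_measurable[OF w_m h_m])
  have "(\<lambda>n. LINT x|lebesgue. D n x) \<longlonglongrightarrow> (LINT x|lebesgue. dens c v g x)"
    by (rule integral_dominated_convergence[OF _ _ b_int])
      (use D_m int D_lim D_bd borel_measurable_integrable in auto)
  then have "eventually (\<lambda>n. (LINT x|lebesgue. D n x) < 0) sequentially"
    using neg by (rule order_tendstoD(2))
  then obtain n where n: "(LINT x|lebesgue. D n x) < 0" unfolding eventually_sequentially by blast
  have "integrable lebesgue (D n)"
    by (rule Bochner_Integration.integrable_bound[OF b_int D_m]) (use D_bd in \<open>auto intro!: AE_I2 intro: order_trans[OF _ abs_ge_self]\<close>)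
  then have "negative_energy (c + k n) (w n) (h n)"
    using n w_sob by (simp add: negative_energy_def D_def)
  then show ?thesis using that[of "c + k n"] k(1)[of n] by simp
qed

lemma c_nl_not_in_C_minus_infinity:
  "c_nl V e \<notin> C_minus_infinity V e"
proof
  assume "c_nl V e \<in> C_minus_infinity V e"
  then obtain v g where c: "c_nl V e > 0" and v: "negative_energy (c_nl V e) v g"
    using C_minus_infinity_iff by blast
  obtain c' v' g' where c': "c' > c_nl V e" "negative_energy c' v' g'" by (rule negative_energy_faster[OF v c])
  then have "c' \<in> C_minus_infinity V e" using C_minus_infinity_iff c by auto
  then have "c' \<le> c_nl V e" unfolding c_nl_def by (rule cSup_upper[OF _ C_minus_infinity_bdd_above])
  then show False using c' by simp
qed

text \<open>A profile equal to a minimum point of \<open>V\<close> on the left, and running linearly to \<open>e\<close> over \<open>[0, 1]\<close>, has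
  energy at most \<open>V m / c\<close> plus a constant, which is negative for small \<open>c\<close>.\<close>
lemma C_minus_infinity_nonempty: "C_minus_infinity V e \<noteq> {}"
proof -
  obtain m where m: "V m < 0" using V_min by blast
  have "compact ((\<lambda>t. e + t *\<^sub>R (m - e)) ` {0..1})" by (intro compact_continuous_image continuous_intros) auto
  then have "bounded (V ` ((\<lambda>t. e + t *\<^sub>R (m - e)) ` {0..1}))"
    by (rule compact_imp_bounded[OF compact_continuous_image[OF V_continuous]])
  then obtain B where "\<forall>t\<in>{0..1}. \<bar>V (e + t *\<^sub>R (m - e))\<bar> \<le> B" unfolding bounded_iff by auto
  then have B: "\<And>t. t \<in> {0..1} \<Longrightarrow> \<bar>V (e + t *\<^sub>R (m - e))\<bar> \<le> B" by blast
  have B0: "B \<ge> 0" using B[of 0] by auto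
  define d where "d = (norm (m - e))\<^sup>2 / 2 + B"
  have d0: "d \<ge> 0" using B0 by (simp add: d_def)
  \<comment> \<open>3 bounds \<open>exp c\<close>, the weight on the ramp, and \<open>d\<close> the density on it\<close>
  define c where "c = min 1 (- V m / (3 * d + 1))"
  have "- V m / (3 * d + 1) > 0" using m d0 by (intro divide_pos_pos) auto
  then have c: "0 < c" "c \<le> 1" by (auto simp: c_def)
  have small: "V m / c + 3 * d < 0"
  proof -
    have "c \<le> - V m / (3 * d + 1)" by (simp add: c_def)
    then have "c * (3 * d + 1) \<le> - V m" using d0 by (subst (asm) pos_le_divide_eq) auto
    then have "3 * d * c < - V m" using c by (simp add: algebra_simps)
    then have "3 * d < - V m / c" using c by (subst pos_less_divide_eq) auto
    then show ?thesis by simp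
  qed
  define s where "s x = max 0 (min 1 (1 - x))" for x :: real
  define s' :: "real \<Rightarrow> real" where "s' x = - indicator {0..1} x" for x
  have s_ac: "abs_cont s s'"
  proof (rule abs_cont_piecewise[where S = "{0,1}"])
    show "continuous_on UNIV s" unfolding s_def by (intro continuous_intros)
    show "s' \<in> borel_measurable lebesgue"
      unfolding s'_def by (intro borel_measurable_uminus borel_measurable_indicator) simp
    show "\<exists>B. \<forall>x\<in>{a..b}. norm (s' x) \<le> B" for a b by (intro exI[of _ 1]) (auto simp: s'_def indicator_def)
    fix x :: real assume x: "x \<notin> {0,1}"
    consider "x < 0" | "0 < x" "x < 1" | "x > 1" using x by fastforce
    then have "(s has_real_derivative s' x) (at x)"
    proof cases
      case 1
      have "((\<lambda>x. 1) has_real_derivative s' x) (at x)" using 1 by (simp add: s'_def)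
      then show ?thesis by (rule has_field_derivative_transform_within_open[of _ _ _ "{..<0}"]) (use 1 in \<open>auto simp: s_def\<close>)
    next
      case 2
      have "((\<lambda>x. 1 - x) has_real_derivative s' x) (at x)" using 2 by (auto simp: s'_def intro!: derivative_eq_intros)
      then show ?thesis by (rule has_field_derivative_transform_within_open[of _ _ _ "{0<..<1}"]) (use 2 in \<open>auto simp: s_def\<close>)
    next
      case 3
      have "((\<lambda>x. 0) has_real_derivative s' x) (at x)" using 3 by (simp add: s'_def)
      then show ?thesis by (rule has_field_derivative_transform_within_open[of _ _ _ "{1<..}"]) (use 3 in \<open>auto simp: s_def\<close>)
    qed
    then show "(s has_vector_derivative s' x) (at x)" by (simp add: has_real_derivative_iff_has_vector_derivative)
  qed simp
  define a where "a x = exp ((c / 2) * x) * s x" for x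
  define a' where "a' x = ((c / 2) * exp ((c / 2) * x)) * s x + exp ((c / 2) * x) * s' x" for x
  have a_ac: "abs_cont a a'"
    unfolding a_def a'_def by (rule abs_cont_product[OF bounded_bilinear_mult exp_abs_cont s_ac])
  define v where "v x = a x *\<^sub>R (m - e)" for x
  define g where "g x = a' x *\<^sub>R (m - e)" for x
  have v_ac: "abs_cont v g"
    using abs_cont_product[OF bounded_bilinear_scaleR a_ac abs_cont_const[of "m - e"]] by (simp add: v_def[abs_def] g_def[abs_def])
  have g_m: "g \<in> borel_measurable lebesgue"
    unfolding g_def[abs_def] a'_def
    by (intro borel_measurable_scaleR borel_measurable_add borel_measurable_times continuous_lebesgue_measurable[OF abs_cont_continuous[OF s_ac]]
       weight_measurable borel_measurable_const) (auto simp: s'_def[abs_def] intro!: borel_measurable_uminus borel_measurable_indicator)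
  have v_m: "v \<in> borel_measurable lebesgue" by (rule continuous_lebesgue_measurable[OF abs_cont_continuous[OF v_ac]])
  define E where "E x = indicator {..0} x * exp (c * x)" for x :: real
  define I where "I x = indicator {0..1} x * (1::real)" for x :: real
  have E: "integrable lebesgue E" "(LINT x|lebesgue. E x) = 1 / c"
    unfolding E_def using exp_left_integral[OF c(1)] by auto
  have I: "integrable lebesgue I" "(LINT x|lebesgue. I x) = 1"
    unfolding I_def by auto
  have sq: "(exp ((c / 2) * x))\<^sup>2 = exp (c * x)" for x by (simp add: power2_eq_square flip: exp_add)
  have wt: "exp (c * x) \<le> E x + 3 * I x" if "x \<le> 1" for x
  proof (cases "x \<le> 0")
    case True
    then show ?thesis by (simp add: E_def I_def)
  next
    case False
    have "c * x \<le> 1 * 1" using c that False by (intro mult_mono) auto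
    then have "exp (c * x) \<le> exp 1" by simp
    also have "\<dots> \<le> 3" by (rule exp_le)
    finally show ?thesis using False that by (simp add: E_def I_def)
  qed
  have s01: "0 \<le> s x" "s x \<le> 1" for x by (auto simp: s_def)
  have bd: "integrable lebesgue (\<lambda>x. r * (E x + 3 * I x))" for r using E(1) I(1) by simp
  have EI0: "E x + 3 * I x \<ge> 0" for x by (simp add: E_def I_def)
  have a_bd: "(a x)\<^sup>2 \<le> E x + 3 * I x" "(a' x)\<^sup>2 \<le> 4 * (E x + 3 * I x)" for x
  proof -
    show "(a x)\<^sup>2 \<le> E x + 3 * I x"
    proof (cases "x \<le> 1")
      case True
      have "(a x)\<^sup>2 \<le> exp (c * x) * 1" unfolding a_def power_mult_distrib sq using s01[of x] by (intro mult_left_mono) (auto simp: power_le_one)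
      then show ?thesis using wt[OF True] by simp
    next
      case False
      then show ?thesis using EI0[of x] by (simp add: a_def s_def)
    qed
    show "(a' x)\<^sup>2 \<le> 4 * (E x + 3 * I x)"
    proof (cases "x \<le> 1")
      case True
      have eq: "a' x = exp ((c / 2) * x) * ((c / 2) * s x + s' x)" by (simp add: a'_def algebra_simps)
      have "0 \<le> (c / 2) * s x" using c s01[of x] by simp
      moreover have "(c / 2) * s x \<le> 1 * 1" using c s01[of x] by (intro mult_mono) auto
      moreover have "-1 \<le> s' x" "s' x \<le> 0" by (auto simp: s'_def indicator_def)
      ultimately have "\<bar>(c / 2) * s x + s' x\<bar> \<le> 2" by auto
      then have "((c / 2) * s x + s' x)\<^sup>2 \<le> 2\<^sup>2" by (intro iffD1[OF abs_le_square_iff]) simp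
      then have "(a' x)\<^sup>2 \<le> exp (c * x) * 4" unfolding eq power_mult_distrib sq by (intro mult_left_mono) auto
      then show ?thesis using wt[OF True] by simp
    next
      case False
      then show ?thesis using EI0[of x] by (simp add: a'_def s_def s'_def)
    qed
  qed
  have sob: "sobolev v g"
    unfolding sobolev_def
  proof (intro conjI v_ac)
    show "L2 v"
    proof (rule L2_bounded_by[OF v_m bd])
      show "(norm (v x))\<^sup>2 \<le> (norm (m - e))\<^sup>2 * (E x + 3 * I x)" for x
        using a_bd(1)[of x] by (simp add: v_def power_mult_distrib mult.commute[of "(a x)\<^sup>2"] mult_left_mono)
    qed
    show "L2 g"
    proof (rule L2_bounded_by[OF g_m bd])
      show "(norm (g x))\<^sup>2 \<le> ((norm (m - e))\<^sup>2 * 4) * (E x + 3 * I x)" for x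
      proof -
        have "(norm (g x))\<^sup>2 = (norm (m - e))\<^sup>2 * (a' x)\<^sup>2" by (simp add: g_def power_mult_distrib)
        also have "\<dots> \<le> (norm (m - e))\<^sup>2 * (4 * (E x + 3 * I x))" by (intro mult_left_mono a_bd(2)) simp
        finally show ?thesis by (simp only: mult.assoc)
      qed
    qed
  qed
  have pr: "profile e c v x = e + s x *\<^sub>R (m - e)" for x
    unfolding profile_def v_def a_def by (simp add: exp_minus field_simps)
  have gv: "g x - (c / 2) *\<^sub>R v x = (exp ((c / 2) * x) * s' x) *\<^sub>R (m - e)" for x
    unfolding g_def v_def a'_def a_def by (simp add: algebra_simps flip: scaleR_diff_left)
  have dens_eq: "dens c v g x = exp (c * x) * ((s' x)\<^sup>2 * ((norm (m - e))\<^sup>2 / 2) + V (e + s x *\<^sub>R (m - e)))" for x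
    unfolding dens_def pr gv norm_scaleR power_mult_distrib power2_abs sq by (simp add: algebra_simps)
  have up: "dens c v g x \<le> V m * E x + 3 * d * I x" if "x \<noteq> 0" for x
  proof -
    consider "x < 0" | "0 < x" "x \<le> 1" | "x > 1" using \<open>x \<noteq> 0\<close> by fastforce
    then show ?thesis
    proof cases
      case 1
      then show ?thesis unfolding dens_eq by (simp add: s'_def s_def E_def I_def)
    next
      case 2
      have "(s' x)\<^sup>2 * ((norm (m - e))\<^sup>2 / 2) + V (e + s x *\<^sub>R (m - e)) \<le> d"
        using B[of "s x"] s01[of x] 2 by (simp add: s'_def d_def)
      then have "dens c v g x \<le> exp (c * x) * d" unfolding dens_eq by (intro mult_left_mono) auto
      also have "\<dots> \<le> (E x + 3 * I x) * d" using wt[of x] 2 d0 by (intro mult_right_mono) auto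
      finally show ?thesis using 2 by (simp add: E_def I_def)
    next
      case 3
      then show ?thesis unfolding dens_eq by (simp add: s'_def s_def E_def I_def V_e)
    qed
  qed
  have low: "\<bar>dens c v g x\<bar> \<le> d * (E x + 3 * I x)" for x
  proof (cases "x \<le> 1")
    case True
    have "(s' x)\<^sup>2 \<le> 1" by (simp add: s'_def indicator_def)
    then have "(s' x)\<^sup>2 * ((norm (m - e))\<^sup>2 / 2) \<le> 1 * ((norm (m - e))\<^sup>2 / 2)" by (intro mult_right_mono) auto
    then have "\<bar>(s' x)\<^sup>2 * ((norm (m - e))\<^sup>2 / 2) + V (e + s x *\<^sub>R (m - e))\<bar> \<le> d"
      using B[of "s x"] s01[of x] unfolding d_def by (intro order_trans[OF abs_triangle_ineq add_mono]) auto
    then have "\<bar>dens c v g x\<bar> \<le> exp (c * x) * d" unfolding dens_eq abs_mult by (intro mult_mono) auto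
    also have "\<dots> \<le> (E x + 3 * I x) * d" using wt[OF True] d0 by (intro mult_right_mono) auto
    finally show ?thesis by (simp add: mult.commute)
  next
    case False
    then show ?thesis unfolding dens_eq using d0 EI0[of x] by (simp add: s'_def s_def V_e)
  qed
  have int: "integrable lebesgue (dens c v g)"
    by (rule Bochner_Integration.integrable_bound[OF bd[of d] dens_measurable[OF v_m g_m]])
      (use low in \<open>auto intro!: AE_I2 intro: order_trans[OF _ abs_ge_self]\<close>)
  have "AE x in lebesgue. x \<noteq> (0::real)"
    by (rule AE_I'[of "{0}"]) (auto simp: negligible_iff_null_sets[symmetric])
  then have "AE x in lebesgue. dens c v g x \<le> V m * E x + 3 * d * I x" by eventually_elim (rule up)
  then have "(LINT x|lebesgue. dens c v g x) \<le> (LINT x|lebesgue. V m * E x + 3 * d * I x)"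
    using E(1) I(1) by (intro integral_mono_AE int) auto
  also have "\<dots> = V m / c + 3 * d" using E I by simp
  also have "\<dots> < 0" by (rule small)
  finally have "negative_energy c v g" using sob int by (simp add: negative_energy_def)
  then have "c \<in> C_minus_infinity V e" using c C_minus_infinity_iff by blast
  then show ?thesis by blast
qed

end

section \<open>Existence of a minimiser at the critical speed\<close>

text \<open>The Arzela-Ascoli theorem on \<open>[-i, i]\<close> for each \<open>i\<close>, and a diagonal sequence.\<close>
lemma locally_uniform_subsequence:
  fixes vn :: "nat \<Rightarrow> real \<Rightarrow> 'a::euclidean_space"
  assumes M: "\<And>n. norm (vn n 0) \<le> M" and K: "K \<ge> 0" "\<And>n x y. (norm (vn n y - vn n x))\<^sup>2 \<le> \<bar>y - x\<bar> * K"
  obtains v k where "strict_mono (k :: nat \<Rightarrow> nat)"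
    "\<And>R \<epsilon>. \<epsilon> > 0 \<Longrightarrow> \<exists>N. \<forall>n\<ge>N. \<forall>x. \<bar>x\<bar> \<le> R \<longrightarrow> norm (vn (k n) x - v x) \<le> \<epsilon>"
proof -
  define P where "P i r \<longleftrightarrow> (\<exists>g. \<forall>\<epsilon>>0. \<exists>N. \<forall>n x. n \<ge> N \<and> x \<in> {- real i..real i} \<longrightarrow> norm (vn (r n) x - g x) < \<epsilon>)"
    for i and r :: "nat \<Rightarrow> nat"
  have hold: "norm (vn n y - vn n x) \<le> sqrt (\<bar>y - x\<bar> * K)" for n x y
    using real_le_rsqrt[OF K(2)] .
  have sub: "\<exists>k. strict_mono k \<and> P i (r \<circ> k)" for i and r :: "nat \<Rightarrow> nat"
  proof -
    have 1: "norm (vn (r n) x) \<le> M + sqrt (real i * K)" if "x \<in> {- real i..real i}" for n x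
    proof -
      have "norm (vn (r n) x) \<le> norm (vn (r n) 0) + norm (vn (r n) x - vn (r n) 0)" by (metis norm_triangle_sub)
      also have "\<dots> \<le> M + sqrt (\<bar>x - 0\<bar> * K)" by (intro add_mono M hold)
      also have "\<dots> \<le> M + sqrt (real i * K)" using that K(1) by (intro add_left_mono real_sqrt_le_mono mult_right_mono) auto
      finally show ?thesis .
    qed
    have 2: "\<exists>d>0. \<forall>n y. y \<in> {- real i..real i} \<and> norm (x - y) < d \<longrightarrow> norm (vn (r n) x - vn (r n) y) < \<epsilon>"
      if "\<epsilon> > 0" for x \<epsilon>
    proof (intro exI[of _ "\<epsilon>\<^sup>2 / (K + 1)"] conjI allI impI)
      show "\<epsilon>\<^sup>2 / (K + 1) > 0" using that K(1) by (simp add: add_nonneg_pos)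
      fix n y assume "y \<in> {- real i..real i} \<and> norm (x - y) < \<epsilon>\<^sup>2 / (K + 1)"
      then have "\<bar>x - y\<bar> * (K + 1) < \<epsilon>\<^sup>2" using K(1) by (simp add: pos_less_divide_eq add_nonneg_pos)
      moreover have "\<bar>x - y\<bar> * K \<le> \<bar>x - y\<bar> * (K + 1)" by (intro mult_left_mono) auto
      ultimately have "(norm (vn (r n) x - vn (r n) y))\<^sup>2 < \<epsilon>\<^sup>2" using K(2)[where n = "r n" and y = x and x = y] by (meson le_less_trans order_trans)
      then show "norm (vn (r n) x - vn (r n) y) < \<epsilon>" using that by (simp add: power2_less_imp_less)
    qed
    obtain g k where "continuous_on {- real i..real i} g" "strict_mono (k :: nat \<Rightarrow> nat)"
      "\<And>\<epsilon>. 0 < \<epsilon> \<Longrightarrow> \<exists>N. \<forall>n x. n \<ge> N \<and> x \<in> {- real i..real i} \<longrightarrow> norm (vn (r (k n)) x - g x) < \<epsilon>"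
      by (rule Arzela_Ascoli[of "{- real i..real i}" "\<lambda>n. vn (r n)" "M + sqrt (real i * K)"]) (use 1 2 in auto)
    then show ?thesis unfolding P_def o_def by blast
  qed
  obtain k where k: "strict_mono (k :: nat \<Rightarrow> nat)" "\<And>i. P i (id \<circ> k)"
  proof (rule subsequence_diagonalization_lemma[of P id])
    show "\<exists>k. strict_mono k \<and> P i (r \<circ> k)" for i and r :: "nat \<Rightarrow> nat" by (rule sub)
    fix i N and r k1 k2 :: "nat \<Rightarrow> nat"
    assume P1: "P i (r \<circ> k1)" and tail: "\<And>j. N \<le> j \<Longrightarrow> \<exists>j'\<ge>j. k2 j = k1 j'"
    obtain g where g: "\<And>\<epsilon>. \<epsilon> > 0 \<Longrightarrow> \<exists>N. \<forall>n x. n \<ge> N \<and> x \<in> {- real i..real i} \<longrightarrow> norm (vn ((r \<circ> k1) n) x - g x) < \<epsilon>"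
      using P1 unfolding P_def by blast
    have "\<exists>N. \<forall>n x. n \<ge> N \<and> x \<in> {- real i..real i} \<longrightarrow> norm (vn ((r \<circ> k2) n) x - g x) < \<epsilon>" if ep: "\<epsilon> > 0" for \<epsilon>
    proof -
      obtain N1 where N1: "\<And>n x. n \<ge> N1 \<Longrightarrow> x \<in> {- real i..real i} \<Longrightarrow> norm (vn (r (k1 n)) x - g x) < \<epsilon>"
        using g[OF ep] unfolding o_def by blast
      have "norm (vn (r (k2 n)) x - g x) < \<epsilon>" if n: "n \<ge> max N N1" and x: "x \<in> {- real i..real i}" for n x
      proof -
        obtain j where j: "j \<ge> n" "k2 n = k1 j" using tail[of n] n by auto
        then show ?thesis using N1[of j x] n x by simp
      qed
      then show ?thesis by (intro exI[of _ "max N N1"]) auto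
    qed
    then show "P i (r \<circ> k2)" unfolding P_def by blast
  qed (use that in blast)
  have "\<exists>g. \<forall>\<epsilon>>0. \<exists>N. \<forall>n x. n \<ge> N \<and> x \<in> {- real i..real i} \<longrightarrow> norm (vn (k n) x - g x) < \<epsilon>" for i
    using k(2)[of i] by (simp add: P_def)
  then obtain g where g: "\<And>i \<epsilon>. \<epsilon> > 0 \<Longrightarrow> \<exists>N. \<forall>n x. n \<ge> N \<and> x \<in> {- real i..real i} \<longrightarrow> norm (vn (k n) x - g i x) < \<epsilon>"
    by metis
  have glim: "(\<lambda>n. vn (k n) x) \<longlonglongrightarrow> g i x" if "\<bar>x\<bar> \<le> real i" for i x
  proof (rule LIMSEQ_I)
    fix \<epsilon> :: real assume "\<epsilon> > 0"
    then obtain N where N: "\<forall>n x. n \<ge> N \<and> x \<in> {- real i..real i} \<longrightarrow> norm (vn (k n) x - g i x) < \<epsilon>"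
      using g by blast
    show "\<exists>no. \<forall>n\<ge>no. norm (vn (k n) x - g i x) < \<epsilon>"
    proof (intro exI[of _ N] allI impI)
      fix n assume "N \<le> n"
      moreover have "x \<in> {- real i..real i}" using that by (simp add: abs_le_iff) 
      ultimately show "norm (vn (k n) x - g i x) < \<epsilon>" using N by blast
    qed
  qed
  define v where "v x = lim (\<lambda>n. vn (k n) x)" for x
  have veq: "v x = g i x" if "\<bar>x\<bar> \<le> real i" for i x
    unfolding v_def by (rule limI[OF glim[OF that]])
  have "\<exists>N. \<forall>n\<ge>N. \<forall>x. \<bar>x\<bar> \<le> R \<longrightarrow> norm (vn (k n) x - v x) \<le> \<epsilon>" if ep: "\<epsilon> > 0" for R \<epsilon>
  proof -
    obtain i :: nat where i: "R \<le> real i" using real_arch_simple by blast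
    obtain N where N: "\<And>n x. n \<ge> N \<Longrightarrow> x \<in> {- real i..real i} \<Longrightarrow> norm (vn (k n) x - g i x) < \<epsilon>"
      using g[OF ep, of i] by blast
    have "norm (vn (k n) x - v x) \<le> \<epsilon>" if "n \<ge> N" "\<bar>x\<bar> \<le> R" for n x
    proof -
      have "\<bar>x\<bar> \<le> real i" using that i by simp
      moreover from this have "x \<in> {- real i..real i}" by (simp add: abs_le_iff)
      ultimately show ?thesis using N[OF that(1), of x] veq[of x i] by simp
    qed
    then show ?thesis by blast
  qed
  then show ?thesis using that k(1) by blast
qed

lemma abs_cont_cong_AE:
  assumes "abs_cont v g" "AE x in lebesgue. g x = h x" "loc_integrable h"
  shows "abs_cont v h"
  unfolding abs_cont_def
proof (intro conjI allI impI assms(3))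
  fix a b :: real assume ab: "a \<le> b"
  obtain N where N: "\<And>x. x \<in> space lebesgue - N \<Longrightarrow> g x = h x" "N \<in> null_sets lebesgue"
    using AE_E3[OF assms(2)] by blast
  show "(h has_integral v b - v a) {a..b}"
    by (rule has_integral_spike[OF _ _ abs_contD(2)[OF assms(1) ab], of N]) (use N negligible_iff_null_sets in auto)
qed

lemma abs_cont_vector_derivative:
  assumes "abs_cont v g" "continuous_on UNIV g"
  shows "(v has_vector_derivative g x) (at x)"
proof -
  have "v = (\<lambda>x. v 0 + prim g x)" by (rule ext) (rule abs_cont_eq_prim[OF assms(1)])
  moreover have "((\<lambda>x. v 0 + prim g x) has_vector_derivative 0 + g x) (at x)"
    by (intro has_vector_derivative_add has_vector_derivative_const prim_derivative assms(2))
  ultimately show ?thesis by simp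
qed

lemma linear_term_zero:
  fixes X Y :: real
  assumes "\<And>t. \<bar>t\<bar> \<le> 1 \<Longrightarrow> 0 \<le> t * X + t\<^sup>2 * Y"
  shows "X = 0"
proof (rule ccontr)
  assume X: "X \<noteq> 0"
  define p where "p = \<bar>X\<bar> + \<bar>Y\<bar>"
  have p: "p > 0" "\<bar>X\<bar> \<le> p" "Y - p < 0" using X by (auto simp: p_def)
  define t where "t = - X / p"
  have "\<bar>t\<bar> \<le> 1" using p by (simp add: t_def)
  then have "0 \<le> t * X + t\<^sup>2 * Y" by (rule assms)
  also have "t * X + t\<^sup>2 * Y = X\<^sup>2 / p\<^sup>2 * (Y - p)"
    using p(1) by (simp add: t_def field_simps power2_eq_square)
  finally have "0 \<le> X\<^sup>2 / p\<^sup>2 * (Y - p)" .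
  moreover have "X\<^sup>2 / p\<^sup>2 > 0" using X p(1) by simp
  ultimately show False using p(3) by (meson linorder_not_le mult_pos_neg)
qed

context invaded_potential
begin

lemma norm_profile: "norm (profile e c v x - e) = exp (- (c / 2) * x) * norm (v x)"
  by (simp add: profile_def)

lemma pot_factor: "pot c v x = exp (c * x) * (V (profile e c v x) + c\<^sup>2 / 8 * (norm (profile e c v x - e))\<^sup>2)"
  unfolding pot_def using weight_cancel[of c x v] by (simp add: distrib_left)

text \<open>The lower bound is uniform in the speeds \<open>c \<ge> c0\<close>, which is needed for a sequence of speeds.\<close>
lemma pot_near_e:
  assumes near: "\<And>u. norm (u - e) \<le> \<delta> \<Longrightarrow> \<epsilon> * (norm (u - e))\<^sup>2 \<le> V u + c0\<^sup>2/8 * (norm (u - e))\<^sup>2"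
    and "0 \<le> c0" "c0 \<le> c" "norm (profile e c v x - e) \<le> \<delta>"
  shows "\<epsilon> * (norm (v x))\<^sup>2 \<le> pot c v x"
proof -
  have "c0\<^sup>2 \<le> c\<^sup>2" using assms by (intro power_mono) auto
  then have "c0\<^sup>2/8 * (norm (profile e c v x - e))\<^sup>2 \<le> c\<^sup>2/8 * (norm (profile e c v x - e))\<^sup>2" by (intro mult_right_mono) auto
  then have "\<epsilon> * (norm (profile e c v x - e))\<^sup>2 \<le> V (profile e c v x) + c\<^sup>2/8 * (norm (profile e c v x - e))\<^sup>2"
    using near[OF assms(4)] by linarith
  then have "exp (c * x) * (\<epsilon> * (norm (profile e c v x - e))\<^sup>2) \<le> pot c v x"
    unfolding pot_factor by (intro mult_left_mono) auto
  moreover have "exp (c * x) * (\<epsilon> * (norm (profile e c v x - e))\<^sup>2) = \<epsilon> * (norm (v x))\<^sup>2"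
    unfolding weight_cancel[of c x v, symmetric] by simp
  ultimately show ?thesis by simp
qed

text \<open>The profile is not always in the ball, since \<open>pot\<close> would be nonnegative. The last time at which it is not
  in the open ball is translated to 0; there \<open>profile\<close> and \<open>v\<close> differ by the constant \<open>e\<close> only.\<close>
lemma negative_energy_normalised:
  assumes near: "\<And>u. norm (u - e) \<le> \<delta> \<Longrightarrow> \<epsilon> * (norm (u - e))\<^sup>2 \<le> V u + c0\<^sup>2/8 * (norm (u - e))\<^sup>2"
    and pos: "0 < \<delta>" "0 < \<epsilon>" and c: "0 < c0" "c0 \<le> c" and ne: "negative_energy c v g"
  obtains v' g' where "sobolev v' g'" "integrable lebesgue (pot c v')"
    "sq_int g' / 2 + (LINT x|lebesgue. pot c v' x) \<le> 0"
    "norm (v' 0) = \<delta>" "\<And>x. x \<ge> 0 \<Longrightarrow> norm (profile e c v' x - e) \<le> \<delta>"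
proof -
  have v: "sobolev v g" and int: "integrable lebesgue (dens c v g)" and neg: "(LINT x|lebesgue. dens c v g x) < 0"
    using ne by (auto simp: negative_energy_def)
  define q where "q x = norm (profile e c v x - e)" for x
  have q_cont: "continuous_on UNIV q"
    using abs_cont_continuous[of v g UNIV] v unfolding q_def norm_profile sobolev_def by (intro continuous_intros) auto
  define A where "A = {x. \<delta> \<le> q x}"
  have A_ne: "A \<noteq> {}"
  proof
    assume "A = {}"
    then have "\<not> \<delta> \<le> q x" for x unfolding A_def by blast
    then have "q x \<le> \<delta>" for x by (simp add: less_imp_le not_le)
    then have "\<epsilon> * (norm (v x))\<^sup>2 \<le> pot c v x" for x using pot_near_e[OF near _ c(2)] c(1) by (simp add: q_def)
    then have "pot c v x \<ge> 0" for x using pos(2) by (meson less_imp_le mult_nonneg_nonneg order_trans zero_le_power2)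
    then have "(LINT x|lebesgue. pot c v x) \<ge> 0" by simp
    then have "sq_int g / 2 + (LINT x|lebesgue. pot c v x) \<ge> 0"
      by (intro add_nonneg_nonneg divide_nonneg_nonneg) auto
    then show False using dens_integral[OF v, of c] int neg by simp
  qed
  have "eventually (\<lambda>x. norm (v x) < \<delta>) at_top"
    using tendstoD[OF sobolev_tendsto(1)[OF v] pos(1)] by simp
  then obtain X where X: "\<And>x. x \<ge> X \<Longrightarrow> norm (v x) < \<delta>" unfolding eventually_at_top_linorder by blast
  have A_bdd: "bdd_above A"
  proof (rule bdd_aboveI[of _ "max 0 X"])
    fix x assume x: "x \<in> A"
    show "x \<le> max 0 X"
    proof (rule ccontr)
      assume "\<not> x \<le> max 0 X"
      then have "norm (v x) < \<delta>" "x > 0" using X[of x] by auto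
      moreover have "q x \<le> 1 * norm (v x)"
        unfolding q_def norm_profile using \<open>x > 0\<close> c by (intro mult_right_mono) auto
      ultimately show False using x by (simp add: A_def)
    qed
  qed
  have A_closed: "closed A" unfolding A_def by (intro closed_Collect_le continuous_on_const q_cont)
  define a where "a = Sup A"
  have aA: "a \<in> A" unfolding a_def by (rule closed_contains_Sup[OF A_ne A_bdd A_closed])
  have after: "q x < \<delta>" if "x > a" for x
    using cSup_upper[of x A] A_bdd that unfolding a_def A_def by force
  have "q a \<le> \<delta>"
  proof (rule tendsto_upperbound)
    show "(q \<longlongrightarrow> q a) (at_right a)"
      using q_cont by (simp add: continuous_on_eq_continuous_at continuous_at_imp_continuous_at_within continuous_within[symmetric])
    show "eventually (\<lambda>x. q x \<le> \<delta>) (at_right a)"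
      using after by (auto simp: eventually_at_right_field intro!: exI[of _ "a + 1"] less_imp_le)
  qed simp
  then have qa: "q a = \<delta>" using aA by (simp add: A_def)
  define v' where "v' = (\<lambda>x. exp (c * (- a) / 2) *\<^sub>R v (x - (- a)))"
  define g' where "g' = (\<lambda>x. exp (c * (- a) / 2) *\<^sub>R g (x - (- a)))"
  have sob: "sobolev v' g'" unfolding v'_def g'_def by (rule sobolev_translate[OF v])
  have d_int: "integrable lebesgue (dens c v' g')" unfolding v'_def g'_def by (rule dens_translate_integral(1)[OF int])
  have "(LINT x|lebesgue. dens c v' g' x) = exp (c * (- a)) * (LINT x|lebesgue. dens c v g x)"
    unfolding v'_def g'_def by (rule dens_translate_integral(2)[OF int])
  then have le: "(LINT x|lebesgue. dens c v' g' x) \<le> 0" using neg by (simp add: mult_nonneg_nonpos)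
  have p_int: "integrable lebesgue (pot c v')" using dens_integral(1)[OF sob] d_int by blast
  have pr: "norm (profile e c v' x - e) = q (x + a)" for x
    unfolding v'_def profile_translate q_def by simp
  show ?thesis
  proof (rule that[OF sob p_int])
    show "sq_int g' / 2 + (LINT x|lebesgue. pot c v' x) \<le> 0"
      using le dens_integral(2)[OF sob p_int] by simp
    show "norm (v' 0) = \<delta>" using pr[of 0] qa by (simp add: norm_profile)
    show "norm (profile e c v' x - e) \<le> \<delta>" if "x \<ge> 0" for x
      using after[of "x + a"] qa pr[of x] that by (cases "x = 0") auto
  qed
qed

text \<open>On the right half-line \<open>pot\<close> controls \<open>\<bar>v\<bar>\<^sup>2\<close> by the normalisation; on the left one it does so
  up to the integrable function \<open>B\<close>, which is independent of the speed. Hence \<open>pot + B\<close> is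
  nonnegative, Fatou's lemma applies to it, and the Dirichlet integrals are bounded by
  \<open>K = 2 \<integral> B\<close>.\<close>
lemma minimiser_exists:
  assumes lt: "c_lin V e < c_nl V e"
  obtains v g where "sobolev v g" "integrable lebesgue (dens (c_nl V e) v g)"
    "(LINT x|lebesgue. dens (c_nl V e) v g x) \<le> 0" "v 0 \<noteq> 0"
proof -
  define c where "c = c_nl V e"
  have "c_lin V e \<ge> 0" by (simp add: c_lin_def Let_def)
  \<comment> \<open>a speed that separates \<open>c_lin\<close> from the approximating speeds \<open>d n\<close>\<close>
  define c0 where "c0 = (c_lin V e + c) / 2"
  have c0: "c_lin V e < c0" "0 < c0" "c0 < c" using lt \<open>c_lin V e \<ge> 0\<close> by (auto simp: c0_def c_def)
  obtain \<delta> \<epsilon> where pos: "\<delta> > 0" "\<epsilon> > 0"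
    and near: "\<And>u. norm (u - e) \<le> \<delta> \<Longrightarrow> \<epsilon> * (norm (u - e))\<^sup>2 \<le> V u + c0\<^sup>2/8 * (norm (u - e))\<^sup>2"
    by (rule V_near_e[OF c0(1)]) blast
  have "\<exists>d. d \<in> C_minus_infinity V e \<and> max c0 (c - 1 / real (Suc n)) < d" for n
  proof -
    have "max c0 (c - 1 / real (Suc n)) < Sup (C_minus_infinity V e)" using c0 by (simp add: c_def c_nl_def)
    then show ?thesis using less_cSupD[OF C_minus_infinity_nonempty] by blast
  qed
  then obtain d where d: "\<And>n. d n \<in> C_minus_infinity V e" "\<And>n. max c0 (c - 1 / real (Suc n)) < d n" by metis
  have dc: "d n \<le> c" for n unfolding c_def c_nl_def by (rule cSup_upper[OF d(1) C_minus_infinity_bdd_above])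
  have d0: "c0 \<le> d n" for n using d(2)[of n] by simp
  have d_lim: "d \<longlonglongrightarrow> c"
  proof (rule tendsto_sandwich[OF _ _ _ tendsto_const])
    show "eventually (\<lambda>n. c - 1 / real (Suc n) \<le> d n) sequentially" using d(2) by (intro always_eventually) (auto simp: less_imp_le)
    show "eventually (\<lambda>n. d n \<le> c) sequentially" using dc by simp
    show "(\<lambda>n. c - 1 / real (Suc n)) \<longlonglongrightarrow> c"
      using tendsto_diff[OF tendsto_const LIMSEQ_Suc[OF lim_1_over_n], of c] by simp
  qed
  have "\<exists>v g. sobolev v g \<and> integrable lebesgue (pot (d n) v) \<and>
    sq_int g / 2 + (LINT x|lebesgue. pot (d n) v x) \<le> 0 \<and>
    norm (v 0) = \<delta> \<and> (\<forall>x\<ge>0. norm (profile e (d n) v x - e) \<le> \<delta>)" for n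
  proof -
    obtain v g where "negative_energy (d n) v g" using d(1)[of n] C_minus_infinity_iff by blast
    from negative_energy_normalised[OF near pos c0(2) d0 this] show ?thesis by metis
  qed
  then obtain v g where vg: "\<And>n. sobolev (v n) (g n)" "\<And>n. integrable lebesgue (pot (d n) (v n))"
    "\<And>n. sq_int (g n) / 2 + (LINT x|lebesgue. pot (d n) (v n) x) \<le> 0"
    "\<And>n. norm (v n 0) = \<delta>" "\<And>n x. x \<ge> 0 \<Longrightarrow> norm (profile e (d n) (v n) x - e) \<le> \<delta>" by metis
  obtain m where m: "\<And>u. V m \<le> V u" "V m < 0" using V_min by blast
  define B where "B x = - V m * (indicator {..0} x * exp (c0 * x))" for x
  have B: "integrable lebesgue B" "(LINT x|lebesgue. B x) = - V m / c0"
    unfolding B_def using exp_left_integral[OF c0(2)] by auto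
  define \<epsilon>' where "\<epsilon>' = min \<epsilon> (c0\<^sup>2 / 8)"
  have \<epsilon>': "\<epsilon>' > 0" using pos c0 by (simp add: \<epsilon>'_def)
  have low: "\<epsilon>' * (norm (v n x))\<^sup>2 \<le> pot (d n) (v n) x + B x" for n x
  proof (cases "x \<ge> 0")
    case True
    have "\<epsilon>' * (norm (v n x))\<^sup>2 \<le> \<epsilon> * (norm (v n x))\<^sup>2" by (intro mult_right_mono) (auto simp: \<epsilon>'_def)
    also have "\<dots> \<le> pot (d n) (v n) x"
      using pot_near_e[OF near _ d0 vg(5)[OF True]] c0 by simp
    also have "\<dots> \<le> pot (d n) (v n) x + B x"
    proof -
      have "- V m * (indicator {..0} x * exp (c0 * x)) \<ge> 0" using m(2) by (intro mult_nonneg_nonneg) auto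
      then show ?thesis by (simp add: B_def)
    qed
    finally show ?thesis .
  next
    case False
    have "c0\<^sup>2 \<le> (d n)\<^sup>2" using d0[of n] c0 by (intro power_mono) auto
    then have "\<epsilon>' * (norm (v n x))\<^sup>2 \<le> (d n)\<^sup>2 / 8 * (norm (v n x))\<^sup>2" by (intro mult_right_mono) (auto simp: \<epsilon>'_def)
    moreover have "exp (d n * x) \<le> exp (c0 * x)" using False d0[of n] by (simp add: mult_right_mono_neg)
    then have "exp (c0 * x) * V m \<le> exp (d n * x) * V m" using m(2) by (intro mult_right_mono_neg) auto
    moreover have "exp (d n * x) * V m \<le> exp (d n * x) * V (profile e (d n) (v n) x)" using m(1) by (intro mult_left_mono) auto
    moreover have "B x = - (exp (c0 * x) * V m)" using False by (simp add: B_def)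
    ultimately show ?thesis unfolding pot_def by argo
  qed
  define K where "K = 2 * (- V m / c0)"
  have "- V m / c0 \<ge> 0" using m(2) c0 by (intro divide_nonneg_pos) auto
  then have K0: "K \<ge> 0" by (simp add: K_def)
  have pB: "integrable lebesgue (\<lambda>x. pot (d n) (v n) x + B x)"
    "(LINT x|lebesgue. pot (d n) (v n) x + B x) = (LINT x|lebesgue. pot (d n) (v n) x) - V m / c0" for n
    using vg(2)[of n] B by auto
  have pB0: "0 \<le> pot (d n) (v n) x + B x" for n x
    using low[of n x] \<epsilon>' by (meson less_imp_le mult_nonneg_nonneg order_trans zero_le_power2)
  have gK: "sq_int (g n) \<le> K" for n
  proof -
    have "0 \<le> (LINT x|lebesgue. pot (d n) (v n) x + B x)" using pB0 by simp
    then show ?thesis using vg(3)[of n] pB(2)[of n] unfolding K_def by argo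
  qed
  have hold: "(norm (v n y - v n x))\<^sup>2 \<le> \<bar>y - x\<bar> * K" for n x y
    by (rule sobolev_hoelder[OF vg(1) gK])
  obtain v' k1 where k1: "strict_mono (k1 :: nat \<Rightarrow> nat)"
    and lim1: "\<And>R \<epsilon>. \<epsilon> > 0 \<Longrightarrow> \<exists>N. \<forall>n\<ge>N. \<forall>x. \<bar>x\<bar> \<le> R \<longrightarrow> norm (v (k1 n) x - v' x) \<le> \<epsilon>"
    by (rule locally_uniform_subsequence[of v \<delta> K, OF eq_refl[OF vg(4)] K0 hold]) blast
  define G where "G n = sq_int (g n)" for n
  have "\<And>n. G (k1 n) \<in> {0..K}" using gK by (simp add: G_def)
  moreover have "compact {0..K}" by simp
  ultimately obtain \<kappa> k2 where k2: "strict_mono (k2 :: nat \<Rightarrow> nat)" and \<kappa>: "((\<lambda>n. G (k1 n)) \<circ> k2) \<longlonglongrightarrow> \<kappa>"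
    unfolding compact_def by metis
  define k where "k n = k1 (k2 n)" for n
  have k: "strict_mono k" using strict_mono_o[OF k1 k2] by (simp add: k_def[abs_def] o_def)
  have \<kappa>: "(\<lambda>n. LINT x|lebesgue. (norm (g (k n) x))\<^sup>2) \<longlonglongrightarrow> \<kappa>" using \<kappa> by (simp add: o_def k_def G_def)
  have lim: "\<exists>N. \<forall>n\<ge>N. \<forall>x. \<bar>x\<bar> \<le> R \<longrightarrow> norm (v (k n) x - v' x) \<le> \<epsilon>" if ep: "\<epsilon> > 0" for R \<epsilon>
  proof -
    obtain N where N: "\<And>n x. n \<ge> N \<Longrightarrow> \<bar>x\<bar> \<le> R \<Longrightarrow> norm (v (k1 n) x - v' x) \<le> \<epsilon>" using lim1[OF ep] by blast
    have "norm (v (k n) x - v' x) \<le> \<epsilon>" if "n \<ge> N" "\<bar>x\<bar> \<le> R" for n x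
      using N[of "k2 n" x] that seq_suble[OF k2, of n] by (simp add: k_def)
    then show ?thesis by blast
  qed
  have gL: "L2 (g n)" "abs_cont (v n) (g n)" for n using vg(1)[of n] by (auto simp: sobolev_def)
  obtain g' where g': "L2 g'" "abs_cont v' g'" "sq_int g' \<le> \<kappa>"
    by (rule L2_weak_limit[of "\<lambda>n. v (k n)" "\<lambda>n. g (k n)", OF gL(2) gL(1) \<kappa> lim]) blast+
  have vlim: "(\<lambda>n. v (k n) x) \<longlonglongrightarrow> v' x" for x
  proof (rule LIMSEQ_I)
    fix r :: real assume "r > 0"
    then obtain N where "\<And>n. n \<ge> N \<Longrightarrow> norm (v (k n) x - v' x) \<le> r / 2" using lim[of "r/2" "\<bar>x\<bar>"] by auto
    then have "\<And>n. n \<ge> N \<Longrightarrow> norm (v (k n) x - v' x) < r" using \<open>r > 0\<close> by (smt (verit) field_sum_of_halves)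
    then show "\<exists>no. \<forall>n\<ge>no. norm (v (k n) x - v' x) < r" by blast
  qed
  have dk: "(\<lambda>n. d (k n)) \<longlonglongrightarrow> c" using LIMSEQ_subseq_LIMSEQ[OF d_lim k] by (simp add: o_def)
  have plim: "(\<lambda>n. pot (d (k n)) (v (k n)) x + B x) \<longlonglongrightarrow> pot c v' x + B x" for x
  proof -
    have "(\<lambda>n. profile e (d (k n)) (v (k n)) x) \<longlonglongrightarrow> profile e c v' x"
      unfolding profile_def by (intro tendsto_intros dk vlim) simp
    then have "(\<lambda>n. V (profile e (d (k n)) (v (k n)) x)) \<longlonglongrightarrow> V (profile e c v' x)"
      using V_derivative has_derivative_continuous isCont_tendsto_compose by blast
    then show ?thesis unfolding pot_def by (intro tendsto_intros dk vlim) simp_all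
  qed
  have v'_m: "v' \<in> borel_measurable lebesgue" by (rule continuous_lebesgue_measurable[OF abs_cont_continuous[OF g'(2)]])
  have vm: "v n \<in> borel_measurable lebesgue" for n by (rule continuous_lebesgue_measurable[OF abs_cont_continuous[OF gL(2)]])
  have low': "\<epsilon>' * (norm (v' x))\<^sup>2 \<le> pot c v' x + B x" for x
  proof (rule LIMSEQ_le)
    show "(\<lambda>n. \<epsilon>' * (norm (v (k n) x))\<^sup>2) \<longlonglongrightarrow> \<epsilon>' * (norm (v' x))\<^sup>2" by (intro tendsto_intros vlim)
    show "\<exists>N. \<forall>n\<ge>N. \<epsilon>' * (norm (v (k n) x))\<^sup>2 \<le> pot (d (k n)) (v (k n)) x + B x" using low by blast
  qed (rule plim)
  have f0: "0 \<le> pot c v' x + B x" for x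
    using low'[of x] \<epsilon>' by (meson less_imp_le mult_nonneg_nonneg order_trans zero_le_power2)
  have f_m: "(\<lambda>x. pot c v' x + B x) \<in> borel_measurable lebesgue"
    using pot_measurable[OF v'_m] B(1) by (intro borel_measurable_add) auto
  \<comment> \<open>\<open>U n\<close> bounds the integral of \<open>pot + B\<close>; its limit contains \<open>\<kappa>\<close>, which pays for the Dirichlet integral of the limit\<close>
  define U where "U n = - V m / c0 - G (k n) / 2" for n
  have "(\<integral>\<^sup>+x. ennreal (pot c v' x + B x) \<partial>lebesgue) = (\<integral>\<^sup>+x. liminf (\<lambda>n. ennreal (pot (d (k n)) (v (k n)) x + B x)) \<partial>lebesgue)"
  proof (rule nn_integral_cong)
    fix x
    have "(\<lambda>n. ennreal (pot (d (k n)) (v (k n)) x + B x)) \<longlonglongrightarrow> ennreal (pot c v' x + B x)" by (intro tendsto_ennrealI plim)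
    from lim_imp_Liminf[OF trivial_limit_sequentially this]
    show "ennreal (pot c v' x + B x) = liminf (\<lambda>n. ennreal (pot (d (k n)) (v (k n)) x + B x))" by simp
  qed
  also have "\<dots> \<le> liminf (\<lambda>n. \<integral>\<^sup>+x. ennreal (pot (d (k n)) (v (k n)) x + B x) \<partial>lebesgue)"
    by (rule nn_integral_liminf) (use pot_measurable[OF vm] B(1) in measurable)
  also have "\<dots> \<le> liminf (\<lambda>n. ennreal (U n))"
  proof (rule Liminf_mono, rule always_eventually, rule allI)
    fix n
    have "(\<integral>\<^sup>+x. ennreal (pot (d (k n)) (v (k n)) x + B x) \<partial>lebesgue) = ennreal (LINT x|lebesgue. pot (d (k n)) (v (k n)) x + B x)"
      by (rule nn_integral_eq_integral[OF pB(1)]) (simp add: pB0)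
    also have "\<dots> \<le> ennreal (U n)"
      using vg(3)[of "k n"] unfolding pB(2) by (intro ennreal_leI) (simp add: U_def G_def)
    finally show "(\<integral>\<^sup>+x. ennreal (pot (d (k n)) (v (k n)) x + B x) \<partial>lebesgue) \<le> ennreal (U n)" .
  qed
  also have "liminf (\<lambda>n. ennreal (U n)) = ennreal (- V m / c0 - \<kappa> / 2)"
  proof (rule lim_imp_Liminf[OF trivial_limit_sequentially], rule tendsto_ennrealI)
    show "U \<longlonglongrightarrow> - V m / c0 - \<kappa> / 2" unfolding U_def G_def by (intro tendsto_intros \<kappa>) simp
  qed
  finally have fat: "(\<integral>\<^sup>+x. ennreal (pot c v' x + B x) \<partial>lebesgue) \<le> ennreal (- V m / c0 - \<kappa> / 2)" .
  have f_int: "integrable lebesgue (\<lambda>x. pot c v' x + B x)"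
    using fat f0 by (intro integrableI_bounded[OF f_m]) (auto intro: le_less_trans)
  have \<kappa>K: "0 \<le> - V m / c0 - \<kappa> / 2"
  proof -
    have "\<kappa> \<le> K" by (rule LIMSEQ_le_const2[OF \<kappa>]) (use gK in blast)
    then show ?thesis unfolding K_def by argo
  qed
  have f_le: "(LINT x|lebesgue. pot c v' x + B x) \<le> - V m / c0 - \<kappa> / 2"
    using fat nn_integral_eq_integral[OF f_int] f0 \<kappa>K by (simp add: ennreal_le_iff)
  have p_int: "integrable lebesgue (pot c v')"
    using Bochner_Integration.integrable_diff[OF f_int B(1)] by simp
  have p_le: "(LINT x|lebesgue. pot c v' x) \<le> - \<kappa> / 2"
    using f_le B p_int by simp
  have "L2 v'"
  proof (rule L2_bounded_by[OF v'_m])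
    show "integrable lebesgue (\<lambda>x. (1 / \<epsilon>') * (pot c v' x + B x))" using f_int by simp
    show "(norm (v' x))\<^sup>2 \<le> (1 / \<epsilon>') * (pot c v' x + B x)" for x
      using low'[of x] \<epsilon>' by (simp add: pos_le_divide_eq mult.commute)
  qed
  then have sob: "sobolev v' g'" using g' by (simp add: sobolev_def)
  have "(LINT x|lebesgue. dens c v' g' x) \<le> 0"
    using dens_integral(2)[OF sob p_int] p_le g'(3) by simp
  moreover have "integrable lebesgue (dens c v' g')" using dens_integral(1)[OF sob] p_int by blast
  moreover have "norm (v' 0) = \<delta>"
    using LIMSEQ_unique[OF tendsto_norm[OF vlim[of 0]]] vg(4) by simp
  then have "v' 0 \<noteq> 0" using pos by auto
  ultimately show ?thesis using that sob by (simp add: c_def)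
qed

end

section \<open>The Euler-Lagrange equation\<close>

lemma L2_compact_support:
  fixes f :: "real \<Rightarrow> 'a::euclidean_space"
  assumes "continuous_on UNIV f" "\<And>x. \<bar>x\<bar> \<ge> A \<Longrightarrow> f x = 0"
  shows "L2 f"
  unfolding L2_def
proof
  show "f \<in> borel_measurable lebesgue" by (rule continuous_lebesgue_measurable[OF assms(1)])
  show "integrable lebesgue (\<lambda>x. (norm (f x))\<^sup>2)"
  proof (rule LINT_supported(1)[where a = "-A" and b = A])
    show "(\<lambda>x. (norm (f x))\<^sup>2) absolutely_integrable_on {-A..A}"
      by (intro absolutely_integrable_continuous_real continuous_intros continuous_on_subset[OF assms(1)]) auto
    show "(norm (f x))\<^sup>2 = 0" if "x \<notin> {-A..A}" for x using assms(2)[of x] that by auto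
  qed
qed

lemma integrable_compact_support:
  fixes f :: "real \<Rightarrow> 'a::euclidean_space"
  assumes "continuous_on UNIV f" "\<And>x. \<bar>x\<bar> \<ge> A \<Longrightarrow> f x = 0"
  shows "integrable lebesgue f"
proof (rule LINT_supported(1)[where a = "-A" and b = A])
  show "f absolutely_integrable_on {-A..A}"
    by (intro absolutely_integrable_continuous_real continuous_on_subset[OF assms(1)]) auto
  show "f x = 0" if "x \<notin> {-A..A}" for x using assms(2)[of x] that by auto
qed

context invaded_potential
begin

text \<open>The remainder is quadratic in \<open>r x\<close> with a constant that does not depend on \<open>x\<close>: the weight
  \<open>exp (c x)\<close> cancels against the square of \<open>exp (- c x / 2)\<close>.\<close>
lemma pot_first_variation:
  assumes K: "\<And>x y. x \<in> cball e R \<Longrightarrow> y \<in> cball e R \<Longrightarrow> \<bar>V y - V x - grad V x \<bullet> (y - x)\<bar> \<le> K * (norm (y - x))\<^sup>2"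
    and in1: "profile e c v x \<in> cball e R" and in2: "profile e c (\<lambda>x. v x + r x *\<^sub>R b) x \<in> cball e R"
  shows "\<bar>pot c (\<lambda>x. v x + r x *\<^sub>R b) x - pot c v x
      - r x * ((exp ((c/2) * x) *\<^sub>R grad V (profile e c v x) + (c\<^sup>2/4) *\<^sub>R v x) \<bullet> b)\<bar>
    \<le> (K + c\<^sup>2/8) * (norm b)\<^sup>2 * (r x)\<^sup>2"
proof -
  define p where "p = profile e c v x"
  define h where "h = (exp (- (c/2) * x) * r x) *\<^sub>R b"
  have pt: "profile e c (\<lambda>x. v x + r x *\<^sub>R b) x = p + h"
    by (simp add: p_def h_def profile_def scaleR_add_right)
  have E1: "exp (c * x) * exp (- (c/2) * x) = exp ((c/2) * x)" by (simp flip: exp_add)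
  have E2: "exp (c * x) * (exp (- (c/2) * x))\<^sup>2 = 1" by (simp add: power2_eq_square flip: exp_add)
  define T where "T = V (p + h) - V p - grad V p \<bullet> h"
  have T: "\<bar>T\<bar> \<le> K * (norm h)\<^sup>2"
    using K[of p "p + h"] in1 in2 unfolding pt by (simp add: T_def p_def)
  have hh: "exp (c * x) * (norm h)\<^sup>2 = (norm b)\<^sup>2 * (r x)\<^sup>2"
  proof -
    have "exp (c * x) * (norm h)\<^sup>2 = (exp (c * x) * (exp (- (c/2) * x))\<^sup>2) * ((r x)\<^sup>2 * (norm b)\<^sup>2)"
      by (simp add: h_def power_mult_distrib mult_ac)
    then show ?thesis unfolding E2 by (simp add: mult.commute)
  qed
  have gh: "exp (c * x) * (grad V p \<bullet> h) = r x * (exp ((c/2) * x) * (grad V p \<bullet> b))"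
  proof -
    have "exp (c * x) * (grad V p \<bullet> h) = (exp (c * x) * exp (- (c/2) * x)) * (r x * (grad V p \<bullet> b))"
      by (simp add: h_def mult_ac)
    then show ?thesis unfolding E1 by (simp add: mult_ac)
  qed
  have nv: "(norm (v x + r x *\<^sub>R b))\<^sup>2 = (norm (v x))\<^sup>2 + 2 * r x * (v x \<bullet> b) + (r x)\<^sup>2 * (norm b)\<^sup>2"
    unfolding power2_norm_eq_inner
    by (simp add: inner_add_left inner_add_right inner_commute power2_eq_square algebra_simps)
  have "V (p + h) = T + V p + grad V p \<bullet> h" by (simp add: T_def)
  then have "pot c (\<lambda>x. v x + r x *\<^sub>R b) x - pot c v x
      - r x * ((exp ((c/2) * x) *\<^sub>R grad V p + (c\<^sup>2/4) *\<^sub>R v x) \<bullet> b) = exp (c * x) * T + c\<^sup>2/8 * ((norm b)\<^sup>2 * (r x)\<^sup>2)"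
    using gh unfolding pot_def pt nv p_def[symmetric] by (simp add: distrib_left inner_add_left field_simps)
  also have "\<bar>\<dots>\<bar> \<le> exp (c * x) * \<bar>T\<bar> + c\<^sup>2/8 * ((norm b)\<^sup>2 * (r x)\<^sup>2)"
    by (rule order_trans[OF abs_triangle_ineq]) (simp add: abs_mult)
  also have "exp (c * x) * \<bar>T\<bar> \<le> K * ((norm b)\<^sup>2 * (r x)\<^sup>2)"
    using mult_left_mono[OF T, of "exp (c * x)"] unfolding hh[symmetric] by (simp add: mult_ac)
  finally show ?thesis by (simp add: p_def algebra_simps)
qed

text \<open>Since the energy of \<open>v + t \<eta> b\<close> is nonnegative and that of \<open>v\<close> is at most 0, the coefficient of \<open>t\<close>
  in its expansion vanishes. This says that \<open>g\<close> has a continuous weak derivative, hence a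
  continuously differentiable representative.\<close>
lemma euler_lagrange:
  assumes v: "sobolev v g" and int: "integrable lebesgue (dens c v g)" and le: "(LINT x|lebesgue. dens c v g x) \<le> 0"
    and min: "\<And>v' g'. \<not> negative_energy c v' g'"
  obtains \<gamma> where "\<And>x. (v has_vector_derivative \<gamma> x) (at x)"
    "\<And>x. (\<gamma> has_vector_derivative (exp ((c/2) * x) *\<^sub>R grad V (profile e c v x) + (c\<^sup>2/4) *\<^sub>R v x)) (at x)"
proof -
  have L: "L2 v" "L2 g" "abs_cont v g" using v by (auto simp: sobolev_def)
  note v_cont = abs_cont_continuous[OF L(3), of UNIV]
  have g_li: "loc_integrable g" using L(3) by (simp add: abs_cont_def)
  define f where "f x = exp ((c/2) * x) *\<^sub>R grad V (profile e c v x) + (c\<^sup>2/4) *\<^sub>R v x" for x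
  have pr_cont: "continuous_on UNIV (profile e c v)"
    unfolding profile_def[abs_def] by (intro continuous_intros v_cont)
  have f_cont: "continuous_on UNIV f"
    unfolding f_def by (intro continuous_intros v_cont continuous_on_compose2[OF grad_continuous[of UNIV] pr_cont]) auto
  have p_int: "integrable lebesgue (pot c v)" using dens_integral(1)[OF v] int by blast
  have weak: "has_weak_derivative g f"
    unfolding has_weak_derivative_def
  proof (intro allI impI)
    fix \<eta> :: "real \<Rightarrow> real" assume \<eta>: "test_function \<eta>"
    define \<eta>' where "\<eta>' = deriv \<eta>"
    obtain A where A: "A > 0" "\<And>x. (\<eta> has_real_derivative \<eta>' x) (at x)" "continuous_on UNIV \<eta>'"
      "\<And>x. \<bar>x\<bar> \<ge> A \<Longrightarrow> \<eta> x = 0" "\<And>x. \<bar>x\<bar> \<ge> A \<Longrightarrow> \<eta>' x = 0"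
      unfolding \<eta>'_def by (rule test_functionE[OF \<eta>]) blast
    have \<eta>_ac: "abs_cont \<eta> \<eta>'"
      using A(2,3) by (intro abs_cont_C1) (auto simp: has_real_derivative_iff_has_vector_derivative)
    note \<eta>_cont = abs_cont_continuous[OF \<eta>_ac, of UNIV]
    have comp: "(LINT x|lebesgue. \<eta>' x * (g x \<bullet> b)) + (LINT x|lebesgue. \<eta> x * (f x \<bullet> b)) = 0" for b :: "real ^ 'n"
    proof -
      have "continuous_on {-A..A} (\<lambda>x. norm (profile e c v x - e) + exp (- (c/2) * x) * \<bar>\<eta> x\<bar> * norm b)"
        by (intro continuous_intros continuous_on_subset[OF pr_cont] continuous_on_subset[OF \<eta>_cont]) auto
      then have "bounded ((\<lambda>x. norm (profile e c v x - e) + exp (- (c/2) * x) * \<bar>\<eta> x\<bar> * norm b) ` {-A..A})"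
        by (intro compact_imp_bounded compact_continuous_image) auto
      then obtain R where R0: "\<forall>x\<in>{-A..A}. \<bar>norm (profile e c v x - e) + exp (- (c/2) * x) * \<bar>\<eta> x\<bar> * norm b\<bar> \<le> R"
        unfolding bounded_iff by auto
      have R: "norm (profile e c v x - e) + exp (- (c/2) * x) * \<bar>\<eta> x\<bar> * norm b \<le> R" if "x \<in> {-A..A}" for x
        using R0 that by (meson abs_ge_self order_trans)
      obtain K where K: "K > 0"
        "\<And>x y. x \<in> cball e R \<Longrightarrow> y \<in> cball e R \<Longrightarrow> \<bar>V y - V x - grad V x \<bullet> (y - x)\<bar> \<le> K * (norm (y - x))\<^sup>2"
        by (rule V_taylor[of R]) blast
      define C where "C = (K + c\<^sup>2/8) * (norm b)\<^sup>2"
      have C0: "C \<ge> 0" using K(1) by (simp add: C_def)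
      define w where "w t x = v x + (t * \<eta> x) *\<^sub>R b" for t x
      define h where "h t x = g x + (t * \<eta>' x) *\<^sub>R b" for t x
      define I1 where "I1 = (LINT x|lebesgue. \<eta> x * (f x \<bullet> b))"
      define I2 where "I2 = (LINT x|lebesgue. (\<eta> x)\<^sup>2)"
      define I3 where "I3 = (LINT x|lebesgue. \<eta>' x * (g x \<bullet> b))"
      define I4 where "I4 = (LINT x|lebesgue. (norm (\<eta>' x *\<^sub>R b))\<^sup>2)"
      have i1: "integrable lebesgue (\<lambda>x. \<eta> x * (f x \<bullet> b))"
        by (rule integrable_compact_support[where A = A]) (use A(4) in \<open>auto intro!: continuous_intros \<eta>_cont f_cont\<close>)
      have i2: "integrable lebesgue (\<lambda>x. (\<eta> x)\<^sup>2)"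
        by (rule integrable_compact_support[where A = A]) (use A(4) in \<open>auto intro!: continuous_intros \<eta>_cont\<close>)
      have L\<eta>: "L2 (\<lambda>x. \<eta> x *\<^sub>R b)"
        by (rule L2_compact_support[where A = A]) (use A(4) in \<open>auto intro!: continuous_intros \<eta>_cont\<close>)
      have L\<eta>': "L2 (\<lambda>x. \<eta>' x *\<^sub>R b)"
        by (rule L2_compact_support[where A = A]) (use A(5) in \<open>auto intro!: continuous_intros A(3)\<close>)
      have i3: "integrable lebesgue (\<lambda>x. \<eta>' x * (g x \<bullet> b))" using L2_inner[OF L(2) L\<eta>'] by simp
      have i4: "integrable lebesgue (\<lambda>x. (norm (\<eta>' x *\<^sub>R b))\<^sup>2)" by (rule L2D(2)[OF L\<eta>'])
      have \<eta>b_ac: "abs_cont (\<lambda>x. \<eta> x *\<^sub>R b) (\<lambda>x. \<eta>' x *\<^sub>R b)"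
        using abs_cont_product[OF bounded_bilinear_scaleR \<eta>_ac abs_cont_const[of b]] by simp
      have sob: "sobolev (w t) (h t)" for t
        using abs_cont_lincomb[OF L(3) \<eta>b_ac, of 1 t] L2_add[OF L(1) L2_scaleR[OF L\<eta>, of t]] L2_add[OF L(2) L2_scaleR[OF L\<eta>', of t]]
        by (simp add: sobolev_def w_def[abs_def] h_def[abs_def])
      have var: "\<bar>pot c (w t) x - pot c v x - t * (\<eta> x * (f x \<bullet> b))\<bar> \<le> t\<^sup>2 * (C * (\<eta> x)\<^sup>2)" if t: "\<bar>t\<bar> \<le> 1" for t x
      proof (cases "\<bar>x\<bar> \<ge> A")
        case True
        then show ?thesis using A(4)[OF True] by (simp add: w_def pot_def profile_def)
      next
        case False
        then have x: "x \<in> {-A..A}" by auto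
        have n0: "exp (- (c/2) * x) * \<bar>\<eta> x\<bar> * norm b \<ge> 0" by simp
        have "norm (profile e c (w t) x - e) \<le> R"
        proof -
          have "profile e c (w t) x - e = (profile e c v x - e) + (exp (- (c/2) * x) * (t * \<eta> x)) *\<^sub>R b"
            by (simp add: profile_def w_def scaleR_add_right)
          also have "norm \<dots> \<le> norm (profile e c v x - e) + norm ((exp (- (c/2) * x) * (t * \<eta> x)) *\<^sub>R b)" by (rule norm_triangle_ineq)
          also have "norm ((exp (- (c/2) * x) * (t * \<eta> x)) *\<^sub>R b) = \<bar>t\<bar> * (exp (- (c/2) * x) * \<bar>\<eta> x\<bar> * norm b)"
            by (simp add: abs_mult)
          also have "\<bar>t\<bar> * (exp (- (c/2) * x) * \<bar>\<eta> x\<bar> * norm b) \<le> 1 * (exp (- (c/2) * x) * \<bar>\<eta> x\<bar> * norm b)"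
            using t n0 by (intro mult_right_mono)
          finally show ?thesis using R[OF x] by simp
        qed
        then have in2: "profile e c (\<lambda>x. v x + (t * \<eta> x) *\<^sub>R b) x \<in> cball e R"
          by (simp add: w_def[abs_def] dist_norm norm_minus_commute)
        have "norm (profile e c v x - e) \<le> R" using R[OF x] n0 by argo
        then have in1: "profile e c v x \<in> cball e R" by (simp add: dist_norm norm_minus_commute)
        show ?thesis
          using pot_first_variation[OF K(2) in1 in2] by (simp add: w_def[abs_def] f_def C_def power_mult_distrib mult_ac)
      qed
      have w_m: "w t \<in> borel_measurable lebesgue" for t using sob[of t] by (simp add: sobolev_def L2_def)
      have pw_int: "integrable lebesgue (pot c (w t))" if t: "\<bar>t\<bar> \<le> 1" for t
      proof (rule Bochner_Integration.integrable_bound[OF _ pot_measurable[OF w_m]])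
        show "integrable lebesgue (\<lambda>x. \<bar>pot c v x\<bar> + \<bar>t * (\<eta> x * (f x \<bullet> b))\<bar> + t\<^sup>2 * (C * (\<eta> x)\<^sup>2))"
          using p_int i1 i2 by (intro Bochner_Integration.integrable_add integrable_abs integrable_mult_right) auto
        show "AE x in lebesgue. norm (pot c (w t) x) \<le> norm (\<bar>pot c v x\<bar> + \<bar>t * (\<eta> x * (f x \<bullet> b))\<bar> + t\<^sup>2 * (C * (\<eta> x)\<^sup>2))"
        proof (intro AE_I2)
          fix x
          have "\<bar>pot c (w t) x\<bar> \<le> \<bar>pot c v x\<bar> + \<bar>t * (\<eta> x * (f x \<bullet> b))\<bar> + t\<^sup>2 * (C * (\<eta> x)\<^sup>2)"
            using var[OF t, of x] by argo
          then show "norm (pot c (w t) x) \<le> norm (\<bar>pot c v x\<bar> + \<bar>t * (\<eta> x * (f x \<bullet> b))\<bar> + t\<^sup>2 * (C * (\<eta> x)\<^sup>2))" by simp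
        qed
      qed
      have pw_le: "(LINT x|lebesgue. pot c (w t) x) \<le> (LINT x|lebesgue. pot c v x) + t * I1 + t\<^sup>2 * (C * I2)" if t: "\<bar>t\<bar> \<le> 1" for t
      proof -
        have j: "integrable lebesgue (\<lambda>x. t * (\<eta> x * (f x \<bullet> b)))" "integrable lebesgue (\<lambda>x. t\<^sup>2 * (C * (\<eta> x)\<^sup>2))"
          using i1 i2 by auto
        have "(LINT x|lebesgue. pot c (w t) x) \<le> (LINT x|lebesgue. pot c v x + t * (\<eta> x * (f x \<bullet> b)) + t\<^sup>2 * (C * (\<eta> x)\<^sup>2))"
        proof (rule integral_mono[OF pw_int[OF t]])
          show "integrable lebesgue (\<lambda>x. pot c v x + t * (\<eta> x * (f x \<bullet> b)) + t\<^sup>2 * (C * (\<eta> x)\<^sup>2))"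
            by (intro Bochner_Integration.integrable_add p_int j)
          show "pot c (w t) x \<le> pot c v x + t * (\<eta> x * (f x \<bullet> b)) + t\<^sup>2 * (C * (\<eta> x)\<^sup>2)" for x
            using var[OF t, of x] by argo
        qed
        also have "\<dots> = (LINT x|lebesgue. pot c v x) + t * I1 + t\<^sup>2 * (C * I2)"
          unfolding I1_def I2_def
          by (simp only: Bochner_Integration.integral_add[OF Bochner_Integration.integrable_add[OF p_int j(1)] j(2)]
              Bochner_Integration.integral_add[OF p_int j(1)] integral_mult_right_zero)
        finally show ?thesis .
      qed
      have gw: "sq_int (h t) = sq_int g + 2 * t * I3 + t\<^sup>2 * I4" for t
      proof -
        have pt: "(norm (h t x))\<^sup>2 = (norm (g x))\<^sup>2 + (2 * t) * (\<eta>' x * (g x \<bullet> b)) + t\<^sup>2 * (norm (\<eta>' x *\<^sub>R b))\<^sup>2" for x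
          unfolding h_def power2_norm_eq_inner
          by (simp add: inner_add_left inner_add_right inner_commute power2_eq_square algebra_simps)
        have j: "integrable lebesgue (\<lambda>x. (2 * t) * (\<eta>' x * (g x \<bullet> b)))" "integrable lebesgue (\<lambda>x. t\<^sup>2 * (norm (\<eta>' x *\<^sub>R b))\<^sup>2)"
          using i3 i4 by (intro integrable_mult_right; simp)+
        show ?thesis unfolding pt I3_def I4_def
          by (simp only: Bochner_Integration.integral_add[OF Bochner_Integration.integrable_add[OF L2D(2)[OF L(2)] j(1)] j(2)]
              Bochner_Integration.integral_add[OF L2D(2)[OF L(2)] j(1)] integral_mult_right_zero)
      qed
      have "0 \<le> t * (I3 + I1) + t\<^sup>2 * (I4 / 2 + C * I2)" if t: "\<bar>t\<bar> \<le> 1" for t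
      proof -
        have "integrable lebesgue (dens c (w t) (h t))" using dens_integral(1)[OF sob] pw_int[OF t] by blast
        then have "(LINT x|lebesgue. dens c (w t) (h t) x) \<ge> 0"
          using min[of "w t" "h t"] sob[of t] by (simp add: negative_energy_def not_less)
        then have "0 \<le> sq_int (h t) / 2 + (LINT x|lebesgue. pot c (w t) x)"
          using dens_integral(2)[OF sob pw_int[OF t]] by simp
        moreover have "sq_int g / 2 + (LINT x|lebesgue. pot c v x) \<le> 0"
          using dens_integral(2)[OF v p_int] le by simp
        moreover have "t * (I3 + I1) + t\<^sup>2 * (I4 / 2 + C * I2) = (2 * t * I3 + t\<^sup>2 * I4) / 2 + (t * I1 + t\<^sup>2 * (C * I2))"
          by (simp add: field_simps)
        ultimately show ?thesis using pw_le[OF t] gw[of t] by argo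
      qed
      then have "I3 + I1 = 0" by (rule linear_term_zero)
      then show ?thesis by (simp add: I1_def I3_def)
    qed
    have ig: "integrable lebesgue (\<lambda>x. \<eta>' x *\<^sub>R g x)"
    proof (rule LINT_supported(1)[where a = "-A" and b = A])
      show "(\<lambda>x. \<eta>' x *\<^sub>R g x) absolutely_integrable_on {-A..A}"
        by (rule abs_integrable_bilinear[OF bounded_bilinear_scaleR continuous_on_subset[OF A(3)]])
          (use g_li in \<open>auto simp: loc_integrable_def\<close>)
      show "\<eta>' x *\<^sub>R g x = 0" if "x \<notin> {-A..A}" for x using A(5)[of x] that by auto
    qed
    have "continuous_on UNIV (\<lambda>x. \<eta> x *\<^sub>R f x)" by (intro continuous_intros \<eta>_cont f_cont)
    then have if': "integrable lebesgue (\<lambda>x. \<eta> x *\<^sub>R f x)"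
      by (rule integrable_compact_support[where A = A]) (simp add: A(4))
    have "(LINT x|lebesgue. \<eta>' x *\<^sub>R g x) + (LINT x|lebesgue. \<eta> x *\<^sub>R f x) = 0"
    proof (rule euclidean_eqI)
      fix b :: "real ^ 'n"
      have "(LINT x|lebesgue. \<eta>' x *\<^sub>R g x) \<bullet> b = (LINT x|lebesgue. \<eta>' x * (g x \<bullet> b))"
        using integral_inner_left[of b lebesgue "\<lambda>x. \<eta>' x *\<^sub>R g x"] ig by simp
      moreover have "(LINT x|lebesgue. \<eta> x *\<^sub>R f x) \<bullet> b = (LINT x|lebesgue. \<eta> x * (f x \<bullet> b))"
        using integral_inner_left[of b lebesgue "\<lambda>x. \<eta> x *\<^sub>R f x"] if' by simp
      ultimately show "((LINT x|lebesgue. \<eta>' x *\<^sub>R g x) + (LINT x|lebesgue. \<eta> x *\<^sub>R f x)) \<bullet> b = 0 \<bullet> b"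
        using comp[of b] by (simp add: inner_add_left)
    qed
    then show "(LINT x|lebesgue. deriv \<eta> x *\<^sub>R g x) = - (LINT x|lebesgue. \<eta> x *\<^sub>R f x)"
      by (simp add: \<eta>'_def add_eq_0_iff2)
  qed
  obtain \<gamma> where \<gamma>: "abs_cont \<gamma> f" "AE x in lebesgue. g x = \<gamma> x"
    by (rule weak_derivative_imp_abs_cont[OF g_li loc_integrable_continuous[OF f_cont] weak])
  have \<gamma>_cont: "continuous_on UNIV \<gamma>" by (rule abs_cont_continuous[OF \<gamma>(1)])
  have "abs_cont v \<gamma>" by (rule abs_cont_cong_AE[OF L(3) \<gamma>(2) loc_integrable_continuous[OF \<gamma>_cont]])
  then have "(v has_vector_derivative \<gamma> x) (at x)" for x by (rule abs_cont_vector_derivative[OF _ \<gamma>_cont])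
  moreover have "(\<gamma> has_vector_derivative f x) (at x)" for x by (rule abs_cont_vector_derivative[OF \<gamma>(1) f_cont])
  ultimately show ?thesis using that unfolding f_def by blast
qed

end

section \<open>The travelling wave equation\<close>

lemma lipschitz_of_derivative:
  fixes f :: "real \<Rightarrow> 'a::euclidean_space"
  assumes f: "\<And>x. (f has_vector_derivative f' x) (at x)" and B: "\<And>x. x \<in> {a..b} \<Longrightarrow> norm (f' x) \<le> B" and ab: "a \<le> b"
  shows "norm (f b - f a) \<le> B * (b - a)"
proof (cases "a = b")
  case False
  then have "a < b" using ab by simp
  moreover have "continuous_on {a..b} f"
    by (meson f continuous_at_imp_continuous_on has_vector_derivative_continuous)
  ultimately obtain x where x: "x \<in> {a<..<b}" "norm (f b - f a) \<le> norm ((b - a) *\<^sub>R f' x)"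
    using mvt_general[of a b f "\<lambda>x h. h *\<^sub>R f' x"] f unfolding has_vector_derivative_def by blast
  have "norm ((b - a) *\<^sub>R f' x) \<le> (b - a) * B" using ab B[of x] x(1) by (simp add: mult_left_mono)
  then show ?thesis using x(2) by (simp add: mult.commute)
qed simp

lemma lipschitz_uniformly_continuous:
  fixes f :: "real \<Rightarrow> 'a::euclidean_space"
  assumes "\<And>x y. x \<le> y \<Longrightarrow> norm (f y - f x) \<le> B * (y - x)"
  shows "uniformly_continuous_on UNIV f"
  unfolding uniformly_continuous_on_def
proof (intro allI impI)
  fix \<epsilon> :: real assume \<epsilon>: "\<epsilon> > 0"
  have *: "dist (f y) (f x) \<le> (\<bar>B\<bar> + 1) * dist y x" for x y
  proof -
    have le: "norm (f y - f x) \<le> (\<bar>B\<bar> + 1) * (y - x)" if "x \<le> y" for x y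
      by (rule order_trans[OF assms[OF that] mult_right_mono]) (use that in auto)
    show ?thesis using le[of x y] le[of y x] by (cases "x \<le> y") (auto simp: dist_norm norm_minus_commute)
  qed
  show "\<exists>d>0. \<forall>x\<in>UNIV. \<forall>x'\<in>UNIV. dist x' x < d \<longrightarrow> dist (f x') (f x) < \<epsilon>"
  proof (intro exI[of _ "\<epsilon> / (\<bar>B\<bar> + 1)"] conjI ballI impI)
    show "\<epsilon> / (\<bar>B\<bar> + 1) > 0" using \<epsilon> by simp
    fix x y :: real assume "dist y x < \<epsilon> / (\<bar>B\<bar> + 1)"
    then have "(\<bar>B\<bar> + 1) * dist y x < \<epsilon>" by (simp add: pos_less_divide_eq mult.commute add_nonneg_pos)
    then show "dist (f y) (f x) < \<epsilon>" using *[of y x] by simp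
  qed
qed

text \<open>Over a step \<open>s\<close> on which \<open>f'\<close> hardly varies, \<open>f (x + s) - f x\<close> is close to \<open>s f' x\<close>.\<close>
lemma derivative_tendsto_0_at_bot:
  fixes f :: "real \<Rightarrow> 'a::euclidean_space"
  assumes f: "\<And>x. (f has_vector_derivative f' x) (at x)" and uc: "uniformly_continuous_on UNIV f'" and lim: "(f \<longlongrightarrow> 0) at_bot"
  shows "(f' \<longlongrightarrow> 0) at_bot"
proof (rule tendstoI)
  fix \<epsilon> :: real assume \<epsilon>: "\<epsilon> > 0"
  then have "\<epsilon> / 4 > 0" by simp
  then obtain \<delta> where \<delta>: "\<delta> > 0" "\<And>x y. dist y x < \<delta> \<Longrightarrow> dist (f' y) (f' x) < \<epsilon> / 4"
    using uc unfolding uniformly_continuous_on_def by (metis UNIV_I)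
  define s where "s = \<delta> / 2"
  have s: "0 < s" "s < \<delta>" using \<delta>(1) by (auto simp: s_def)
  have "eventually (\<lambda>x. dist (f x) 0 < s * \<epsilon> / 4) at_bot" using \<epsilon> s by (intro tendstoD[OF lim]) simp
  then obtain X where X: "\<And>x. x \<le> X \<Longrightarrow> norm (f x) < s * \<epsilon> / 4" unfolding eventually_at_bot_linorder by auto
  have "dist (f' x) 0 < \<epsilon>" if x: "x \<le> X - s" for x
  proof -
    have "norm ((\<lambda>y. f y - (y - x) *\<^sub>R f' x) (x + s) - (\<lambda>y. f y - (y - x) *\<^sub>R f' x) x) \<le> \<epsilon> / 4 * (x + s - x)"
    proof (rule lipschitz_of_derivative[where f' = "\<lambda>y. f' y - f' x"])
      show "((\<lambda>y. f y - (y - x) *\<^sub>R f' x) has_vector_derivative f' y - f' x) (at y)" for y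
      proof -
        have "((\<lambda>y. (y - x) *\<^sub>R f' x) has_vector_derivative f' x) (at y)"
          unfolding has_vector_derivative_def by (auto intro!: derivative_eq_intros)
        from has_vector_derivative_diff[OF f this] show ?thesis .
      qed
      fix y assume "y \<in> {x..x+s}"
      then have "dist y x < \<delta>" using s by (auto simp: dist_real_def)
      then show "norm (f' y - f' x) \<le> \<epsilon> / 4" using \<delta>(2) by (simp add: dist_norm less_imp_le)
    qed (use s in simp)
    then have "norm ((f (x + s) - f x) - s *\<^sub>R f' x) \<le> s * \<epsilon> / 4" by (simp add: algebra_simps)
    moreover have "norm (f (x + s)) < s * \<epsilon> / 4" "norm (f x) < s * \<epsilon> / 4" using X[of "x + s"] X[of x] x s by auto
    moreover have "norm (s *\<^sub>R f' x) \<le> norm (f (x + s)) + norm (f x) + norm ((f (x + s) - f x) - s *\<^sub>R f' x)"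
    proof -
      have "s *\<^sub>R f' x = (f (x + s) - f x) - ((f (x + s) - f x) - s *\<^sub>R f' x)" by simp
      then have "norm (s *\<^sub>R f' x) \<le> norm (f (x + s) - f x) + norm ((f (x + s) - f x) - s *\<^sub>R f' x)" by (metis norm_triangle_ineq4)
      also have "norm (f (x + s) - f x) \<le> norm (f (x + s)) + norm (f x)" by (rule norm_triangle_ineq4)
      finally show ?thesis by simp
    qed
    ultimately have "norm (s *\<^sub>R f' x) < 3 * (s * \<epsilon> / 4)" by argo
    moreover have "norm (s *\<^sub>R f' x) = s * norm (f' x)" using s by simp
    moreover have "3 * (s * \<epsilon> / 4) = s * (3 * \<epsilon> / 4)" by simp
    ultimately have "s * norm (f' x) < s * (3 * \<epsilon> / 4)" by argo
    then have "norm (f' x) < 3 * \<epsilon> / 4" using s by simp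
    then show ?thesis using \<epsilon> by simp
  qed
  then show "eventually (\<lambda>x. dist (f' x) 0 < \<epsilon>) at_bot" unfolding eventually_at_bot_linorder by blast
qed

context invaded_potential
begin

definition wave :: "real \<Rightarrow> (real \<Rightarrow> real ^ 'n) \<Rightarrow> (real \<Rightarrow> real ^ 'n) \<Rightarrow> bool" where
  "wave c \<phi> \<psi> \<longleftrightarrow> (\<forall>x. (\<phi> has_vector_derivative \<psi> x) (at x) \<and>
      (\<psi> has_vector_derivative (- c *\<^sub>R \<psi> x + grad V (\<phi> x))) (at x))"

lemma waveD:
  assumes "wave c \<phi> \<psi>"
  shows "(\<phi> has_vector_derivative \<psi> x) (at x)" "(\<psi> has_vector_derivative (- c *\<^sub>R \<psi> x + grad V (\<phi> x))) (at x)"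
    "continuous_on S \<phi>" "continuous_on S \<psi>"
proof -
  show 1: "(\<phi> has_vector_derivative \<psi> x) (at x)" "(\<psi> has_vector_derivative (- c *\<^sub>R \<psi> x + grad V (\<phi> x))) (at x)" for x
    using assms by (auto simp: wave_def)
  show "continuous_on S \<phi>" "continuous_on S \<psi>"
    using has_vector_derivative_continuous[OF 1(1)] has_vector_derivative_continuous[OF 1(2)]
    by (simp_all add: continuous_at_imp_continuous_on)
qed

lemma wave_lyapunov:
  assumes w: "wave c \<phi> \<psi>"
  shows "((\<lambda>x. (\<psi> x \<bullet> \<psi> x) / 2 - V (\<phi> x)) has_real_derivative - c * (norm (\<psi> x))\<^sup>2) (at x)"
proof -
  have "(\<phi> has_derivative (\<lambda>h. h *\<^sub>R \<psi> x)) (at x)" using waveD(1)[OF w] by (simp add: has_vector_derivative_def)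
  from has_derivative_compose[OF this V_derivative]
  have dV: "((\<lambda>x. V (\<phi> x)) has_real_derivative grad V (\<phi> x) \<bullet> \<psi> x) (at x)"
    unfolding has_field_derivative_def by (rule has_derivative_eq_rhs) auto
  have d\<psi>: "((\<lambda>x. \<psi> x \<bullet> \<psi> x) has_real_derivative 2 * (\<psi> x \<bullet> (- c *\<^sub>R \<psi> x + grad V (\<phi> x)))) (at x)"
    unfolding has_real_derivative_iff_has_vector_derivative
    by (rule has_vector_derivative_eq_rhs[OF bounded_bilinear.has_vector_derivative[OF bounded_bilinear_inner waveD(2)[OF w] waveD(2)[OF w]]])
      (simp add: inner_commute)
  show ?thesis
    by (rule DERIV_cong[OF DERIV_diff[OF DERIV_cdivide[OF d\<psi>] dV]])
      (simp add: inner_add_right inner_diff_right inner_commute power2_norm_eq_inner diff_divide_distrib)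
qed

text \<open>In each coordinate some time in the window has \<open>\<bar>\<psi>\<bar> \<le> 2 a\<close> by the mean value theorem, and
  \<open>\<psi> + c \<phi>\<close>, whose derivative is \<open>grad V \<phi>\<close>, changes by at most \<open>b\<close> from there. All bounds and decay
  rates of \<open>\<psi>\<close> follow from those of \<open>\<phi>\<close> by this lemma.\<close>
lemma wave_derivative_window:
  assumes w: "wave c \<phi> \<psi>" and c: "c \<ge> 0"
    and a: "\<And>s. s \<in> {t-1..t} \<Longrightarrow> norm (\<phi> s - p) \<le> a" and b: "\<And>s. s \<in> {t-1..t} \<Longrightarrow> norm (grad V (\<phi> s)) \<le> b"
  shows "norm (\<psi> t) \<le> real DIM(real ^ 'n) * (2 * a * (1 + c) + b)"
proof -
  have b0: "b \<ge> 0" by (rule order_trans[OF norm_ge_zero b[of t]]) simp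
  have osc: "norm (\<phi> s - \<phi> r) \<le> 2 * a" if "s \<in> {t-1..t}" "r \<in> {t-1..t}" for s r
    using norm_triangle_ineq4[of "\<phi> s - p" "\<phi> r - p"] a[OF that(1)] a[OF that(2)] by simp
  have comp: "\<bar>\<psi> t \<bullet> i\<bar> \<le> 2 * a * (1 + c) + b" if i: "i \<in> Basis" for i
  proof -
    have d: "((\<lambda>x. \<phi> x \<bullet> i) has_real_derivative \<psi> x \<bullet> i) (at x)" for x
      unfolding has_real_derivative_iff_has_vector_derivative
      using bounded_linear.has_vector_derivative[OF bounded_linear_inner_left waveD(1)[OF w]] .
    obtain z where z: "t - 1 < z" "z < t" "\<phi> t \<bullet> i - \<phi> (t - 1) \<bullet> i = (t - (t - 1)) * (\<psi> z \<bullet> i)"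
      using MVT2[of "t - 1" t "\<lambda>x. \<phi> x \<bullet> i" "\<lambda>x. \<psi> x \<bullet> i"] d by auto
    have "\<bar>\<psi> z \<bullet> i\<bar> = \<bar>(\<phi> t - \<phi> (t - 1)) \<bullet> i\<bar>" using z(3) by (simp add: inner_diff_left)
    also have "\<dots> \<le> norm (\<phi> t - \<phi> (t - 1))" by (rule Basis_le_norm[OF i])
    also have "\<dots> \<le> 2 * a" by (rule osc) auto
    finally have 1: "\<bar>\<psi> z \<bullet> i\<bar> \<le> 2 * a" .
    have "norm ((\<lambda>x. \<psi> x + c *\<^sub>R \<phi> x) t - (\<lambda>x. \<psi> x + c *\<^sub>R \<phi> x) z) \<le> b * (t - z)"
    proof (rule lipschitz_of_derivative[where f' = "\<lambda>x. grad V (\<phi> x)"])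
      show "((\<lambda>x. \<psi> x + c *\<^sub>R \<phi> x) has_vector_derivative grad V (\<phi> x)) (at x)" for x
        using has_vector_derivative_add[OF waveD(2)[OF w] bounded_linear.has_vector_derivative[OF bounded_linear_scaleR_right waveD(1)[OF w], of c x]]
        by simp
    qed (use z b in auto)
    also have "\<dots> \<le> b * 1" using z b0 by (intro mult_left_mono) auto
    finally have 2: "norm ((\<psi> t - \<psi> z) + c *\<^sub>R (\<phi> t - \<phi> z)) \<le> b" by (simp add: algebra_simps)
    have "\<bar>(\<psi> t - \<psi> z) \<bullet> i\<bar> \<le> norm (\<psi> t - \<psi> z)" by (rule Basis_le_norm[OF i])
    also have "\<dots> \<le> norm ((\<psi> t - \<psi> z) + c *\<^sub>R (\<phi> t - \<phi> z)) + norm (c *\<^sub>R (\<phi> t - \<phi> z))"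
      using norm_triangle_ineq4[of "(\<psi> t - \<psi> z) + c *\<^sub>R (\<phi> t - \<phi> z)" "c *\<^sub>R (\<phi> t - \<phi> z)"] by simp
    also have "norm (c *\<^sub>R (\<phi> t - \<phi> z)) \<le> c * (2 * a)" using osc[of t z] z c by (simp add: mult_left_mono)
    finally have 3: "\<bar>(\<psi> t - \<psi> z) \<bullet> i\<bar> \<le> b + c * (2 * a)" using 2 by simp
    have "\<bar>\<psi> t \<bullet> i\<bar> \<le> \<bar>\<psi> z \<bullet> i\<bar> + \<bar>(\<psi> t - \<psi> z) \<bullet> i\<bar>" by (simp add: inner_diff_left)
    also have "\<dots> \<le> 2 * a + (b + c * (2 * a))" using 1 3 by (rule add_mono)
    finally show ?thesis by (simp add: algebra_simps)
  qed
  have "norm (\<psi> t) \<le> (\<Sum>i\<in>Basis. \<bar>\<psi> t \<bullet> i\<bar>)" by (rule norm_le_l1)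
  also have "\<dots> \<le> (\<Sum>i\<in>(Basis :: (real ^ 'n) set). 2 * a * (1 + c) + b)" by (intro sum_mono comp)
  finally show ?thesis by simp
qed

lemma grad_linear_bound:
  obtains K where "K > 0" "\<And>u. u \<in> cball e R \<Longrightarrow> norm (grad V u) \<le> K * norm (u - e)"
proof (cases "R \<ge> 0")
  case True
  obtain K where K: "K > 0" "\<And>x y. x \<in> cball e R \<Longrightarrow> y \<in> cball e R \<Longrightarrow> norm (grad V x - grad V y) \<le> K * norm (x - y)"
    by (rule grad_lipschitz[of R]) blast
  have "norm (grad V u) \<le> K * norm (u - e)" if "u \<in> cball e R" for u
    using K(2)[OF that, of e] True by (simp add: grad_e)
  then show ?thesis using that K(1) by blast
next
  case False
  then show ?thesis using that[of 1] by auto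
qed

lemma wave_derivative_bounded:
  assumes w: "wave c \<phi> \<psi>" and c: "c \<ge> 0" and R: "\<And>x. norm (\<phi> x - e) \<le> R"
  obtains B where "\<And>x. norm (\<psi> x) \<le> B" "\<And>x. norm (- c *\<^sub>R \<psi> x + grad V (\<phi> x)) \<le> B"
proof -
  obtain K where K: "K > 0" "\<And>u. u \<in> cball e R \<Longrightarrow> norm (grad V u) \<le> K * norm (u - e)"
    by (rule grad_linear_bound[of R]) blast
  have g: "norm (grad V (\<phi> x)) \<le> K * R" for x
  proof -
    have "norm (grad V (\<phi> x)) \<le> K * norm (\<phi> x - e)" by (rule K(2)) (use R[of x] in \<open>simp add: dist_norm norm_minus_commute\<close>)
    also have "\<dots> \<le> K * R" using R K(1) by (intro mult_left_mono) auto
    finally show ?thesis .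
  qed
  define B where "B = real DIM(real ^ 'n) * (2 * R * (1 + c) + K * R)"
  have B: "norm (\<psi> x) \<le> B" for x unfolding B_def by (rule wave_derivative_window[OF w c R g])
  have B0: "B \<ge> 0" using B[of 0] norm_ge_zero order_trans by blast
  have KR: "K * R \<ge> 0" using g[of 0] norm_ge_zero order_trans by blast
  have "norm (- c *\<^sub>R \<psi> x + grad V (\<phi> x)) \<le> B + (c * B + K * R)" for x
  proof -
    have "norm (- c *\<^sub>R \<psi> x + grad V (\<phi> x)) \<le> norm (- c *\<^sub>R \<psi> x) + norm (grad V (\<phi> x))" by (rule norm_triangle_ineq)
    also have "\<dots> \<le> c * B + K * R" using c B[of x] g[of x] by (intro add_mono) (auto simp: mult_left_mono)
    finally show ?thesis using B0 by simp
  qed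
  moreover have "norm (\<psi> x) \<le> B + (c * B + K * R)" for x
    using B[of x] B0 c KR by (simp add: add_increasing2)
  ultimately show ?thesis using that by blast
qed

lemma wave_derivative_decay:
  assumes w: "wave c \<phi> \<psi>" and c: "c \<ge> 0" and M: "\<And>x. x \<ge> x0 \<Longrightarrow> norm (\<phi> x - e) \<le> M * exp (- \<alpha> * x)" and \<alpha>: "\<alpha> \<ge> 0" and x0: "x0 \<ge> 0"
  obtains M' where "\<And>x. x \<ge> x0 + 1 \<Longrightarrow> norm (\<psi> x) \<le> M' * exp (- \<alpha> * x)"
proof -
  have M0: "M \<ge> 0"
  proof -
    have "0 \<le> M * exp (- \<alpha> * x0)" using M[of x0] norm_ge_zero order_trans by blast
    then show ?thesis by (simp add: zero_le_mult_iff)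
  qed
  obtain K where K: "K > 0" "\<And>u. u \<in> cball e M \<Longrightarrow> norm (grad V u) \<le> K * norm (u - e)"
    by (rule grad_linear_bound[of M]) blast
  have "norm (\<psi> t) \<le> (real DIM(real ^ 'n) * (2 * (1 + c) + K) * M * exp \<alpha>) * exp (- \<alpha> * t)" if t: "t \<ge> x0 + 1" for t
  proof -
    define a where "a = M * exp (- \<alpha> * (t - 1))"
    have a: "norm (\<phi> s - e) \<le> a" if s: "s \<in> {t-1..t}" for s
    proof -
      have "norm (\<phi> s - e) \<le> M * exp (- \<alpha> * s)" by (rule M) (use s t in auto)
      also have "\<dots> \<le> a" unfolding a_def using s M0 \<alpha> by (intro mult_left_mono) (auto simp: mult_left_mono)
      finally show ?thesis .
    qed
    have aM: "a \<le> M * 1" unfolding a_def using M0 \<alpha> t x0 by (intro mult_left_mono) auto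
    have b: "norm (grad V (\<phi> s)) \<le> K * a" if s: "s \<in> {t-1..t}" for s
    proof -
      have "norm (grad V (\<phi> s)) \<le> K * norm (\<phi> s - e)" by (rule K(2)) (use a[OF s] aM in \<open>simp add: dist_norm norm_minus_commute\<close>)
      also have "\<dots> \<le> K * a" using a[OF s] K(1) by (intro mult_left_mono) auto
      finally show ?thesis .
    qed
    have "norm (\<psi> t) \<le> real DIM(real ^ 'n) * (2 * a * (1 + c) + K * a)" by (rule wave_derivative_window[OF w c a b])
    also have "a = M * exp \<alpha> * exp (- \<alpha> * t)" unfolding a_def by (simp add: algebra_simps flip: exp_add)
    finally show ?thesis by (simp add: algebra_simps)
  qed
  then show ?thesis using that by blast
qed

lemma wave_derivative_tendsto_0:
  assumes w: "wave c \<phi> \<psi>" and c: "c \<ge> 0" and lim: "(\<phi> \<longlongrightarrow> e) at_top"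
  shows "(\<psi> \<longlongrightarrow> 0) at_top"
proof (rule tendstoI)
  fix \<epsilon> :: real assume \<epsilon>: "\<epsilon> > 0"
  obtain K where K: "K > 0" "\<And>u. u \<in> cball e 1 \<Longrightarrow> norm (grad V u) \<le> K * norm (u - e)"
    by (rule grad_linear_bound[of 1]) blast
  define D where "D = real DIM(real ^ 'n) * (2 * (1 + c) + K) + 1"
  have D: "D > 0" using K c by (simp add: D_def add_nonneg_pos)
  define a where "a = min 1 (\<epsilon> / (2 * D))"
  have a: "a > 0" "a \<le> 1" "a * D \<le> \<epsilon> / 2" using \<epsilon> D by (auto simp: a_def min_def field_simps)
  have "eventually (\<lambda>x. dist (\<phi> x) e < a) at_top" by (rule tendstoD[OF lim a(1)])
  then obtain X where X: "\<And>x. x \<ge> X \<Longrightarrow> norm (\<phi> x - e) < a" unfolding eventually_at_top_linorder dist_norm by blast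
  have "dist (\<psi> t) 0 < \<epsilon>" if t: "t \<ge> X + 1" for t
  proof -
    have 1: "norm (\<phi> s - e) \<le> a" if "s \<in> {t-1..t}" for s using X[of s] that t by (simp add: less_imp_le)
    have 2: "norm (grad V (\<phi> s)) \<le> K * a" if s: "s \<in> {t-1..t}" for s
    proof -
      have "norm (grad V (\<phi> s)) \<le> K * norm (\<phi> s - e)" by (rule K(2)) (use 1[OF s] a in \<open>simp add: dist_norm norm_minus_commute\<close>)
      also have "\<dots> \<le> K * a" using 1[OF s] K(1) by (intro mult_left_mono) auto
      finally show ?thesis .
    qed
    have "norm (\<psi> t) \<le> real DIM(real ^ 'n) * (2 * a * (1 + c) + K * a)" by (rule wave_derivative_window[OF w c 1 2])
    also have "\<dots> = a * (D - 1)" by (simp add: D_def algebra_simps)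
    also have "\<dots> \<le> a * D" using a by (intro mult_left_mono) auto
    finally show ?thesis using a \<epsilon> by simp
  qed
  then show "eventually (\<lambda>x. dist (\<psi> x) 0 < \<epsilon>) at_top" unfolding eventually_at_top_linorder by blast
qed

text \<open>\<open>L = \<bar>\<psi>\<bar>\<^sup>2 / 2 - V \<phi>\<close> is bounded with derivative \<open>- c \<bar>\<psi>\<bar>\<^sup>2\<close>, so \<open>\<psi>\<close>, and then also \<open>\<psi>'\<close>, tends to 0 at
  \<open>-\<infinity>\<close>, which makes limit points of \<open>\<phi>\<close> critical. \<open>L\<close> decreases to 0 at \<open>+\<infinity>\<close> and is not
  constant, so its limit \<open>S\<close> at \<open>-\<infinity>\<close> is positive, and \<open>V \<phi>\<close> tends to \<open>h = - S\<close>.\<close>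
lemma wave_converges_to_critical_level:
  assumes w: "wave c \<phi> \<psi>" and c: "c > 0" and R: "\<And>x. norm (\<phi> x - e) \<le> R"
    and lim: "(\<phi> \<longlongrightarrow> e) at_top" and nonconst: "\<phi> x1 \<noteq> e"
  obtains h where "h < 0" "critical_points_at_level V h \<noteq> {}"
    "((\<lambda>x. infdist (\<phi> x) (critical_points_at_level V h)) \<longlongrightarrow> 0) at_bot"
proof -
  obtain B where B: "\<And>x. norm (\<psi> x) \<le> B" "\<And>x. norm (- c *\<^sub>R \<psi> x + grad V (\<phi> x)) \<le> B"
    by (rule wave_derivative_bounded[OF w less_imp_le[OF c] R]) blast
  have in_ball: "\<phi> x \<in> cball e R" for x using R[of x] by (simp add: dist_norm norm_minus_commute)
  have \<phi>_lip: "norm (\<phi> y - \<phi> x) \<le> B * (y - x)" if "x \<le> y" for x y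
    by (rule lipschitz_of_derivative[OF waveD(1)[OF w] B(1) that])
  have \<psi>_lip: "norm (\<psi> y - \<psi> x) \<le> B * (y - x)" if "x \<le> y" for x y
    by (rule lipschitz_of_derivative[OF waveD(2)[OF w] B(2) that])
  obtain K where K: "K > 0" "\<And>x y. x \<in> cball e R \<Longrightarrow> y \<in> cball e R \<Longrightarrow> norm (grad V x - grad V y) \<le> K * norm (x - y)"
    by (rule grad_lipschitz[of R]) blast
  define L where "L x = (\<psi> x \<bullet> \<psi> x) / 2 - V (\<phi> x)" for x
  have dL: "(L has_real_derivative - c * (norm (\<psi> x))\<^sup>2) (at x)" for x
    unfolding L_def by (rule wave_lyapunov[OF w])
  have G: "((\<lambda>t. (norm (\<psi> t))\<^sup>2) has_integral (- L b / c) - (- L a / c)) {a..b}" if "a \<le> b" for a b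
  proof (rule fundamental_theorem_of_calculus[OF that])
    fix x
    have "((\<lambda>x. - L x / c) has_real_derivative (norm (\<psi> x))\<^sup>2) (at x)"
      by (rule DERIV_cong[OF DERIV_cdivide[OF DERIV_minus[OF dL]]]) (use c in simp)
    then show "((\<lambda>x. - L x / c) has_vector_derivative (norm (\<psi> x))\<^sup>2) (at x within {a..b})"
      by (simp add: has_real_derivative_iff_has_vector_derivative has_vector_derivative_at_within)
  qed
  have "bounded (V ` cball e R)" by (intro compact_imp_bounded compact_continuous_image V_continuous) auto
  then obtain VB where VB: "\<forall>u\<in>cball e R. norm (V u) \<le> VB" unfolding bounded_iff by blast
  have L_bd: "\<bar>L x\<bar> \<le> B\<^sup>2 / 2 + VB" for x
  proof -
    have "\<psi> x \<bullet> \<psi> x \<le> B\<^sup>2" using B(1)[of x] unfolding power2_norm_eq_inner[symmetric] by (intro power_mono) auto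
    moreover have "\<bar>V (\<phi> x)\<bar> \<le> VB" using VB in_ball[of x] by auto
    moreover have "\<psi> x \<bullet> \<psi> x \<ge> 0" by simp
    ultimately show ?thesis unfolding L_def by argo
  qed
  have G_bd: "bounded (range (\<lambda>x. - L x / c))"
    unfolding bounded_iff
  proof (intro exI[of _ "(B\<^sup>2 / 2 + VB) / c"] ballI)
    fix y assume "y \<in> range (\<lambda>x. - L x / c)"
    then obtain x where "y = - L x / c" by auto
    then show "norm y \<le> (B\<^sup>2 / 2 + VB) / c" using L_bd[of x] c by (simp add: divide_right_mono)
  qed
  have \<psi>0: "(\<psi> \<longlongrightarrow> 0) at_bot"
    by (rule square_integral_tendsto_0_at_bot[OF lipschitz_uniformly_continuous[OF \<psi>_lip] G G_bd])
  have "uniformly_continuous_on UNIV (\<lambda>x. - c *\<^sub>R \<psi> x + grad V (\<phi> x))"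
  proof (rule lipschitz_uniformly_continuous[where B = "c * B + K * B"])
    fix x y :: real assume xy: "x \<le> y"
    have eq: "(- c *\<^sub>R \<psi> y + grad V (\<phi> y)) - (- c *\<^sub>R \<psi> x + grad V (\<phi> x)) = (grad V (\<phi> y) - grad V (\<phi> x)) - c *\<^sub>R (\<psi> y - \<psi> x)"
      by (simp add: algebra_simps)
    have "norm (grad V (\<phi> y) - grad V (\<phi> x)) \<le> K * norm (\<phi> y - \<phi> x)" by (rule K(2)[OF in_ball in_ball])
    also have "\<dots> \<le> K * (B * (y - x))" using \<phi>_lip[OF xy] K(1) by (intro mult_left_mono) auto
    finally have 1: "norm (grad V (\<phi> y) - grad V (\<phi> x)) \<le> K * (B * (y - x))" .
    have 2: "norm (c *\<^sub>R (\<psi> y - \<psi> x)) \<le> c * (B * (y - x))" using \<psi>_lip[OF xy] c by (simp add: mult_left_mono)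
    show "norm ((- c *\<^sub>R \<psi> y + grad V (\<phi> y)) - (- c *\<^sub>R \<psi> x + grad V (\<phi> x))) \<le> (c * B + K * B) * (y - x)"
      unfolding eq using norm_triangle_ineq4[of "grad V (\<phi> y) - grad V (\<phi> x)" "c *\<^sub>R (\<psi> y - \<psi> x)"] 1 2 by (simp add: algebra_simps)
  qed
  from derivative_tendsto_0_at_bot[OF waveD(2)[OF w] this \<psi>0]
  have "((\<lambda>x. (- c *\<^sub>R \<psi> x + grad V (\<phi> x)) + c *\<^sub>R \<psi> x) \<longlongrightarrow> 0 + c *\<^sub>R 0) at_bot"
    by (intro tendsto_intros \<psi>0)
  then have grad0: "((\<lambda>x. grad V (\<phi> x)) \<longlongrightarrow> 0) at_bot" by simp
  have L_anti: "L y \<le> L x" if "x \<le> y" for x y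
    by (rule DERIV_nonpos_imp_nonincreasing[OF that]) (use dL c in \<open>fastforce simp: mult_nonneg_nonneg\<close>)
  have bdd: "bdd_above (range L)" by (rule bdd_aboveI[of _ "B\<^sup>2 / 2 + VB"]) (use L_bd in \<open>auto simp: abs_le_iff\<close>)
  define S where "S = Sup (range L)"
  have L_lim: "(L \<longlongrightarrow> S) at_bot"
  proof (rule order_tendstoI)
    fix a assume "a < S"
    then obtain x where x: "a < L x" unfolding S_def using less_cSup_iff[OF _ bdd] by auto
    show "eventually (\<lambda>y. a < L y) at_bot" unfolding eventually_at_bot_linorder
      using x L_anti by (meson less_le_trans)
  next
    fix a assume "S < a"
    moreover have "L x \<le> S" for x unfolding S_def by (rule cSup_upper[OF _ bdd]) auto
    ultimately show "eventually (\<lambda>y. L y < a) at_bot" by (intro always_eventually) (auto intro: le_less_trans)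
  qed
  have "(L \<longlongrightarrow> (0 \<bullet> (0 :: real ^ 'n)) / 2 - V e) at_top"
    unfolding L_def
    by (intro tendsto_intros wave_derivative_tendsto_0[OF w less_imp_le[OF c] lim]
       isCont_tendsto_compose[OF has_derivative_continuous[OF V_derivative] lim]) simp
  then have L_top: "(L \<longlongrightarrow> 0) at_top" by (simp add: V_e)
  have L_nonneg: "L x \<ge> 0" for x
    by (rule tendsto_upperbound[OF L_top]) (use L_anti in \<open>auto simp: eventually_at_top_linorder\<close>)
  have "S > 0"
  proof (rule ccontr)
    assume "\<not> S > 0"
    moreover have "L x \<le> S" for x unfolding S_def by (rule cSup_upper[OF _ bdd]) auto
    ultimately have L0: "L x = 0" for x using L_nonneg[of x] by (meson dual_order.antisym not_less order_trans)
    have "\<psi> x = 0" for x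
    proof -
      have "L = (\<lambda>x. 0)" using L0 by auto
      then have "(L has_real_derivative 0) (at x)" by simp
      then have "- c * (norm (\<psi> x))\<^sup>2 = 0" using dL DERIV_unique by blast
      then show ?thesis using c by simp
    qed
    then have "norm (\<phi> y - \<phi> x) \<le> 0 * (y - x)" if "x \<le> y" for x y
      by (intro lipschitz_of_derivative[OF waveD(1)[OF w] _ that]) simp
    then have "\<phi> y = \<phi> x1" if "y \<ge> x1" for y using that by simp
    then have "eventually (\<lambda>y. \<phi> y = \<phi> x1) at_top" unfolding eventually_at_top_linorder by blast
    then have "(\<phi> \<longlongrightarrow> \<phi> x1) at_top" by (rule tendsto_eventually)
    then have "\<phi> x1 = e" using lim tendsto_unique trivial_limit_at_top_linorder by blast
    then show False using nonconst by simp
  qed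
  define h where "h = - S"
  have Vh: "((\<lambda>x. V (\<phi> x)) \<longlongrightarrow> h) at_bot"
  proof -
    have "((\<lambda>x. (\<psi> x \<bullet> \<psi> x) / 2 - L x) \<longlongrightarrow> (0 \<bullet> (0 :: real ^ 'n)) / 2 - S) at_bot"
      by (intro tendsto_intros \<psi>0 L_lim) simp
    then show ?thesis by (simp add: L_def h_def)
  qed
  define Z where "Z = critical_points_at_level V h"
  have limit_pt: "\<exists>p\<in>Z. \<exists>r. strict_mono (r :: nat \<Rightarrow> nat) \<and> (\<lambda>n. \<phi> (xs (r n))) \<longlonglongrightarrow> p"
    if xs: "filterlim xs at_bot sequentially" for xs
  proof -
    have "compact (cball e R)" by simp
    then obtain p r where pr: "strict_mono (r :: nat \<Rightarrow> nat)" "((\<lambda>n. \<phi> (xs n)) \<circ> r) \<longlonglongrightarrow> p"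
      unfolding compact_def using in_ball by metis
    have pl: "(\<lambda>n. \<phi> (xs (r n))) \<longlonglongrightarrow> p" using pr(2) by (simp add: o_def)
    have xr: "filterlim (\<lambda>n. xs (r n)) at_bot sequentially"
      using filterlim_compose[OF xs filterlim_subseq[OF pr(1)]] .
    have "(\<lambda>n. V (\<phi> (xs (r n)))) \<longlonglongrightarrow> V p"
      by (rule isCont_tendsto_compose[OF has_derivative_continuous[OF V_derivative] pl])
    moreover have "(\<lambda>n. V (\<phi> (xs (r n)))) \<longlonglongrightarrow> h" by (rule filterlim_compose[OF Vh xr])
    ultimately have "V p = h" by (rule LIMSEQ_unique)
    moreover have "(\<lambda>n. grad V (\<phi> (xs (r n)))) \<longlonglongrightarrow> grad V p"
      by (rule isCont_tendsto_compose[OF has_derivative_continuous[OF grad_derivative] pl])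
    then have "grad V p = 0" using filterlim_compose[OF grad0 xr] LIMSEQ_unique by blast
    ultimately have "p \<in> Z" by (simp add: Z_def critical_points_at_level_def)
    then show ?thesis using pr(1) pl by blast
  qed
  have Z_ne: "Z \<noteq> {}"
    using limit_pt[OF filterlim_compose[OF filterlim_uminus_at_bot_at_top filterlim_real_sequentially]] by blast
  have "((\<lambda>x. infdist (\<phi> x) Z) \<longlongrightarrow> 0) at_bot"
  proof (rule ccontr)
    assume "\<not> ((\<lambda>x. infdist (\<phi> x) Z) \<longlongrightarrow> 0) at_bot"
    then obtain \<epsilon> where \<epsilon>: "\<epsilon> > 0" "\<not> eventually (\<lambda>x. dist (infdist (\<phi> x) Z) 0 < \<epsilon>) at_bot"
      unfolding tendsto_iff by blast
    have "\<exists>x\<le>- real n. infdist (\<phi> x) Z \<ge> \<epsilon>" for n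
    proof (rule ccontr)
      assume "\<not> (\<exists>x\<le>- real n. infdist (\<phi> x) Z \<ge> \<epsilon>)"
      then have "\<forall>x\<le>- real n. dist (infdist (\<phi> x) Z) 0 < \<epsilon>" by (auto simp: infdist_nonneg not_le) (metis not_le)
      then show False using \<epsilon>(2) unfolding eventually_at_bot_linorder by blast
    qed
    then obtain xs where xs: "\<And>n. xs n \<le> - real n" "\<And>n. infdist (\<phi> (xs n)) Z \<ge> \<epsilon>" by metis
    have "filterlim xs at_bot sequentially"
      by (rule filterlim_at_bot_mono[OF filterlim_compose[OF filterlim_uminus_at_bot_at_top filterlim_real_sequentially]])
        (use xs(1) in auto)
    then obtain p r where pr: "p \<in> Z" "(\<lambda>n. \<phi> (xs (r n))) \<longlonglongrightarrow> p" using limit_pt by blast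
    have "eventually (\<lambda>n. dist (\<phi> (xs (r n))) p < \<epsilon>) sequentially" by (rule tendstoD[OF pr(2) \<epsilon>(1)])
    then obtain n where "dist (\<phi> (xs (r n))) p < \<epsilon>" unfolding eventually_sequentially by blast
    then show False using infdist_le[OF pr(1), of "\<phi> (xs (r n))"] xs(2)[of "r n"] by simp
  qed
  then show ?thesis using that[of h] Z_ne \<open>S > 0\<close> by (simp add: Z_def h_def)
qed

end

lemma exp_tendsto_0_at_bot: "(k::real) > 0 \<Longrightarrow> ((\<lambda>x. exp (k * x)) \<longlongrightarrow> 0) at_bot"
  by (rule filterlim_compose[OF exp_at_bot filterlim_tendsto_pos_mult_at_bot[OF tendsto_const _ filterlim_ident]])

lemma exp_tendsto_0_at_top: "(k::real) > 0 \<Longrightarrow> ((\<lambda>x. exp (- k * x)) \<longlongrightarrow> 0) at_top"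
  using exp_tendsto_0_at_bot[of k] by (simp add: filterlim_at_bot_mirror)

context invaded_potential
begin

text \<open>Hence \<open>exp (c x) (\<bar>\<phi>\<bar>\<^sup>2)'\<close> is nondecreasing wherever \<open>\<phi> \<bullet> grad V \<phi> \<ge> 0\<close>.\<close>
lemma wave_norm_derivative:
  assumes w: "wave c \<phi> \<psi>"
  shows "((\<lambda>x. \<phi> x \<bullet> \<phi> x) has_real_derivative 2 * (\<phi> x \<bullet> \<psi> x)) (at x)"
    "((\<lambda>x. exp (c * x) * (2 * (\<phi> x \<bullet> \<psi> x))) has_real_derivative
       2 * exp (c * x) * (\<psi> x \<bullet> \<psi> x + \<phi> x \<bullet> grad V (\<phi> x))) (at x)"
proof -
  show "((\<lambda>x. \<phi> x \<bullet> \<phi> x) has_real_derivative 2 * (\<phi> x \<bullet> \<psi> x)) (at x)"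
    unfolding has_real_derivative_iff_has_vector_derivative
    by (rule has_vector_derivative_eq_rhs[OF bounded_bilinear.has_vector_derivative[OF bounded_bilinear_inner waveD(1)[OF w] waveD(1)[OF w]]])
      (simp add: inner_commute)
  have 1: "((\<lambda>x. \<phi> x \<bullet> \<psi> x) has_real_derivative (\<phi> x \<bullet> (- c *\<^sub>R \<psi> x + grad V (\<phi> x)) + \<psi> x \<bullet> \<psi> x)) (at x)"
    unfolding has_real_derivative_iff_has_vector_derivative
    by (rule bounded_bilinear.has_vector_derivative[OF bounded_bilinear_inner waveD(1)[OF w] waveD(2)[OF w]])
  have 2: "((\<lambda>x. exp (c * x)) has_real_derivative c * exp (c * x)) (at x)" by (auto intro!: derivative_eq_intros)
  show "((\<lambda>x. exp (c * x) * (2 * (\<phi> x \<bullet> \<psi> x))) has_real_derivative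
       2 * exp (c * x) * (\<psi> x \<bullet> \<psi> x + \<phi> x \<bullet> grad V (\<phi> x))) (at x)"
    by (rule DERIV_cong[OF DERIV_mult[OF 2 DERIV_cmult[OF 1]]])
      (simp add: inner_add_right inner_diff_right algebra_simps)
qed

text \<open>Suppose \<open>\<bar>\<phi>\<bar>\<close> exceeds a radius outside which \<open>u \<bullet> grad V u > 0\<close>. As \<open>\<phi>\<close> returns into
  the ball on the right, \<open>\<bar>\<phi>\<bar>\<^sup>2\<close> decreases somewhere outside it, at \<open>x2\<close>. To the left of \<open>x2\<close> the
  monotone quantity \<open>p\<close> stays below \<open>-\<kappa> = p x2\<close>, so \<open>\<phi>\<close> stays outside the ball and \<open>\<bar>\<phi>\<bar>\<^sup>2\<close> grows like \<open>(\<kappa> / c) exp (- c x)\<close>, which the hypothesis at \<open>-\<infinity>\<close> forbids.\<close>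
lemma wave_bounded:
  assumes w: "wave c \<phi> \<psi>" and c: "c > 0" and top: "(\<phi> \<longlongrightarrow> e) at_top"
    and bot: "((\<lambda>x. exp (c * x) * (norm (\<phi> x))\<^sup>2) \<longlongrightarrow> 0) at_bot"
  obtains R where "\<And>x. norm (\<phi> x) \<le> R"
proof -
  obtain R0 where R0: "R0 > 0" "\<And>u. norm u \<ge> R0 \<Longrightarrow> u \<bullet> grad V u > 0" by (rule V_coercive_bound) blast
  define R where "R = max R0 (norm e + 1)"
  have R: "R > 0" "norm e < R" using R0(1) by (auto simp: R_def)
  define q where "q x = \<phi> x \<bullet> \<phi> x" for x
  define q' where "q' x = 2 * (\<phi> x \<bullet> \<psi> x)" for x
  define p where "p x = exp (c * x) * q' x" for x
  define p' where "p' x = 2 * exp (c * x) * (\<psi> x \<bullet> \<psi> x + \<phi> x \<bullet> grad V (\<phi> x))" for x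
  have dq: "(q has_real_derivative q' x) (at x)" for x
    unfolding q_def q'_def by (rule wave_norm_derivative(1)[OF w])
  have dp: "(p has_real_derivative p' x) (at x)" for x
    unfolding p_def q'_def p'_def by (rule wave_norm_derivative(2)[OF w])
  have q_norm: "q x = (norm (\<phi> x))\<^sup>2" for x by (simp add: q_def power2_norm_eq_inner)
  have big: "norm (\<phi> x) > R \<longleftrightarrow> q x > R\<^sup>2" for x
    unfolding q_norm using R(1) by (auto intro: power_strict_mono power2_less_imp_less)
  have p'0: "p' x \<ge> 0" if "q x > R\<^sup>2" for x
  proof -
    have "norm (\<phi> x) \<ge> R0" using that big[of x] by (auto simp: R_def)
    then have "\<phi> x \<bullet> grad V (\<phi> x) > 0" by (rule R0(2))
    moreover have "\<psi> x \<bullet> \<psi> x \<ge> 0" by simp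
    ultimately show ?thesis by (simp add: p'_def)
  qed
  have q_cont: "continuous_on S q" for S unfolding q_def by (intro continuous_intros waveD(3)[OF w])
  have False if large: "norm (\<phi> x0) > R" for x0
  proof -
    have "eventually (\<lambda>x. norm (\<phi> x) < R) at_top" by (rule order_tendstoD(2)[OF tendsto_norm[OF top] R(2)])
    then obtain X where X: "\<And>x. x \<ge> X \<Longrightarrow> norm (\<phi> x) < R" unfolding eventually_at_top_linorder by blast
    \<comment> \<open>\<open>y\<close> is the first time after \<open>x0\<close> at which the wave is back in the ball\<close>
    define x1 where "x1 = max X (x0 + 1)"
    define S where "S = {x \<in> {x0..x1}. q x \<le> R\<^sup>2}"
    have "\<not> norm (\<phi> x1) > R" using X[of x1] by (simp add: x1_def)
    then have S1: "x1 \<in> S" using big[of x1] by (simp add: S_def x1_def)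
    have S_cl: "closed S" unfolding S_def by (intro continuous_on_closed_Collect_le q_cont continuous_on_const closed_atLeastAtMost)
    have S_bd: "bdd_below S" by (rule bdd_belowI[of _ x0]) (simp add: S_def)
    define y where "y = Inf S"
    have yS: "y \<in> S" unfolding y_def by (rule closed_contains_Inf[OF _ S_bd S_cl]) (use S1 in blast)
    have before: "q x > R\<^sup>2" if "x0 \<le> x" "x < y" for x
    proof (rule ccontr)
      assume "\<not> q x > R\<^sup>2"
      then have "x \<in> S" using that yS by (auto simp: S_def)
      then have "y \<le> x" unfolding y_def by (rule cInf_lower[OF _ S_bd])
      then show False using that by simp
    qed
    have q0: "q x0 > R\<^sup>2" using large big by blast
    have xy: "x0 < y" using yS q0 by (cases "x0 = y") (auto simp: S_def)
    obtain x2 where x2: "x0 < x2" "x2 < y" "q y - q x0 = (y - x0) * q' x2"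
      using MVT2[OF xy, of q q'] dq by blast
    have "q y - q x0 < 0" using yS q0 by (simp add: S_def)
    then have q'2: "q' x2 < 0" using x2(3) xy by (simp add: mult_less_0_iff)
    have q2: "q x2 > R\<^sup>2" using before x2 by simp
    have p2: "p x2 < 0" using q'2 by (simp add: p_def mult_pos_neg)
    have left: "q x > R\<^sup>2" if x: "x \<le> x2" for x
    proof (rule ccontr)
      assume nx: "\<not> q x > R\<^sup>2"
      \<comment> \<open>between the last entrance \<open>z\<close> into the ball and \<open>x2\<close>, \<open>\<bar>\<phi>\<bar>\<^sup>2\<close> would have to increase, against \<open>p x2 < 0\<close> and the monotonicity of \<open>p\<close>\<close>
      define T where "T = {z \<in> {x..x2}. q z \<le> R\<^sup>2}"
      have T1: "x \<in> T" using nx x by (simp add: T_def)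
      have T_cl: "closed T" unfolding T_def by (intro continuous_on_closed_Collect_le q_cont continuous_on_const closed_atLeastAtMost)
      have T_bd: "bdd_above T" by (rule bdd_aboveI[of _ x2]) (simp add: T_def)
      define z where "z = Sup T"
      have zT: "z \<in> T" unfolding z_def by (rule closed_contains_Sup[OF _ T_bd T_cl]) (use T1 in blast)
      have after: "q s > R\<^sup>2" if "z < s" "s \<le> x2" for s
      proof (rule ccontr)
        assume "\<not> q s > R\<^sup>2"
        then have "s \<in> T" using that zT by (auto simp: T_def)
        then have "s \<le> z" unfolding z_def by (rule cSup_upper[OF _ T_bd])
        then show False using that by simp
      qed
      have zx: "z < x2" using zT q2 by (cases "z = x2") (auto simp: T_def)
      obtain \<xi> where \<xi>: "z < \<xi>" "\<xi> < x2" "q x2 - q z = (x2 - z) * q' \<xi>"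
        using MVT2[OF zx, of q q'] dq by blast
      have "q x2 - q z > 0" using zT q2 by (simp add: T_def)
      then have "q' \<xi> > 0" using \<xi>(3) zx by (simp add: zero_less_mult_iff)
      then have p\<xi>: "p \<xi> > 0" by (simp add: p_def)
      obtain \<zeta> where \<zeta>: "\<xi> < \<zeta>" "\<zeta> < x2" "p x2 - p \<xi> = (x2 - \<xi>) * p' \<zeta>"
        using MVT2[OF \<xi>(2), of p p'] dp by blast
      have "p' \<zeta> \<ge> 0" using after[of \<zeta>] \<zeta> \<xi> by (intro p'0) auto
      then have "p x2 - p \<xi> \<ge> 0" using \<zeta>(3) \<xi>(2) by simp
      then show False using p2 p\<xi> by simp
    qed
    define \<kappa> where "\<kappa> = - p x2"
    have \<kappa>: "\<kappa> > 0" using p2 by (simp add: \<kappa>_def)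
    have pl: "p x \<le> - \<kappa>" if x: "x \<le> x2" for x
    proof -
      have "p x \<le> p x2"
        by (rule DERIV_nonneg_imp_nondecreasing[OF x]) (use dp p'0 left in blast)
      then show ?thesis by (simp add: \<kappa>_def)
    qed
    define W where "W x = q x - (\<kappa> / c) * exp (- c * x)" for x
    have dW: "(W has_real_derivative q' x + \<kappa> * exp (- c * x)) (at x)" for x
      unfolding W_def using c by (auto intro!: derivative_eq_intros dq)
    have W_le: "W x2 \<le> W x" if x: "x \<le> x2" for x
    proof (rule DERIV_nonpos_imp_nonincreasing[OF x])
      fix z assume z: "x \<le> z" "z \<le> x2"
      have "exp (- c * z) * p z = q' z" by (simp add: p_def mult.assoc[symmetric] flip: exp_add)
      moreover have "exp (- c * z) * p z \<le> exp (- c * z) * (- \<kappa>)" by (rule mult_left_mono[OF pl[OF z(2)]]) simp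
      ultimately have "q' z + \<kappa> * exp (- c * z) \<le> 0" by (simp add: mult.commute)
      then show "\<exists>D. (W has_real_derivative D) (at z) \<and> D \<le> 0" using dW by blast
    qed
    have low: "exp (c * x) * W x2 + \<kappa> / c \<le> exp (c * x) * (norm (\<phi> x))\<^sup>2" if x: "x \<le> x2" for x
    proof -
      have "exp (c * x) * W x2 \<le> exp (c * x) * W x" by (intro mult_left_mono W_le x) simp
      moreover have "exp (c * x) * W x = exp (c * x) * q x - \<kappa> / c"
      proof -
        have "exp (c * x) * exp (- c * x) = 1" by (simp flip: exp_add)
        then show ?thesis unfolding W_def by (simp add: right_diff_distrib)
      qed
      ultimately show ?thesis by (simp add: q_norm)
    qed
    have ex0: "((\<lambda>x. exp (c * x)) \<longlongrightarrow> 0) at_bot"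
      by (rule exp_tendsto_0_at_bot[OF c])
    have "((\<lambda>x. exp (c * x) * W x2 + \<kappa> / c) \<longlongrightarrow> 0 * W x2 + \<kappa> / c) at_bot"
      by (intro tendsto_intros ex0)
    then have "0 * W x2 + \<kappa> / c \<le> 0"
      by (rule tendsto_le[OF trivial_limit_at_bot_linorder bot]) (use low in \<open>auto simp: eventually_at_bot_linorder\<close>)
    then show False using \<kappa> c by (simp add: divide_le_0_iff)
  qed
  then have "norm (\<phi> x) \<le> R" for x by (meson not_le)
  then show ?thesis using that by blast
qed

lemma pushed_front_exists:
  assumes lt: "c_lin V e < c_nl V e"
  shows "\<exists>\<phi>. pushed_front_profile V e (c_nl V e) \<phi>"
proof -
  define c where "c = c_nl V e"
  have "c_lin V e \<ge> 0" by (simp add: c_lin_def Let_def)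
  then have c: "c > 0" using lt by (simp add: c_def)
  obtain v g where v: "sobolev v g" "integrable lebesgue (dens c v g)" "(LINT x|lebesgue. dens c v g x) \<le> 0" "v 0 \<noteq> 0"
    unfolding c_def by (rule minimiser_exists[OF lt])
  have min: "\<not> negative_energy c v' g'" for v' g'
    using c_nl_not_in_C_minus_infinity C_minus_infinity_iff c unfolding c_def by blast
  obtain \<gamma> where \<gamma>: "\<And>x. (v has_vector_derivative \<gamma> x) (at x)"
    "\<And>x. (\<gamma> has_vector_derivative (exp ((c/2) * x) *\<^sub>R grad V (profile e c v x) + (c\<^sup>2/4) *\<^sub>R v x)) (at x)"
    by (rule euler_lagrange[OF v(1-3) min]) blast
  define \<phi> where "\<phi> = profile e c v"
  define \<psi> where "\<psi> x = exp (- (c/2) * x) *\<^sub>R (\<gamma> x - (c/2) *\<^sub>R v x)" for x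
  have dE: "((\<lambda>x. exp (- (c/2) * x)) has_real_derivative - (c/2) * exp (- (c/2) * x)) (at x)" for x
    by (auto intro!: derivative_eq_intros)
  have d\<phi>: "(\<phi> has_vector_derivative \<psi> x) (at x)" for x
  proof -
    have "((\<lambda>x. e + exp (- (c/2) * x) *\<^sub>R v x) has_vector_derivative 0 + (exp (- (c/2) * x) *\<^sub>R \<gamma> x + (- (c/2) * exp (- (c/2) * x)) *\<^sub>R v x)) (at x)"
      by (intro has_vector_derivative_add has_vector_derivative_const has_vector_derivative_scaleR dE \<gamma>)
    moreover have "0 + (exp (- (c/2) * x) *\<^sub>R \<gamma> x + (- (c/2) * exp (- (c/2) * x)) *\<^sub>R v x) = \<psi> x"
      by (simp add: \<psi>_def scaleR_diff_right mult.commute)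
    ultimately show ?thesis unfolding \<phi>_def profile_def[abs_def] by simp
  qed
  have d\<psi>: "(\<psi> has_vector_derivative (- c *\<^sub>R \<psi> x + grad V (\<phi> x))) (at x)" for x
  proof -
    define F where "F = exp ((c/2) * x) *\<^sub>R grad V (profile e c v x) + (c\<^sup>2/4) *\<^sub>R v x"
    have "(\<psi> has_vector_derivative exp (- (c/2) * x) *\<^sub>R (F - (c/2) *\<^sub>R \<gamma> x) + (- (c/2) * exp (- (c/2) * x)) *\<^sub>R (\<gamma> x - (c/2) *\<^sub>R v x)) (at x)"
      unfolding \<psi>_def F_def
      by (intro has_vector_derivative_scaleR dE has_vector_derivative_diff \<gamma> bounded_linear.has_vector_derivative[OF bounded_linear_scaleR_right \<gamma>(1)])
    moreover have "exp (- (c/2) * x) *\<^sub>R (F - (c/2) *\<^sub>R \<gamma> x) + (- (c/2) * exp (- (c/2) * x)) *\<^sub>R (\<gamma> x - (c/2) *\<^sub>R v x)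
       = - c *\<^sub>R \<psi> x + grad V (\<phi> x)"
    proof -
      have "exp (- (c/2) * x) *\<^sub>R F = grad V (\<phi> x) + (exp (- (c/2) * x) * (c\<^sup>2/4)) *\<^sub>R v x"
        unfolding F_def \<phi>_def scaleR_add_right scaleR_scaleR by (simp flip: exp_add)
      then show ?thesis
        unfolding \<psi>_def by (simp add: scaleR_diff_right algebra_simps power2_eq_square flip: scaleR_add_left)
    qed
    ultimately show ?thesis by simp
  qed
  have w: "wave c \<phi> \<psi>" using d\<phi> d\<psi> by (simp add: wave_def)
  have v_top: "(v \<longlongrightarrow> 0) at_top" and v_bot: "(v \<longlongrightarrow> 0) at_bot" by (rule sobolev_tendsto[OF v(1)])+
  have norm\<phi>: "norm (\<phi> x - e) = exp (- (c / 2) * x) * norm (v x)" for x unfolding \<phi>_def by (rule norm_profile)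
  have E_top: "((\<lambda>x. exp (- (c / 2) * x)) \<longlongrightarrow> 0) at_top" by (rule exp_tendsto_0_at_top) (use c in simp)
  have top: "(\<phi> \<longlongrightarrow> e) at_top"
  proof -
    have "((\<lambda>x. e + exp (- (c / 2) * x) *\<^sub>R v x) \<longlongrightarrow> e + 0 *\<^sub>R 0) at_top" by (intro tendsto_intros E_top v_top)
    then show ?thesis by (simp add: \<phi>_def profile_def[abs_def])
  qed
  have bot: "((\<lambda>x. exp (c * x) * (norm (\<phi> x))\<^sup>2) \<longlongrightarrow> 0) at_bot"
  proof (rule tendsto_sandwich[OF _ _ tendsto_const])
    show "eventually (\<lambda>x. 0 \<le> exp (c * x) * (norm (\<phi> x))\<^sup>2) at_bot" by simp
    have le: "exp (c * x) * (norm (\<phi> x))\<^sup>2 \<le> 2 * (norm (v x))\<^sup>2 + exp (c * x) * (2 * (norm e)\<^sup>2)" for x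
    proof -
      have "(norm (\<phi> x))\<^sup>2 \<le> 2 * (norm (\<phi> x - e))\<^sup>2 + 2 * (norm e)\<^sup>2" using norm_add_sq_le[of "\<phi> x - e" e] by simp
      then have "exp (c * x) * (norm (\<phi> x))\<^sup>2 \<le> exp (c * x) * (2 * (norm (\<phi> x - e))\<^sup>2 + 2 * (norm e)\<^sup>2)" by (intro mult_left_mono) auto
      also have "\<dots> = 2 * (exp (c * x) * (norm (\<phi> x - e))\<^sup>2) + exp (c * x) * (2 * (norm e)\<^sup>2)" by (simp add: algebra_simps)
      finally show ?thesis unfolding \<phi>_def weight_cancel .
    qed
    then show "eventually (\<lambda>x. exp (c * x) * (norm (\<phi> x))\<^sup>2 \<le> 2 * (norm (v x))\<^sup>2 + exp (c * x) * (2 * (norm e)\<^sup>2)) at_bot" by simp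
    have ex0: "((\<lambda>x. exp (c * x)) \<longlongrightarrow> 0) at_bot"
      by (rule exp_tendsto_0_at_bot[OF c])
    have "((\<lambda>x. 2 * (norm (v x))\<^sup>2 + exp (c * x) * (2 * (norm e)\<^sup>2)) \<longlongrightarrow> 2 * (norm (0 :: real ^ 'n))\<^sup>2 + 0 * (2 * (norm e)\<^sup>2)) at_bot"
      by (intro tendsto_intros v_bot ex0)
    then show "((\<lambda>x. 2 * (norm (v x))\<^sup>2 + exp (c * x) * (2 * (norm e)\<^sup>2)) \<longlongrightarrow> 0) at_bot" by simp
  qed
  obtain R where R: "\<And>x. norm (\<phi> x) \<le> R" by (rule wave_bounded[OF w c top bot]) blast
  have R': "norm (\<phi> x - e) \<le> R + norm e" for x using R[of x] norm_triangle_ineq4[of "\<phi> x" e] by simp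
  have ne: "\<phi> 0 \<noteq> e" using v(4) norm\<phi>[of 0] by auto
  obtain h where h: "h < 0" "critical_points_at_level V h \<noteq> {}"
    "((\<lambda>x. infdist (\<phi> x) (critical_points_at_level V h)) \<longlongrightarrow> 0) at_bot"
    by (rule wave_converges_to_critical_level[OF w c R' top ne])
  have nonconst: "\<exists>y. \<phi> 0 \<noteq> \<phi> y"
  proof (rule ccontr)
    assume "\<not> ?thesis"
    then have "\<phi> x = \<phi> 0" for x by metis
    then have "\<phi> = (\<lambda>x. \<phi> 0)" by (rule ext)
    then have "(\<phi> \<longlongrightarrow> \<phi> 0) at_top" by (metis tendsto_const)
    then show False using top ne tendsto_unique trivial_limit_at_top_linorder by blast
  qed
  have "wave_solution V c UNIV \<phi>" unfolding wave_solution_def using d\<phi> d\<psi> by blast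
  then have "maximal_wave_solution V c UNIV \<phi>"
    unfolding maximal_wave_solution_def by auto
  then have front: "travelling_front_profile V e c \<phi>"
    unfolding travelling_front_profile_def travelling_wave_profile_def using c top nonconst h by auto
  have "(\<lambda>x. norm (\<phi> x - e)) \<in> o[at_top](\<lambda>x. exp (- c * x / 2))"
  proof (rule smalloI_tendsto)
    have "norm (\<phi> x - e) / exp (- c * x / 2) = norm (v x)" for x unfolding norm\<phi> by simp
    then show "((\<lambda>x. norm (\<phi> x - e) / exp (- c * x / 2)) \<longlongrightarrow> 0) at_top"
      using tendsto_norm[OF v_top] by simp
  qed simp
  then have "pushed_front_profile V e c \<phi>" using front by (simp add: pushed_front_profile_def)
  then show ?thesis unfolding c_def by blast
qed

end

section \<open>The energy of pushed fronts\<close>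

lemma exp_two_sided_integrable:
  assumes "(k::real) > 0" shows "integrable lebesgue (\<lambda>x::real. exp (- k * \<bar>x\<bar>))"
proof (rule Bochner_Integration.integrable_bound)
  show "integrable lebesgue (\<lambda>x::real. indicator {..0} x * exp (k * x) + indicator {0..} x * exp (- k * x) :: real)"
    by (intro Bochner_Integration.integrable_add exp_left_integral(1) exp_right_integrable assms)
  show "(\<lambda>x::real. exp (- k * \<bar>x\<bar>)) \<in> borel_measurable lebesgue"
    by (intro continuous_lebesgue_measurable continuous_intros)
  show "AE x::real in lebesgue. norm (exp (- k * \<bar>x\<bar>)) \<le> norm (indicator {..0} x * exp (k * x) + indicator {0..} x * exp (- k * x) :: real)"
    by (intro AE_I2) (auto simp: indicator_def)
qed

lemma two_sided_bound:
  fixes a b :: "real \<Rightarrow> real"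
  assumes R: "\<And>x. \<bar>a x\<bar> \<le> R" "\<And>x. \<bar>b x\<bar> \<le> R" and M: "\<And>x. x \<ge> x0 \<Longrightarrow> \<bar>a x\<bar> \<le> M * exp (- \<alpha> * x)" "\<And>x. x \<ge> x0 \<Longrightarrow> \<bar>b x\<bar> \<le> M * exp (- \<alpha> * x)"
    and c: "0 < c" "c < 2 * \<alpha>" and x0: "x0 \<ge> 0"
  obtains k M' where "k > 0" "\<And>x. exp (c * x) * ((a x)\<^sup>2 + (b x)\<^sup>2) \<le> M' * exp (- k * \<bar>x\<bar>)"
proof -
  \<comment> \<open>\<open>c\<close> is the rate of the weight at \<open>-\<infinity>\<close>, \<open>2 \<alpha> - c\<close> that of the weighted squares at \<open>+\<infinity>\<close>\<close>
  define k where "k = min c (2 * \<alpha> - c)"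
  have k: "k > 0" "k \<le> c" "k \<le> 2 * \<alpha> - c" using c by (auto simp: k_def)
  define M1 where "M1 = 2 * R\<^sup>2 * exp ((c + k) * x0)"
  have M10: "M1 \<ge> 0" "2 * M\<^sup>2 \<ge> 0" by (auto simp: M1_def)
  have ab: "(a x)\<^sup>2 + (b x)\<^sup>2 \<le> 2 * R\<^sup>2" for x
    using power_mono[OF R(1)[of x], of 2] power_mono[OF R(2)[of x], of 2] by simp
  have "exp (c * x) * ((a x)\<^sup>2 + (b x)\<^sup>2) \<le> (M1 + 2 * M\<^sup>2) * exp (- k * \<bar>x\<bar>)" for x
  proof (cases "x \<ge> x0")
    case True
    have "(a x)\<^sup>2 \<le> (M * exp (- \<alpha> * x))\<^sup>2" "(b x)\<^sup>2 \<le> (M * exp (- \<alpha> * x))\<^sup>2"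
      using power_mono[OF M(1)[OF True], of 2] power_mono[OF M(2)[OF True], of 2] by auto
    then have "exp (c * x) * ((a x)\<^sup>2 + (b x)\<^sup>2) \<le> exp (c * x) * (2 * (M * exp (- \<alpha> * x))\<^sup>2)"
      by (intro mult_left_mono) auto
    also have "\<dots> = 2 * M\<^sup>2 * exp ((c - 2 * \<alpha>) * x)"
      by (simp add: power_mult_distrib power2_eq_square algebra_simps flip: exp_add)
    also have "\<dots> \<le> 2 * M\<^sup>2 * exp (- k * \<bar>x\<bar>)"
    proof -
      have "(c - 2 * \<alpha>) * x \<le> (- k) * x" using k True x0 by (intro mult_right_mono) auto
      then show ?thesis using True x0 by (intro mult_left_mono) auto
    qed
    also have "\<dots> \<le> (M1 + 2 * M\<^sup>2) * exp (- k * \<bar>x\<bar>)" using M10 by (intro mult_right_mono) auto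
    finally show ?thesis .
  next
    case False
    have "c * x \<le> (c + k) * x0 - k * \<bar>x\<bar>"
    proof (cases "x \<ge> 0")
      case True
      have "(c + k) * x \<le> (c + k) * x0" using False k c by (intro mult_left_mono) auto
      then show ?thesis using True by (simp add: algebra_simps)
    next
      case xn: False
      have "c * x \<le> k * x" using xn k by (intro mult_right_mono_neg) auto
      moreover have "(c + k) * x0 \<ge> 0" using k c x0 by simp
      moreover have "k * \<bar>x\<bar> = - (k * x)" using xn by simp
      ultimately show ?thesis by argo
    qed
    then have E: "exp (c * x) \<le> exp ((c + k) * x0) * exp (- k * \<bar>x\<bar>)" by (simp flip: exp_add)
    have "exp (c * x) * ((a x)\<^sup>2 + (b x)\<^sup>2) \<le> (exp ((c + k) * x0) * exp (- k * \<bar>x\<bar>)) * (2 * R\<^sup>2)"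
      by (rule mult_mono[OF E ab]) auto
    also have "\<dots> = M1 * exp (- k * \<bar>x\<bar>)" by (simp add: M1_def)
    also have "\<dots> \<le> (M1 + 2 * M\<^sup>2) * exp (- k * \<bar>x\<bar>)" using M10 by (intro mult_right_mono) auto
    finally show ?thesis .
  qed
  then show ?thesis using that k(1) by blast
qed

context invaded_potential
begin

text \<open>Integrate the derivative of \<open>Y = exp (c' x) (\<bar>\<psi>\<bar>\<^sup>2 / 2 - V \<phi>)\<close>, which vanishes at both ends.\<close>
lemma wave_energy:
  assumes w: "wave c \<phi> \<psi>" and c': "c' > 0" and R: "\<And>x. norm (\<phi> x - e) \<le> R" and k: "k > 0"
    and M: "\<And>x. exp (c' * x) * ((norm (\<phi> x - e))\<^sup>2 + (norm (\<psi> x))\<^sup>2) \<le> M * exp (- k * \<bar>x\<bar>)"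
  obtains v g where "sobolev v g" "profile e c' v = \<phi>" "integrable lebesgue (dens c' v g)"
    "integrable lebesgue (\<lambda>x. exp (c' * x) * (norm (\<psi> x))\<^sup>2)"
    "c' * (LINT x|lebesgue. dens c' v g x) = - (c - c') * (LINT x|lebesgue. exp (c' * x) * (norm (\<psi> x))\<^sup>2)"
proof -
  define E where "E x = exp (- k * \<bar>x\<bar>)" for x :: real
  have E_int: "integrable lebesgue (\<lambda>x. r * E x)" for r using exp_two_sided_integrable[OF k] by (simp add: E_def)
  have pos: "0 \<le> exp (c' * x) * (norm (\<phi> x - e))\<^sup>2" "0 \<le> exp (c' * x) * (norm (\<psi> x))\<^sup>2" for x by simp_all
  have M1: "exp (c' * x) * (norm (\<phi> x - e))\<^sup>2 \<le> M * E x" "exp (c' * x) * (norm (\<psi> x))\<^sup>2 \<le> M * E x" for x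
    using M[of x] pos[of x] unfolding E_def distrib_left by argo+
  have ME: "0 \<le> M * E x" for x by (rule order_trans[OF pos(1) M1(1)])
  define v where "v x = exp ((c'/2) * x) *\<^sub>R (\<phi> x - e)" for x
  define g where "g x = exp ((c'/2) * x) *\<^sub>R (\<psi> x + (c'/2) *\<^sub>R (\<phi> x - e))" for x
  have sq: "(exp ((c'/2) * x))\<^sup>2 = exp (c' * x)" for x by (simp add: power2_eq_square flip: exp_add)
  have \<phi>_cont: "continuous_on UNIV \<phi>" and \<psi>_cont: "continuous_on UNIV \<psi>" by (rule waveD[OF w])+
  have dE: "((\<lambda>x. exp ((c'/2) * x)) has_real_derivative (c'/2) * exp ((c'/2) * x)) (at x)" for x
    by (auto intro!: derivative_eq_intros)
  have ac: "abs_cont v g"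
  proof (rule abs_cont_C1)
    fix x
    have d\<phi>: "((\<lambda>x. \<phi> x - e) has_vector_derivative \<psi> x) (at x)"
      using has_vector_derivative_diff[OF waveD(1)[OF w] has_vector_derivative_const[of e]] by simp
    have "(v has_vector_derivative exp ((c'/2) * x) *\<^sub>R \<psi> x + ((c'/2) * exp ((c'/2) * x)) *\<^sub>R (\<phi> x - e)) (at x)"
      unfolding v_def by (rule has_vector_derivative_scaleR[OF dE d\<phi>])
    then show "(v has_vector_derivative g x) (at x)" by (simp add: g_def scaleR_add_right mult.commute)
  next
    show "continuous_on UNIV g" unfolding g_def by (intro continuous_intros \<phi>_cont \<psi>_cont)
  qed
  have v_m: "v \<in> borel_measurable lebesgue" by (rule continuous_lebesgue_measurable[OF abs_cont_continuous[OF ac]])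
  have g_m: "g \<in> borel_measurable lebesgue"
    unfolding g_def by (intro continuous_lebesgue_measurable continuous_intros \<phi>_cont \<psi>_cont)
  have Lv: "L2 v"
  proof (rule L2_bounded_by[OF v_m E_int])
    show "(norm (v x))\<^sup>2 \<le> M * E x" for x
      using M1(1)[of x] unfolding v_def norm_scaleR power_mult_distrib power2_abs sq .
  qed
  have Lg: "L2 g"
  proof (rule L2_bounded_by[OF g_m E_int])
    fix x
    have "(norm (\<psi> x + (c'/2) *\<^sub>R (\<phi> x - e)))\<^sup>2 \<le> 2 * (norm (\<psi> x))\<^sup>2 + c'\<^sup>2 / 2 * (norm (\<phi> x - e))\<^sup>2"
      using norm_add_sq_le[of "\<psi> x" "(c'/2) *\<^sub>R (\<phi> x - e)"] by (simp add: power_mult_distrib power_divide)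
    then have "(norm (g x))\<^sup>2 \<le> exp (c' * x) * (2 * (norm (\<psi> x))\<^sup>2 + c'\<^sup>2 / 2 * (norm (\<phi> x - e))\<^sup>2)"
      unfolding g_def norm_scaleR power_mult_distrib power2_abs sq by (intro mult_left_mono) auto
    also have "\<dots> = 2 * (exp (c' * x) * (norm (\<psi> x))\<^sup>2) + c'\<^sup>2 / 2 * (exp (c' * x) * (norm (\<phi> x - e))\<^sup>2)" by (simp add: algebra_simps)
    also have "\<dots> \<le> 2 * (M * E x) + c'\<^sup>2 / 2 * (M * E x)" by (intro add_mono mult_left_mono M1) auto
    also have "\<dots> = ((2 + c'\<^sup>2 / 2) * M) * E x" by (simp add: algebra_simps)
    finally show "(norm (g x))\<^sup>2 \<le> ((2 + c'\<^sup>2 / 2) * M) * E x" .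
  qed
  have sob: "sobolev v g" using Lv Lg ac by (simp add: sobolev_def)
  have pr: "profile e c' v = \<phi>"
  proof
    fix x
    have "exp (- (c'/2) * x) * exp ((c'/2) * x) = 1" by (simp flip: exp_add)
    then show "profile e c' v x = \<phi> x" unfolding profile_def v_def scaleR_scaleR by simp
  qed
  have gv: "g x - (c'/2) *\<^sub>R v x = exp ((c'/2) * x) *\<^sub>R \<psi> x" for x
    by (simp add: g_def v_def scaleR_add_right mult.commute)
  have dens_eq: "dens c' v g x = exp (c' * x) * ((norm (\<psi> x))\<^sup>2 / 2 + V (\<phi> x))" for x
    unfolding dens_def gv pr norm_scaleR power_mult_distrib power2_abs sq by (simp add: distrib_left)
  obtain K where K: "K > 0" "\<And>u. u \<in> cball e R \<Longrightarrow> \<bar>V u\<bar> \<le> K * (norm (u - e))\<^sup>2" by (rule V_quadratic_bound[of R]) blast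
  have V_bd: "exp (c' * x) * \<bar>V (\<phi> x)\<bar> \<le> K * (M * E x)" for x
  proof -
    have "\<bar>V (\<phi> x)\<bar> \<le> K * (norm (\<phi> x - e))\<^sup>2" by (rule K(2)) (use R[of x] in \<open>simp add: dist_norm norm_minus_commute\<close>)
    then have "exp (c' * x) * \<bar>V (\<phi> x)\<bar> \<le> exp (c' * x) * (K * (norm (\<phi> x - e))\<^sup>2)" by (intro mult_left_mono) auto
    also have "\<dots> = K * (exp (c' * x) * (norm (\<phi> x - e))\<^sup>2)" by simp
    also have "\<dots> \<le> K * (M * E x)" using K(1) by (intro mult_left_mono M1) auto
    finally show ?thesis .
  qed
  have pm_bd: "\<bar>exp (c' * x) * ((norm (\<psi> x))\<^sup>2 / 2 + s * V (\<phi> x))\<bar> \<le> ((1 + K) * M) * E x" if s: "\<bar>s\<bar> = 1" for s x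
  proof -
    have "\<bar>exp (c' * x) * ((norm (\<psi> x))\<^sup>2 / 2 + s * V (\<phi> x))\<bar> \<le> exp (c' * x) * ((norm (\<psi> x))\<^sup>2 + \<bar>V (\<phi> x)\<bar>)"
      unfolding abs_mult[of "exp (c' * x)"] abs_exp_cancel
    proof (intro mult_left_mono)
      have "\<bar>(norm (\<psi> x))\<^sup>2 / 2 + s * V (\<phi> x)\<bar> \<le> \<bar>(norm (\<psi> x))\<^sup>2 / 2\<bar> + \<bar>s * V (\<phi> x)\<bar>" by (rule abs_triangle_ineq)
      also have "\<dots> \<le> (norm (\<psi> x))\<^sup>2 + \<bar>V (\<phi> x)\<bar>" using s by (simp add: abs_mult)
      finally show "\<bar>(norm (\<psi> x))\<^sup>2 / 2 + s * V (\<phi> x)\<bar> \<le> (norm (\<psi> x))\<^sup>2 + \<bar>V (\<phi> x)\<bar>" .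
    qed simp
    also have "\<dots> \<le> M * E x + K * (M * E x)" unfolding distrib_left by (intro add_mono M1 V_bd)
    finally show ?thesis by (simp add: algebra_simps)
  qed
  have d_int: "integrable lebesgue (dens c' v g)"
  proof (rule Bochner_Integration.integrable_bound[OF E_int dens_measurable[OF v_m g_m]])
    show "AE x in lebesgue. norm (dens c' v g x) \<le> norm (((1 + K) * M) * E x)"
      using pm_bd[of 1] unfolding dens_eq by (intro AE_I2) (auto intro: order_trans[OF _ abs_ge_self])
  qed
  have psi_m: "(\<lambda>x. exp (c' * x) * (norm (\<psi> x))\<^sup>2) \<in> borel_measurable lebesgue"
    by (intro continuous_lebesgue_measurable continuous_intros \<psi>_cont)
  have psi_int: "integrable lebesgue (\<lambda>x. exp (c' * x) * (norm (\<psi> x))\<^sup>2)"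
    by (rule Bochner_Integration.integrable_bound[OF E_int[of M] psi_m]) (use M1(2) ME in \<open>auto intro!: AE_I2\<close>)
  define Y where "Y x = exp (c' * x) * ((\<psi> x \<bullet> \<psi> x) / 2 - V (\<phi> x))" for x
  define D where "D x = - c' * dens c' v g x - (c - c') * (exp (c' * x) * (norm (\<psi> x))\<^sup>2)" for x
  note dL = wave_lyapunov[OF w]
  have dexp: "((\<lambda>x. exp (c' * x)) has_real_derivative c' * exp (c' * x)) (at x)" for x by (auto intro!: derivative_eq_intros)
  have dY: "(Y has_real_derivative D x) (at x)" for x
    unfolding Y_def
    by (rule DERIV_cong[OF DERIV_mult[OF dexp dL]])
      (simp add: D_def dens_eq power2_norm_eq_inner field_simps)
  have Y_int: "integral {- real n..real n} D = Y (real n) - Y (- real n)" for n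
    by (rule integral_unique, rule fundamental_theorem_of_calculus)
      (use dY in \<open>auto simp: has_real_derivative_iff_has_vector_derivative[symmetric] intro: DERIV_subset\<close>)
  have Y_bd: "\<bar>Y x\<bar> \<le> ((1 + K) * M) * E x" for x using pm_bd[of "-1" x] by (simp add: Y_def power2_norm_eq_inner)
  have E_lim: "(\<lambda>n. E (real n)) \<longlonglongrightarrow> 0"
    using filterlim_compose[OF exp_tendsto_0_at_top[OF k] filterlim_real_sequentially] by (simp add: E_def)
  have Y_lim: "(\<lambda>n. Y (s * real n)) \<longlonglongrightarrow> 0" if "\<bar>s\<bar> = 1" for s
  proof (rule Lim_null_comparison)
    have "E (s * real n) = E (real n)" for n using that by (simp add: E_def abs_mult)
    then show "eventually (\<lambda>n. norm (Y (s * real n)) \<le> ((1 + K) * M) * E (real n)) sequentially"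
      using Y_bd by (metis (no_types, lifting) always_eventually real_norm_def)
    show "(\<lambda>n. ((1 + K) * M) * E (real n)) \<longlonglongrightarrow> 0" using tendsto_mult_left[OF E_lim, of "(1 + K) * M"] by simp
  qed
  have D_int: "integrable lebesgue D" unfolding D_def using d_int psi_int by simp
  have "(\<lambda>n. integral {- real n..real n} D) \<longlonglongrightarrow> 0 - 0"
    unfolding Y_int using tendsto_diff[OF Y_lim[of 1] Y_lim[of "-1"]] by simp
  then have "(LINT x|lebesgue. D x) = 0" using LINT_limit_of_intervals[OF D_int] LIMSEQ_unique by fastforce
  moreover have "(LINT x|lebesgue. D x) = - c' * (LINT x|lebesgue. dens c' v g x) - (c - c') * (LINT x|lebesgue. exp (c' * x) * (norm (\<psi> x))\<^sup>2)"
    unfolding D_def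
    by (subst Bochner_Integration.integral_diff) (use d_int psi_int in auto)
  ultimately have "c' * (LINT x|lebesgue. dens c' v g x) = - (c - c') * (LINT x|lebesgue. exp (c' * x) * (norm (\<psi> x))\<^sup>2)" by argo
  then show ?thesis using that[OF sob pr d_int psi_int] by blast
qed

lemma wave_kinetic_positive:
  assumes w: "wave c \<phi> \<psi>" and int: "integrable lebesgue (\<lambda>x. exp (c' * x) * (norm (\<psi> x))\<^sup>2)" and ne: "\<phi> x1 \<noteq> \<phi> x2"
  shows "(LINT x|lebesgue. exp (c' * x) * (norm (\<psi> x))\<^sup>2) > 0"
proof (rule ccontr)
  assume "\<not> ?thesis"
  moreover have "(LINT x|lebesgue. exp (c' * x) * (norm (\<psi> x))\<^sup>2) \<ge> 0" by simp
  ultimately have "(LINT x|lebesgue. exp (c' * x) * (norm (\<psi> x))\<^sup>2) = 0" by simp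
  then have "AE x in lebesgue. exp (c' * x) * (norm (\<psi> x))\<^sup>2 = 0"
    using integral_nonneg_eq_0_iff_AE[OF int] by simp
  then have "AE x in lebesgue. \<psi> x = 0" by simp
  then have "\<psi> = (\<lambda>x. 0)" by (intro AE_continuous_eq[OF waveD(4)[OF w]]) auto
  then have "norm (\<phi> y - \<phi> x) \<le> 0 * (y - x)" if "x \<le> y" for x y
    by (intro lipschitz_of_derivative[OF waveD(1)[OF w] _ that]) simp
  then have "\<phi> y = \<phi> x" if "x \<le> y" for x y using that by simp
  then show False using ne by (metis linear)
qed

text \<open>Put \<open>p = \<bar>v\<bar>\<^sup>2\<close> for \<open>v = exp (c x / 2) (\<phi> - e)\<close>. Near \<open>e\<close> one has \<open>p'' \<ge> k\<^sup>2 p\<close> with \<open>k > 0\<close>, since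
  \<open>c > c_lin\<close>. For \<open>y = p' + k p\<close> this reads \<open>y' \<ge> k y\<close>, so a positive value of \<open>y\<close> would make \<open>p\<close> grow
  like \<open>exp (k x)\<close>; as \<open>p\<close> tends to 0, \<open>y \<le> 0\<close> and \<open>exp (k x) p\<close> is nonincreasing.\<close>
lemma wave_fast_decay:
  assumes w: "wave c \<phi> \<psi>" and c: "c > c_lin V e" and top: "(\<phi> \<longlongrightarrow> e) at_top"
    and small: "((\<lambda>x. exp ((c/2) * x) * norm (\<phi> x - e)) \<longlongrightarrow> 0) at_top"
  obtains M \<alpha> x0 where "\<alpha> > c/2" "x0 \<ge> 0" "\<And>x. x \<ge> x0 \<Longrightarrow> norm (\<phi> x - e) \<le> M * exp (- \<alpha> * x)"
proof -
  obtain \<delta> \<epsilon> where \<delta>: "\<delta> > 0" and \<epsilon>: "\<epsilon> > 0"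
    and near: "\<And>u. norm (u - e) \<le> \<delta> \<Longrightarrow> \<epsilon> * (norm (u - e))\<^sup>2 \<le> grad V u \<bullet> (u - e) + c\<^sup>2/4 * (norm (u - e))\<^sup>2"
    by (rule V_near_e[OF c]) blast
  define k where "k = sqrt (2 * \<epsilon>)"
  have k: "k > 0" "k\<^sup>2 = 2 * \<epsilon>" using \<epsilon> by (auto simp: k_def)
  define p where "p x = exp (c * x) * ((\<phi> x - e) \<bullet> (\<phi> x - e))" for x
  define p1 where "p1 x = exp (c * x) * (2 * ((\<phi> x - e) \<bullet> \<psi> x) + c * ((\<phi> x - e) \<bullet> (\<phi> x - e)))" for x
  define p2 where "p2 x = exp (c * x) * (2 * (\<psi> x \<bullet> \<psi> x) + 2 * c * ((\<phi> x - e) \<bullet> \<psi> x)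
      + 2 * (grad V (\<phi> x) \<bullet> (\<phi> x - e)) + c\<^sup>2 * ((\<phi> x - e) \<bullet> (\<phi> x - e)))" for x
  have d\<phi>: "((\<lambda>x. \<phi> x - e) has_vector_derivative \<psi> x) (at x)" for x
    using has_vector_derivative_diff[OF waveD(1)[OF w] has_vector_derivative_const[of e]] by simp
  have d1: "((\<lambda>x. (\<phi> x - e) \<bullet> (\<phi> x - e)) has_real_derivative 2 * ((\<phi> x - e) \<bullet> \<psi> x)) (at x)" for x
    unfolding has_real_derivative_iff_has_vector_derivative
    by (rule has_vector_derivative_eq_rhs[OF bounded_bilinear.has_vector_derivative[OF bounded_bilinear_inner d\<phi> d\<phi>]])
      (simp add: inner_commute)
  have d2: "((\<lambda>x. (\<phi> x - e) \<bullet> \<psi> x) has_real_derivative ((\<phi> x - e) \<bullet> (- c *\<^sub>R \<psi> x + grad V (\<phi> x)) + \<psi> x \<bullet> \<psi> x)) (at x)" for x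
    unfolding has_real_derivative_iff_has_vector_derivative
    by (rule bounded_bilinear.has_vector_derivative[OF bounded_bilinear_inner d\<phi> waveD(2)[OF w]])
  have dexp: "((\<lambda>x. exp (c * x)) has_real_derivative c * exp (c * x)) (at x)" for x by (auto intro!: derivative_eq_intros)
  have dp: "(p has_real_derivative p1 x) (at x)" for x
    unfolding p_def by (rule DERIV_cong[OF DERIV_mult[OF dexp d1]]) (simp add: p1_def algebra_simps)
  have dp1: "(p1 has_real_derivative p2 x) (at x)" for x
    unfolding p1_def
    by (rule DERIV_cong[OF DERIV_mult[OF dexp DERIV_add[OF DERIV_cmult[OF d2] DERIV_cmult[OF d1]]]])
      (simp add: p2_def inner_add_right inner_diff_right inner_commute[of "grad V (\<phi> x)"] power2_eq_square algebra_simps)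
  have p_norm: "p x = (exp ((c/2) * x) * norm (\<phi> x - e))\<^sup>2" for x
    unfolding p_def power_mult_distrib power2_norm_eq_inner by (simp add: power2_eq_square flip: exp_add)
  have p0: "p x \<ge> 0" for x unfolding p_norm by simp
  have p_lim: "(p \<longlongrightarrow> 0) at_top" unfolding p_norm using tendsto_power[OF small, of 2] by simp
  have "eventually (\<lambda>x. dist (\<phi> x) e < \<delta>) at_top" by (rule tendstoD[OF top \<delta>])
  then obtain X where X: "\<And>x. x \<ge> X \<Longrightarrow> norm (\<phi> x - e) < \<delta>" unfolding eventually_at_top_linorder dist_norm by blast
  \<comment> \<open>from \<open>x0\<close> on the wave is in the neighbourhood of \<open>e\<close> where the form is positive\<close>
  define x0 where "x0 = max 0 X"
  have p2_ge: "p2 x \<ge> k\<^sup>2 * p x" if x: "x \<ge> x0" for x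
  proof -
    have "norm (\<phi> x - e) \<le> \<delta>" using X[of x] x by (simp add: x0_def less_imp_le)
    note n = near[OF this, unfolded power2_norm_eq_inner]
    have sq: "(a + (c/2) *\<^sub>R u) \<bullet> (a + (c/2) *\<^sub>R u) = a \<bullet> a + c * (u \<bullet> a) + c\<^sup>2 / 4 * (u \<bullet> u)" for a u :: "real ^ 'n"
      unfolding inner_add_left inner_add_right inner_scaleR_left inner_scaleR_right inner_commute[of a u]
      by (simp add: power2_eq_square field_simps)
    have "(\<psi> x + (c/2) *\<^sub>R (\<phi> x - e)) \<bullet> (\<psi> x + (c/2) *\<^sub>R (\<phi> x - e)) \<ge> 0" by simp
    then have s: "2 * (\<psi> x \<bullet> \<psi> x) + 2 * c * ((\<phi> x - e) \<bullet> \<psi> x) + c\<^sup>2 / 2 * ((\<phi> x - e) \<bullet> (\<phi> x - e)) \<ge> 0"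
      unfolding sq by argo
    have "2 * \<epsilon> * ((\<phi> x - e) \<bullet> (\<phi> x - e)) \<le> 2 * (\<psi> x \<bullet> \<psi> x) + 2 * c * ((\<phi> x - e) \<bullet> \<psi> x)
      + 2 * (grad V (\<phi> x) \<bullet> (\<phi> x - e)) + c\<^sup>2 * ((\<phi> x - e) \<bullet> (\<phi> x - e))"
      using n s by argo
    then have "exp (c * x) * (2 * \<epsilon> * ((\<phi> x - e) \<bullet> (\<phi> x - e))) \<le> p2 x" unfolding p2_def by (intro mult_left_mono) auto
    then show ?thesis unfolding k(2) p_def by (simp add: mult_ac)
  qed
  define y where "y x = p1 x + k * p x" for x
  have dy: "(y has_real_derivative p2 x + k * p1 x) (at x)" for x
    unfolding y_def by (intro DERIV_add dp1 DERIV_cmult dp)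
  have dk: "((\<lambda>x. exp (r * x)) has_real_derivative r * exp (r * x)) (at x)" for r x :: real by (auto intro!: derivative_eq_intros)
  have y_mono: "exp (- k * a) * y a \<le> exp (- k * b) * y b" if ab: "x0 \<le> a" "a \<le> b" for a b
  proof (rule DERIV_nonneg_imp_nondecreasing[OF ab(2), of "\<lambda>x. exp (- k * x) * y x"])
    fix x assume x: "a \<le> x" "x \<le> b"
    have d: "((\<lambda>x. exp (- k * x) * y x) has_real_derivative exp (- k * x) * (p2 x - k\<^sup>2 * p x)) (at x)"
      by (rule DERIV_cong[OF DERIV_mult[OF dk dy]]) (simp add: y_def power2_eq_square algebra_simps)
    have "exp (- k * x) * (p2 x - k\<^sup>2 * p x) \<ge> 0" using p2_ge[of x] x ab by simp
    with d show "\<exists>D. ((\<lambda>x. exp (- k * x) * y x) has_real_derivative D) (at x) \<and> D \<ge> 0" by blast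
  qed
  have dkp: "((\<lambda>x. exp (k * x) * p x) has_real_derivative exp (k * x) * y x) (at x)" for x
    by (rule DERIV_cong[OF DERIV_mult[OF dk dp]]) (simp add: y_def algebra_simps)
  have y_neg: "y a \<le> 0" if a: "a \<ge> x0" for a
  proof (rule ccontr)
    assume "\<not> y a \<le> 0"
    define r where "r = exp (- k * a) * y a"
    have r: "r > 0" using \<open>\<not> y a \<le> 0\<close> by (simp add: r_def)
    define W where "W x = exp (k * x) * p x - r / (2 * k) * exp ((2 * k) * x)" for x
    have dW: "(W has_real_derivative exp (k * x) * y x - r * exp ((2 * k) * x)) (at x)" for x
      unfolding W_def by (rule DERIV_cong[OF DERIV_diff[OF dkp DERIV_cmult[OF dk]]]) (use k(1) in simp)
    have W_ge: "W a \<le> W b" if b: "a \<le> b" for b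
    proof (rule DERIV_nonneg_imp_nondecreasing[OF b])
      fix x assume x: "a \<le> x" "x \<le> b"
      have "exp ((2 * k) * x) * r \<le> exp ((2 * k) * x) * (exp (- k * x) * y x)"
        unfolding r_def by (intro mult_left_mono y_mono a x) simp
      also have "\<dots> = exp (k * x) * y x" unfolding mult.assoc[symmetric] by (simp flip: exp_add)
      finally show "\<exists>D. (W has_real_derivative D) (at x) \<and> D \<ge> 0" using dW[of x] by (intro exI conjI) (auto simp: mult.commute)
    qed
    have low: "exp (- (2 * k) * x) * W a + r / (2 * k) \<le> exp (- k * x) * p x" if x: "a \<le> x" for x
    proof -
      have "exp (- (2 * k) * x) * W a \<le> exp (- (2 * k) * x) * W x" by (intro mult_left_mono W_ge x) simp
      also have "\<dots> = (exp (- (2 * k) * x) * exp (k * x)) * p x - r / (2 * k) * (exp (- (2 * k) * x) * exp ((2 * k) * x))"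
        by (simp add: W_def algebra_simps)
      also have "\<dots> = exp (- k * x) * p x - r / (2 * k)" by (simp flip: exp_add)
      finally show ?thesis by simp
    qed
    have "((\<lambda>x. exp (- (2 * k) * x) * W a + r / (2 * k)) \<longlongrightarrow> 0 * W a + r / (2 * k)) at_top"
      by (intro tendsto_intros exp_tendsto_0_at_top) (use k in simp)
    moreover have "((\<lambda>x. exp (- k * x) * p x) \<longlongrightarrow> 0 * 0) at_top" by (intro tendsto_intros exp_tendsto_0_at_top p_lim k)
    ultimately have "0 * W a + r / (2 * k) \<le> 0 * 0"
      by (intro tendsto_le[OF trivial_limit_at_top_linorder]) (use low in \<open>auto simp: eventually_at_top_linorder\<close>)
    moreover have "r / (2 * k) > 0" using r k(1) by simp
    ultimately show False by simp
  qed
  have decay: "norm (\<phi> x - e) \<le> sqrt (exp (k * x0) * p x0) * exp (- ((c + k) / 2) * x)" if x: "x \<ge> x0" for x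
  proof -
    have "exp (k * x) * p x \<le> exp (k * x0) * p x0"
    proof (rule DERIV_nonpos_imp_nonincreasing[OF x, of "\<lambda>x. exp (k * x) * p x"])
      fix z assume z: "x0 \<le> z" "z \<le> x"
      have "exp (k * z) * y z \<le> 0" using y_neg[OF z(1)] by (simp add: mult_nonneg_nonpos)
      then show "\<exists>D. ((\<lambda>x. exp (k * x) * p x) has_real_derivative D) (at z) \<and> D \<le> 0" using dkp by blast
    qed
    moreover have "exp (k * x) * p x = (exp (((c + k) / 2) * x) * norm (\<phi> x - e))\<^sup>2"
    proof -
      have "exp (k * x) * p x = (exp (k * x) * (exp ((c/2) * x))\<^sup>2) * (norm (\<phi> x - e))\<^sup>2" by (simp add: p_norm power_mult_distrib)
      also have "exp (k * x) * (exp ((c/2) * x))\<^sup>2 = (exp (((c + k) / 2) * x))\<^sup>2"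
        by (simp add: power2_eq_square field_simps flip: exp_add)
      finally show ?thesis by (simp add: power_mult_distrib)
    qed
    ultimately have "exp (((c + k) / 2) * x) * norm (\<phi> x - e) \<le> sqrt (exp (k * x0) * p x0)" by (simp add: real_le_rsqrt)
    then have le: "exp (- ((c + k) / 2) * x) * (exp (((c + k) / 2) * x) * norm (\<phi> x - e)) \<le> exp (- ((c + k) / 2) * x) * sqrt (exp (k * x0) * p x0)"
      by (intro mult_left_mono) auto
    have eq: "exp (- ((c + k) / 2) * x) * (exp (((c + k) / 2) * x) * norm (\<phi> x - e)) = norm (\<phi> x - e)"
      unfolding mult.assoc[symmetric] by (simp flip: exp_add)
    show ?thesis using le unfolding eq by (simp only: mult.commute)
  qed
  show ?thesis by (rule that[of "(c + k) / 2" x0, OF _ _ decay]) (use k x0_def in auto)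
qed

lemma pushed_front_wave:
  assumes pf: "pushed_front_profile V e c \<phi>"
  obtains \<psi> R x1 x2 where "c > 0" "wave c \<phi> \<psi>" "\<And>x. norm (\<phi> x - e) \<le> R" "(\<phi> \<longlongrightarrow> e) at_top" "\<phi> x1 \<noteq> \<phi> x2"
    "((\<lambda>x. exp ((c/2) * x) * norm (\<phi> x - e)) \<longlongrightarrow> 0) at_top"
proof -
  have UN: "{x. - \<infinity> < ereal x} = UNIV" by auto
  have c: "c > 0" and sol: "wave_solution V c UNIV \<phi>" and top: "(\<phi> \<longlongrightarrow> e) at_top" and ne: "\<exists>x y. \<phi> x \<noteq> \<phi> y"
    and o: "(\<lambda>x. norm (\<phi> x - e)) \<in> o[at_top](\<lambda>x. exp (- c * x / 2))"
    using pf unfolding pushed_front_profile_def travelling_front_profile_def travelling_wave_profile_def maximal_wave_solution_def UN by auto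
  obtain h where h: "critical_points_at_level V h \<noteq> {}" "((\<lambda>x. infdist (\<phi> x) (critical_points_at_level V h)) \<longlongrightarrow> 0) at_bot"
    using pf unfolding pushed_front_profile_def travelling_front_profile_def by blast
  obtain \<psi> where w: "wave c \<phi> \<psi>" using sol unfolding wave_solution_def wave_def by blast
  obtain R0 where R0: "R0 > 0" "\<And>u. norm u \<ge> R0 \<Longrightarrow> u \<bullet> grad V u > 0" by (rule V_coercive_bound) blast
  have crit: "norm u < R0" if "u \<in> critical_points_at_level V h" for u
    using R0(2)[of u] that by (force simp: critical_points_at_level_def)
  have "eventually (\<lambda>x. infdist (\<phi> x) (critical_points_at_level V h) < 1) at_bot"
    by (rule order_tendstoD(2)[OF h(2)]) simp
  then obtain a where a: "\<And>x. x \<le> a \<Longrightarrow> infdist (\<phi> x) (critical_points_at_level V h) < 1" unfolding eventually_at_bot_linorder by blast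
  have left: "norm (\<phi> x - e) \<le> R0 + 1 + norm e" if x: "x \<le> a" for x
  proof -
    have "\<exists>s\<in>critical_points_at_level V h. dist (\<phi> x) s < 1"
    proof (rule ccontr)
      assume "\<not> ?thesis"
      then have "1 \<le> (INF s\<in>critical_points_at_level V h. dist (\<phi> x) s)" by (intro cINF_greatest h(1)) auto
      then show False using a[OF x] by (simp add: infdist_notempty[OF h(1)])
    qed
    then obtain s where s: "s \<in> critical_points_at_level V h" "dist (\<phi> x) s < 1" by blast
    have "norm (\<phi> x - e) \<le> norm (\<phi> x - s) + norm s + norm e"
      using norm_triangle_ineq4[of "\<phi> x" e] norm_triangle_ineq[of "\<phi> x - s" s] by simp
    then show ?thesis using s crit[OF s(1)] by (simp add: dist_norm)
  qed
  have "eventually (\<lambda>x. dist (\<phi> x) e < 1) at_top" by (rule tendstoD[OF top]) simp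
  then obtain b where b: "\<And>x. x \<ge> b \<Longrightarrow> norm (\<phi> x - e) < 1" unfolding eventually_at_top_linorder dist_norm by blast
  have "continuous_on {a..b} (\<lambda>x. \<phi> x - e)" by (intro continuous_intros waveD(3)[OF w])
  then have "bounded ((\<lambda>x. \<phi> x - e) ` {a..b})" by (intro compact_imp_bounded compact_continuous_image) auto
  then obtain B where B: "\<forall>x\<in>{a..b}. norm (\<phi> x - e) \<le> B" unfolding bounded_iff by auto
  have bd: "norm (\<phi> x - e) \<le> max (max B 1) (R0 + 1 + norm e)" for x
  proof -
    consider "x \<le> a" | "x \<in> {a..b}" | "x \<ge> b" by fastforce
    then show ?thesis using left[of x] b[of x] B by cases (auto simp: le_max_iff_disj less_imp_le)
  qed
  have "((\<lambda>x. norm (\<phi> x - e) / exp (- c * x / 2)) \<longlongrightarrow> 0) at_top" by (rule smalloD_tendsto[OF o])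
  moreover have "norm (\<phi> x - e) / exp (- c * x / 2) = exp ((c/2) * x) * norm (\<phi> x - e)" for x
    by (simp add: exp_minus field_simps)
  ultimately have "((\<lambda>x. exp ((c/2) * x) * norm (\<phi> x - e)) \<longlongrightarrow> 0) at_top" by simp
  then show ?thesis using that[OF c w bd top] ne by blast
qed

lemma wave_energy_of_decay:
  assumes w: "wave c \<phi> \<psi>" and c: "c > 0" and c': "0 < c'" "c' < 2 * \<alpha>" and R: "\<And>x. norm (\<phi> x - e) \<le> R"
    and x0: "x0 \<ge> 0" and M: "\<And>x. x \<ge> x0 \<Longrightarrow> norm (\<phi> x - e) \<le> M * exp (- \<alpha> * x)"
  obtains v g where "sobolev v g" "profile e c' v = \<phi>" "integrable lebesgue (dens c' v g)"
    "integrable lebesgue (\<lambda>x. exp (c' * x) * (norm (\<psi> x))\<^sup>2)"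
    "c' * (LINT x|lebesgue. dens c' v g x) = - (c - c') * (LINT x|lebesgue. exp (c' * x) * (norm (\<psi> x))\<^sup>2)"
proof -
  have \<alpha>: "\<alpha> \<ge> 0" using c' by simp
  obtain B where B: "\<And>x. norm (\<psi> x) \<le> B" "\<And>x. norm (- c *\<^sub>R \<psi> x + grad V (\<phi> x)) \<le> B"
    by (rule wave_derivative_bounded[OF w less_imp_le[OF c] R]) blast
  obtain M1 where M1: "\<And>x. x \<ge> x0 + 1 \<Longrightarrow> norm (\<psi> x) \<le> M1 * exp (- \<alpha> * x)"
    by (rule wave_derivative_decay[OF w less_imp_le[OF c] M \<alpha> x0]) blast+
  obtain k M' where k: "k > 0" "\<And>x. exp (c' * x) * ((norm (\<phi> x - e))\<^sup>2 + (norm (\<psi> x))\<^sup>2) \<le> M' * exp (- k * \<bar>x\<bar>)"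
  proof (rule two_sided_bound[of "\<lambda>x. norm (\<phi> x - e)" "max R B" "\<lambda>x. norm (\<psi> x)" "x0 + 1" "max M M1" \<alpha> c'])
    show "\<bar>norm (\<phi> x - e)\<bar> \<le> max R B" "\<bar>norm (\<psi> x)\<bar> \<le> max R B" for x using R[of x] B(1)[of x] by auto
    fix x assume x: "x \<ge> x0 + 1"
    have le: "M * exp (- \<alpha> * x) \<le> max M M1 * exp (- \<alpha> * x)" "M1 * exp (- \<alpha> * x) \<le> max M M1 * exp (- \<alpha> * x)"
      by (intro mult_right_mono; simp)+
    show "\<bar>norm (\<phi> x - e)\<bar> \<le> max M M1 * exp (- \<alpha> * x)" "\<bar>norm (\<psi> x)\<bar> \<le> max M M1 * exp (- \<alpha> * x)"
      using order_trans[OF M[of x] le(1)] order_trans[OF M1[OF x] le(2)] x by simp_all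
  qed (use c' x0 in auto)
  show ?thesis by (rule wave_energy[OF w c'(1) R k]) (rule that)
qed

text \<open>The rate \<open>c / 2\<close> of a pushed front is enough for membership in the weighted spaces of all
  speeds below \<open>c\<close>; the strict sign comes from the kinetic term of a nonconstant wave.\<close>
lemma pushed_front_slower_speeds:
  assumes pf: "pushed_front_profile V e c \<phi>" and c': "0 < c'" "c' < c"
  shows "c' \<in> C_minus_infinity V e"
proof -
  obtain \<psi> R x1 x2 where c: "c > 0" and w: "wave c \<phi> \<psi>" and R: "\<And>x. norm (\<phi> x - e) \<le> R" and ne: "\<phi> x1 \<noteq> \<phi> x2"
    and small: "((\<lambda>x. exp ((c/2) * x) * norm (\<phi> x - e)) \<longlongrightarrow> 0) at_top"
    by (rule pushed_front_wave[OF pf]) blast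
  have "eventually (\<lambda>x. exp ((c/2) * x) * norm (\<phi> x - e) < 1) at_top" by (rule order_tendstoD(2)[OF small]) simp
  then obtain X where X: "\<And>x. x \<ge> X \<Longrightarrow> exp ((c/2) * x) * norm (\<phi> x - e) < 1" unfolding eventually_at_top_linorder by blast
  have M: "norm (\<phi> x - e) \<le> 1 * exp (- (c/2) * x)" if "x \<ge> max 0 X" for x
  proof -
    have le: "exp (- (c/2) * x) * (exp ((c/2) * x) * norm (\<phi> x - e)) \<le> exp (- (c/2) * x) * 1"
      using X[of x] that by (intro mult_left_mono) (auto simp: less_imp_le)
    have eq: "exp (- (c/2) * x) * (exp ((c/2) * x) * norm (\<phi> x - e)) = norm (\<phi> x - e)"
      unfolding mult.assoc[symmetric] by (simp flip: exp_add)
    show ?thesis using le unfolding eq by (simp only: mult.commute)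
  qed
  have c2: "c' < 2 * (c/2)" and x0: "0 \<le> max 0 X" using c' by auto
  obtain v g where v: "sobolev v g" "integrable lebesgue (dens c' v g)"
    "integrable lebesgue (\<lambda>x. exp (c' * x) * (norm (\<psi> x))\<^sup>2)"
    "c' * (LINT x|lebesgue. dens c' v g x) = - (c - c') * (LINT x|lebesgue. exp (c' * x) * (norm (\<psi> x))\<^sup>2)"
    by (rule wave_energy_of_decay[OF w c c'(1) c2 R x0 M]) blast
  have "c' * (LINT x|lebesgue. dens c' v g x) < 0"
    unfolding v(4) using wave_kinetic_positive[OF w v(3) ne] c' by (simp add: mult_neg_pos)
  then have "(LINT x|lebesgue. dens c' v g x) < 0" using c' by (simp add: mult_less_0_iff)
  then have "negative_energy c' v g" using v by (simp add: negative_energy_def)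
  then show ?thesis using C_minus_infinity_iff c' by blast
qed

lemma pushed_front_minimises:
  assumes lt: "c_lin V e < c_nl V e" and pf: "pushed_front_profile V e (c_nl V e) \<phi>"
  shows "global_minimizer V (c_nl V e) e \<phi>"
proof -
  define c where "c = c_nl V e"
  obtain \<psi> R x1 x2 where c: "c > 0" and w: "wave c \<phi> \<psi>" and R: "\<And>x. norm (\<phi> x - e) \<le> R" and top: "(\<phi> \<longlongrightarrow> e) at_top" and "\<phi> x1 \<noteq> \<phi> x2"
    and small: "((\<lambda>x. exp ((c/2) * x) * norm (\<phi> x - e)) \<longlongrightarrow> 0) at_top"
    unfolding c_def by (rule pushed_front_wave[OF pf]) blast
  obtain M \<alpha> x0 where \<alpha>: "\<alpha> > c/2" and x0: "x0 \<ge> 0" and M: "\<And>x. x \<ge> x0 \<Longrightarrow> norm (\<phi> x - e) \<le> M * exp (- \<alpha> * x)"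
    by (rule wave_fast_decay[OF w lt[folded c_def] top small]) blast
  have c2: "c < 2 * \<alpha>" using \<alpha> by simp
  obtain v g where v: "sobolev v g" "profile e c v = \<phi>" "integrable lebesgue (dens c v g)"
    "c * (LINT x|lebesgue. dens c v g x) = - (c - c) * (LINT x|lebesgue. exp (c * x) * (norm (\<psi> x))\<^sup>2)"
    by (rule wave_energy_of_decay[OF w c c c2 R x0 M]) blast
  have zero: "(LINT x|lebesgue. dens c v g x) = 0" using v(4) c by simp
  have "energy V c \<phi> = 0"
    using energy_eq_dens[OF v(1) _ profile_in_H1_affine(2)[OF v(1), of e c]] v zero by (simp add: zero_ereal_def)
  moreover have "0 \<le> energy V c w'" if w': "w' \<in> H1_affine c e" for w'
  proof -
    obtain v' g' where v': "sobolev v' g'" "AE x in lebesgue. w' x = profile e c v' x"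
      "AE x in lebesgue. weak_deriv w' x = exp (- (c / 2) * x) *\<^sub>R (g' x - (c / 2) *\<^sub>R v' x)"
      by (rule H1_affine_profile[OF w'])
    have "\<not> negative_energy c v' g'"
      using c_nl_not_in_C_minus_infinity C_minus_infinity_iff c unfolding c_def by blast
    then show ?thesis
      using energy_eq_dens[OF v'] v'(1) by (auto simp: negative_energy_def zero_ereal_def not_less)
  qed
  moreover have "\<phi> \<in> H1_affine c e" using profile_in_H1_affine(1)[OF v(1), of e c] v(2) by simp
  ultimately show ?thesis by (simp add: global_minimizer_def c_def)
qed

lemma pushed_front_speed_le_c_nl:
  assumes pf: "pushed_front_profile V e c \<phi>"
  shows "c \<le> c_nl V e"
proof (rule dense_le_bounded[of 0])
  show "0 < c" using pf by (simp add: pushed_front_profile_def travelling_front_profile_def travelling_wave_profile_def)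
  show "c' \<le> c_nl V e" if "0 < c'" "c' < c" for c'
    unfolding c_nl_def by (rule cSup_upper[OF pushed_front_slower_speeds[OF pf that] C_minus_infinity_bdd_above])
qed

end

theorem mainTheorem2:
  fixes V :: "real ^ 'n \<Rightarrow> real" and e :: "real ^ 'n"
  assumes "C2 V"
    and "coercive V"
    and "grad V e = 0"
    and "V e = 0"
    and "\<exists>m. (\<forall>u. V m \<le> V u) \<and> V m < 0"
  shows "(c_lin V e < c_nl V e \<longleftrightarrow> (\<exists>c \<phi>. c > c_lin V e \<and> pushed_front_profile V e c \<phi>))
       \<and> (c_lin V e < c_nl V e \<longrightarrow>
            (\<exists>\<phi>. pushed_front_profile V e (c_nl V e) \<phi>) \<and>
            (\<forall>\<phi>. pushed_front_profile V e (c_nl V e) \<phi> \<longrightarrow>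
                 global_minimizer V (c_nl V e) e \<phi>))"
proof -
  interpret invaded_potential V e by unfold_locales (fact assms)+
  show ?thesis
    using pushed_front_exists pushed_front_minimises pushed_front_speed_le_c_nl by (meson less_le_trans)
qed

end
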